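(* Let $(X,\mu,T_1,\ldots,T_d)$ be an ergodic measure preserving system with commuting transformations. Then there exists a collection of probability measures $\{\mu^{F}_x\}_{x\in X}$ on $X^d$ such that for $\mu$-a.e. $x\in X$ the measure $\mu^{F}_x$ is (invariant and) ergodic for $T_1\times T_2\times\cdots\times T_d$, and such that for all $f_1,\ldots,f_d\in L^\infty(\mu)$ the $L^2(\mu)$-limit $$\lim_{N\to \infty} \frac{1}{N}\sum_{n=0}^{N-1} f_1(T_1^nx)f_2(T_2^nx)\cdots f_d(T_d^nx)$$ is equal to the function $$x\mapsto\int_{X^d} f_1\otimes f_2\otimes\cdots\otimes f_d \; d\mu^{F}_x .$$
   Context: A measure preserving system with commuting transformations $(X,\mu,T_1,\ldots,T_d)$ is a standard probability space $(X,\mathcal X,\mu)$ with $d$ commuting invertible measure preserving transformations. It is ergodic if every $A\in\mathcal X$ invariant under all of $T_1,\ldots,T_d$ has $\mu(A)\in\{0,1\}$ (the individual $T_i$ need not be ergodic). $f_1\otimes\cdots\otimes f_d(x_1,\ldots,x_d)=f_1(x_1)\cdots f_d(x_d)$. The existence of the $L^2(\mu)$-limit is a known theorem. *)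

theory Defs
  imports "HOL-Probability.Probability"
begin

section \<open>Standard probability spaces\<close>

text \<open>
  Standardness refers to the Borel \<open>\<sigma>\<close>-algebra of a Polish topology on the underlying set,
  without completion: every measurable set is Borel for that topology.
\<close>

definition standard_borel :: "'a measure \<Rightarrow> bool" where
  "standard_borel M \<longleftrightarrow>
     (\<exists>X. completely_metrizable_space X \<and> second_countable X \<and>
          space M = topspace X \<and> sets M = sigma_sets (topspace X) {U. openin X U})"

section \<open>Measure preserving transformations and ergodicity\<close>

definition measure_preserving :: "'a measure \<Rightarrow> ('a \<Rightarrow> 'a) \<Rightarrow> bool" where
  "measure_preserving M S \<longleftrightarrow> S \<in> measurable M M \<and> distr M M S = M"

text \<open>
  Ergodicity for a set \<open>\<S>\<close> of transformations: only sets that are invariant under all members of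
  \<open>\<S>\<close> simultaneously are required to be trivial.
\<close>

definition ergodic_under :: "'a measure \<Rightarrow> ('a \<Rightarrow> 'a) set \<Rightarrow> bool" where
  "ergodic_under M \<S> \<longleftrightarrow>
     (\<forall>A \<in> sets M. (\<forall>S\<in>\<S>. S -` A \<inter> space M = A) \<longrightarrow> measure M A \<in> {0, 1})"

locale commuting_system = prob_space M
  for M :: "'a measure" and d :: nat and T :: "nat \<Rightarrow> 'a \<Rightarrow> 'a" +
  assumes standard: "standard_borel M"
    and dim_pos: "1 \<le> d"
    and preserving: "i \<in> {1..d} \<Longrightarrow> measure_preserving M (T i)"
    and invertible: "i \<in> {1..d} \<Longrightarrow> bij_betw (T i) (space M) (space M)"
    and inverse_measurable: "i \<in> {1..d} \<Longrightarrow> the_inv_into (space M) (T i) \<in> measurable M M"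
    and commute: "i \<in> {1..d} \<Longrightarrow> j \<in> {1..d} \<Longrightarrow> x \<in> space M \<Longrightarrow> T i (T j x) = T j (T i x)"

locale ergodic_commuting_system = commuting_system +
  assumes ergodic: "ergodic_under M (T ` {1..d})"

section \<open>The product system on \<open>X\<^sup>d\<close>\<close>

abbreviation power_space :: "'a measure \<Rightarrow> nat \<Rightarrow> (nat \<Rightarrow> 'a) measure" where
  "power_space M d \<equiv> PiM {1..d} (\<lambda>_. M)"

definition product_map :: "nat \<Rightarrow> (nat \<Rightarrow> 'a \<Rightarrow> 'a) \<Rightarrow> (nat \<Rightarrow> 'a) \<Rightarrow> (nat \<Rightarrow> 'a)" where
  "product_map d T \<omega> = (\<lambda>i\<in>{1..d}. T i (\<omega> i))"

definition tensor :: "nat \<Rightarrow> (nat \<Rightarrow> 'a \<Rightarrow> complex) \<Rightarrow> (nat \<Rightarrow> 'a) \<Rightarrow> complex" where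
  "tensor d f \<omega> = (\<Prod>i\<in>{1..d}. f i (\<omega> i))"

section \<open>\<open>L\<^sup>\<infinity>\<close>, \<open>L\<^sup>2\<close> and multiple ergodic averages\<close>

text \<open>Functions here are representatives; they are not identified up to null sets.\<close>

definition Linfty :: "'a measure \<Rightarrow> ('a \<Rightarrow> complex) set" where
  "Linfty M = {f \<in> borel_measurable M. \<exists>C. AE x in M. norm (f x) \<le> C}"

definition L2 :: "'a measure \<Rightarrow> ('a \<Rightarrow> complex) set" where
  "L2 M = {f \<in> borel_measurable M. integrable M (\<lambda>x. (norm (f x))\<^sup>2)}"

definition tendsto_L2 :: "'a measure \<Rightarrow> (nat \<Rightarrow> 'a \<Rightarrow> complex) \<Rightarrow> ('a \<Rightarrow> complex) \<Rightarrow> bool" where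
  "tendsto_L2 M u g \<longleftrightarrow> (\<forall>N. u N \<in> L2 M) \<and> g \<in> L2 M \<and>
     (\<lambda>N. \<integral>x. (norm (u N x - g x))\<^sup>2 \<partial>M) \<longlonglongrightarrow> 0"

definition multiple_average ::
  "nat \<Rightarrow> (nat \<Rightarrow> 'a \<Rightarrow> 'a) \<Rightarrow> (nat \<Rightarrow> 'a \<Rightarrow> complex) \<Rightarrow> nat \<Rightarrow> 'a \<Rightarrow> complex" where
  "multiple_average d T f N x =
     1 / of_nat N * (\<Sum>n<N. \<Prod>i\<in>{1..d}. f i ((T i ^^ n) x))"

end

theory Submission
  imports Defs
begin

text \<open>
  Norm convergence is proved by Walsh's argument in the form of an ultralimit. If the averages of a
  function in slot \<open>j\<close> do not become small, then that function correlates with some \<open>\<sigma>\<close> such that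
  \<open>\<sigma> \<circ> T j ^^ l\<close> is, up to a small error, a mean of products of a factor independent of \<open>l\<close> and
  functions composed with \<open>T i ^^ l\<close> for \<open>i \<noteq> j\<close>. For such \<open>\<sigma>\<close> the averages converge by induction on
  the number of transformations, and a projection onto the space of all functions with convergent
  averages concludes. The convergence is uniform over all windows \<open>{a..<a+N}\<close>.

  The space \<open>X\<close> is coded as a retract of a Cantor space, where a weak limit of the empirical measures
  of the orbit of \<open>(x, \<dots>, x)\<close> under \<open>S = T\<^sub>1 \<times> \<dots> \<times> T\<^sub>d\<close> along a suitable subsequence is a measure
  by compactness. Its image is \<open>\<mu>F x\<close>.

  Ergodicity follows from uniformity: for a product set \<open>R\<close>, the integral over \<open>x\<close> of the square of
  the \<open>L\<^sup>2(\<mu>F x)\<close>-norm of the average of \<open>1\<^sub>R \<circ> S ^^ h\<close> over \<open>h < H\<close> is the Cesaro limit over \<open>n\<close> of the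
  squared \<open>L\<^sup>2(\<mu>)\<close>-norms of the multiple averages over \<open>{n..<n+H}\<close>. Uniformly in \<open>n\<close> these are close
  to the integral of \<open>(\<mu>F x R)\<^sup>2\<close>, so the averages along \<open>S\<close> converge to constants in \<open>L\<^sup>2(\<mu>F x)\<close>.
\<close>

section \<open>Limits along an ultrafilter\<close>

text \<open>Ultralimits replace the nested error terms of the quantitative argument. The price is
  that the mean on functions is only finitely additive, and that each step of the induction on slots
  brings one more averaging variable. Hence the induction is stated for arbitrary positive,
  normalised, invariant functionals on functions with a list of parameters, a class that both
  operations preserve. Such a functional has no complete \<open>L\<^sup>2\<close> space at hand, so
  projections are taken up to a small error. Uniformity in the window costs nothing: the shift error
  is start plus length of the window divided by a length that tends to infinity in the ultralimit,
  so it vanishes for each fixed window. It is, however, the input for ergodicity, where windows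
  starting at every time occur. Norm convergence gives no limit along single orbits, so the measures
  are built along lengths on which countably many cylinder averages converge almost everywhere.
  Countability also provides one null set that serves all invariant sets simultaneously.\<close>

lemma ex_nonprincipal_ultrafilter:
  "\<exists>U :: nat filter. U \<noteq> bot \<and> U \<le> sequentially \<and>
     (\<forall>P. eventually P U \<or> eventually (\<lambda>n. \<not> P n) U)"
proof -
  define \<F> where "\<F> = {F :: nat filter. F \<noteq> bot \<and> F \<le> sequentially}"
  \<comment> \<open>The order is reversed because a finer filter is a smaller one: Zorn's lemma is
    to produce a minimal proper filter.\<close>
  let ?r = "relation_of (\<lambda>F G. G \<le> F) \<F>"
  have "\<exists>U\<in>\<F>. \<forall>F\<in>\<F>. F \<le> U \<longrightarrow> F = U"
  proof (rule predicate_Zorn)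
    show "partial_order_on \<F> ?r"
      unfolding partial_order_on_def preorder_on_def refl_on_def trans_on_def antisym_on_def relation_of_def
      by auto
  next
    fix C assume C: "C \<in> Chains ?r"
    then have CF: "C \<subseteq> \<F>"
      by (auto simp: Chains_def relation_of_def)
    show "\<exists>U\<in>\<F>. \<forall>F\<in>C. U \<le> F"
    proof (cases "C = {}")
      case True
      then show ?thesis unfolding \<F>_def by (auto intro!: exI[of _ sequentially])
    next
      case False
      \<comment> \<open>A chain is directed, so whatever holds eventually for \<open>Inf C\<close>
        does so for one of its members. The infimum of proper filters is therefore proper.\<close>
      have "\<exists>x\<in>C. x \<le> inf F G" if "F \<in> C" "G \<in> C" for F G
        using C that by (auto simp: Chains_def relation_of_def)
      then have ev: "eventually P (Inf C) \<longleftrightarrow> (\<exists>b\<in>C. eventually P b)" for P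
        using eventually_Inf_base[OF False] by blast
      have "Inf C \<noteq> bot"
        unfolding eventually_False[symmetric] ev using CF by (auto simp: \<F>_def eventually_False)
      moreover have "Inf C \<le> sequentially"
        using False CF by (auto simp: \<F>_def intro: Inf_lower2)
      ultimately show ?thesis
        by (auto simp: \<F>_def intro: Inf_lower bexI[of _ "Inf C"])
    qed
  qed
  then obtain U where U: "U \<noteq> bot" "U \<le> sequentially"
    and max: "\<And>F. F \<noteq> bot \<Longrightarrow> F \<le> sequentially \<Longrightarrow> F \<le> U \<Longrightarrow> F = U"
    by (auto simp: \<F>_def)
  \<comment> \<open>Adjoining \<open>P\<close> to \<open>U\<close> either destroys properness, so
    that the negation holds eventually, or changes nothing by minimality.\<close>
  have "eventually P U \<or> eventually (\<lambda>n. \<not> P n) U" for P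
  proof (cases "inf U (principal {n. P n}) = bot")
    case True
    then have "eventually (\<lambda>_. False) (inf U (principal {n. P n}))"
      by simp
    then show ?thesis
      by (auto simp: eventually_inf_principal)
  next
    case False
    then have "inf U (principal {n. P n}) = U"
      using U(2) by (intro max) (auto intro: le_infI1)
    moreover have "eventually P (inf U (principal {n. P n}))"
      by (simp add: eventually_inf_principal)
    ultimately show ?thesis by simp
  qed
  with U show ?thesis by blast
qed

definition ultra :: "nat filter" where
  "ultra = (SOME U. U \<noteq> bot \<and> U \<le> sequentially \<and>
     (\<forall>P. eventually P U \<or> eventually (\<lambda>n. \<not> P n) U))"

lemma ultra_nontrivial [simp]: "ultra \<noteq> bot"
  and ultra_le_sequentially: "ultra \<le> sequentially"
  and ultra_cases: "eventually P ultra \<or> eventually (\<lambda>n. \<not> P n) ultra"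
  using someI_ex[OF ex_nonprincipal_ultrafilter] unfolding ultra_def by blast+

definition ulim :: "(nat \<Rightarrow> real) \<Rightarrow> real" where
  "ulim f = Lim ultra f"

text \<open>A filter on a compact interval has a cluster point, and a cluster point of an
  ultrafilter is its limit: a neighbourhood that is not eventually visited would be eventually
  avoided.\<close>

lemma tendsto_ulim:
  assumes "\<And>n. \<bar>f n\<bar> \<le> C"
  shows "(f \<longlongrightarrow> ulim f) ultra"
proof -
  have "filtermap f ultra \<noteq> bot"
    by (simp add: filtermap_bot_iff)
  moreover have "eventually (\<lambda>x. x \<in> {-C..C}) (filtermap f ultra)"
    using assms by (auto simp: eventually_filtermap abs_le_iff minus_le_iff)
  ultimately obtain l where l: "inf (nhds l) (filtermap f ultra) \<noteq> bot"
    using compact_filter[of "{-C..C}"] compact_Icc by metis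
  have "(f \<longlongrightarrow> l) ultra"
  proof (rule topological_tendstoI)
    fix S assume S: "open S" "l \<in> S"
    show "eventually (\<lambda>x. f x \<in> S) ultra"
    proof (rule ccontr)
      assume "\<not> ?thesis"
      then have "eventually (\<lambda>x. f x \<notin> S) ultra"
        using ultra_cases by blast
      then have "eventually (\<lambda>_. False) (inf (nhds l) (filtermap f ultra))"
        unfolding eventually_inf using S
        by (intro exI[of _ "\<lambda>x. x \<in> S"] exI[of _ "\<lambda>x. x \<notin> S"])
           (auto simp: eventually_filtermap eventually_nhds)
      with l show False by (simp add: eventually_False)
    qed
  qed
  then show ?thesis
    unfolding ulim_def using tendsto_Lim[OF ultra_nontrivial] by blast
qed

lemma ulim_eqI: "(f \<longlongrightarrow> l) ultra \<Longrightarrow> ulim f = l"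
  unfolding ulim_def by (rule tendsto_Lim) simp_all

lemma ulim_eq_limit: "f \<longlonglongrightarrow> l \<Longrightarrow> ulim f = l"
  by (rule ulim_eqI) (rule tendsto_mono[OF ultra_le_sequentially])

lemma ulim_const [simp]: "ulim (\<lambda>_. c) = c"
  by (rule ulim_eq_limit) simp

section \<open>Convergence of multiple averages\<close>

text \<open>Each unit shift exchanges one term at either end of the window, so the cost grows with
  \<open>l\<close> but not with \<open>N\<close>; after division by a large \<open>N\<close> it is
  negligible.\<close>

lemma window_shift:
  fixes g :: "nat \<Rightarrow> real"
  assumes "\<And>m. \<bar>g m\<bar> \<le> 1"
  shows "\<bar>(\<Sum>m\<in>{b..<b+N}. g m) - (\<Sum>m\<in>{b..<b+N}. g (m + l))\<bar> \<le> 2 * real l"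
proof (induction l)
  case (Suc l)
  have "(\<Sum>m\<in>{b..<b+N}. g (m + Suc l)) - (\<Sum>m\<in>{b..<b+N}. g (m + l)) = g (b + N + l) - g (b + l)"
    using sum_Suc_diff'[of b "b + N" "\<lambda>m. g (m + l)"] by (simp add: sum_subtractf)
  moreover have "\<bar>u - w\<bar> \<le> 2 * real (Suc l)"
    if "w - v = c - d" "\<bar>u - v\<bar> \<le> 2 * real l" "\<bar>c\<bar> \<le> 1" "\<bar>d\<bar> \<le> 1" for u v w c d :: real
    using that by auto
  ultimately show ?case
    using Suc assms[of "b + N + l"] assms[of "b + l"] by blast
qed simp

lemma funpow_commute_apply:
  assumes "\<And>x. f (g x) = g (f x)"
  shows "(f ^^ n) ((g ^^ m) x) = (g ^^ m) ((f ^^ n) x)"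
proof -
  have *: "f ((g ^^ m) x) = (g ^^ m) (f x)" for x
    by (induction m) (simp_all add: assms)
  show ?thesis
    by (induction n) (simp_all add: *)
qed

lemma abs_prod_le_1:
  fixes g :: "'i \<Rightarrow> real"
  assumes "\<And>i. i \<in> J \<Longrightarrow> \<bar>g i\<bar> \<le> 1"
  shows "\<bar>\<Prod>i\<in>J. g i\<bar> \<le> 1"
  unfolding abs_prod using assms by (intro prod_le_1) auto

lemma abs_average_le:
  fixes g :: "nat \<Rightarrow> real"
  assumes "\<And>n. \<bar>g n\<bar> \<le> C"
  shows "\<bar>(\<Sum>n\<in>{a..<a+N}. g n) / real N\<bar> \<le> C"
proof (cases "N = 0")
  case True
  then show ?thesis using assms[of 0] by simp
next
  case False
  have "\<bar>\<Sum>n\<in>{a..<a+N}. g n\<bar> \<le> (\<Sum>n\<in>{a..<a+N}. C)"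
    by (rule order_trans[OF sum_abs sum_mono]) (rule assms)
  then show ?thesis
    using False by (simp add: abs_divide divide_le_eq mult.commute)
qed

section \<open>Bounded functions with parameters, and invariant means on them\<close>

locale commuting_maps =
  fixes M :: "'a measure" and T S :: "nat \<Rightarrow> 'a \<Rightarrow> 'a"
  assumes measurable_T [measurable]: "T i \<in> measurable M M"
    and measurable_S [measurable]: "S i \<in> measurable M M"
    and S_T [simp]: "S i (T i x) = x"
    and T_S [simp]: "T i (S i x) = x"
    and T_commute: "T i (T j x) = T j (T i x)"
begin

lemma measurable_pow_T [measurable]: "T i ^^ n \<in> measurable M M"
  by (induction n) simp_all

lemma measurable_pow_S [measurable]: "S i ^^ n \<in> measurable M M"
  by (induction n) simp_all

lemma S_T_commute: "S i (T j x) = T j (S i x)"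
  by (metis S_T T_S T_commute)

lemma pow_S_T: "(S i ^^ m) ((T j ^^ n) x) = (T j ^^ n) ((S i ^^ m) x)"
  by (rule funpow_commute_apply) (rule S_T_commute)

lemma pow_S_pow_T: "(S i ^^ n) ((T i ^^ n) x) = x"
  by (induction n arbitrary: x) (simp_all add: funpow_swap1)

lemma pow_S_add_pow_T: "(S i ^^ (m + n)) ((T i ^^ n) x) = (S i ^^ m) x"
  by (simp add: funpow_add pow_S_pow_T)

text \<open>
  The first argument of a function in \<open>BM\<close> is a parameter on which the maps do not act: the head of
  the list is the index of an ultralimit, and the following entries are averaging variables.
\<close>

definition BM :: "(nat list \<Rightarrow> 'a \<Rightarrow> real) set" where
  "BM = {F. (\<forall>y. F y \<in> borel_measurable M) \<and> (\<exists>C. \<forall>y x. \<bar>F y x\<bar> \<le> C)}"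

definition BM1 :: "(nat list \<Rightarrow> 'a \<Rightarrow> real) set" where
  "BM1 = {F \<in> BM. \<forall>y x. \<bar>F y x\<bar> \<le> 1}"

lemma BM1_BM: "F \<in> BM1 \<Longrightarrow> F \<in> BM"
  by (simp add: BM1_def)

lemma BM1_bound: "F \<in> BM1 \<Longrightarrow> \<bar>F y x\<bar> \<le> 1"
  by (simp add: BM1_def)

lemma BM1I:
  assumes "\<And>y. F y \<in> borel_measurable M" "\<And>y x. \<bar>F y x\<bar> \<le> 1"
  shows "F \<in> BM1"
  using assms by (auto simp: BM1_def BM_def)

lemma BM_measurable: "F \<in> BM \<Longrightarrow> F y \<in> borel_measurable M"
  by (simp add: BM_def)

lemma BM_bound:
  assumes "F \<in> BM"
  obtains C where "C > 0" "\<And>y x. \<bar>F y x\<bar> \<le> C"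
proof -
  obtain C where "\<And>y x. \<bar>F y x\<bar> \<le> C"
    using assms by (auto simp: BM_def)
  then have "\<bar>F y x\<bar> \<le> max C 1" for y x
    by (meson max.coboundedI1)
  then show ?thesis using that[of "max C 1"] by auto
qed

lemma BM_const: "(\<lambda>_ _. c) \<in> BM"
  by (auto simp: BM_def)

lemma BM_add: "F \<in> BM \<Longrightarrow> G \<in> BM \<Longrightarrow> (\<lambda>y x. F y x + G y x) \<in> BM"
  unfolding BM_def mem_Collect_eq
  by (blast intro: order_trans[OF abs_triangle_ineq add_mono] borel_measurable_add)

lemma BM_mult:
  assumes "F \<in> BM" "G \<in> BM"
  shows "(\<lambda>y x. F y x * G y x) \<in> BM"
proof -
  obtain C where "C > 0" "\<And>y x. \<bar>F y x\<bar> \<le> C" using BM_bound[OF assms(1)] by blast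
  moreover obtain D where "D > 0" "\<And>y x. \<bar>G y x\<bar> \<le> D" using BM_bound[OF assms(2)] by blast
  ultimately have "\<bar>F y x * G y x\<bar> \<le> C * D" for y x
    unfolding abs_mult by (intro mult_mono) (auto intro: less_imp_le)
  then show ?thesis
    using assms by (auto simp: BM_def intro: borel_measurable_times)
qed

lemma BM_diff:
  assumes "F \<in> BM" "G \<in> BM"
  shows "(\<lambda>y x. F y x - G y x) \<in> BM"
  using BM_add[OF assms(1) BM_mult[OF BM_const[of "-1"] assms(2)]] by simp

lemma BM_divide: "F \<in> BM \<Longrightarrow> (\<lambda>y x. F y x / c) \<in> BM"
  using BM_mult[OF _ BM_const[of "1 / c"]] by simp

lemma BM_sum: "(\<And>i. i \<in> A \<Longrightarrow> F i \<in> BM) \<Longrightarrow> (\<lambda>y x. \<Sum>i\<in>A. F i y x) \<in> BM"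
  by (induction A rule: infinite_finite_induct) (simp_all add: BM_const BM_add)

lemma BM_prod: "(\<And>i. i \<in> A \<Longrightarrow> F i \<in> BM) \<Longrightarrow> (\<lambda>y x. \<Prod>i\<in>A. F i y x) \<in> BM"
  by (induction A rule: infinite_finite_induct) (simp_all add: BM_const BM_mult)

lemma BM_abs: "F \<in> BM \<Longrightarrow> (\<lambda>y x. \<bar>F y x\<bar>) \<in> BM"
  by (auto simp: BM_def intro: borel_measurable_abs)

lemma BM_compose: "F \<in> BM \<Longrightarrow> h \<in> measurable M M \<Longrightarrow> (\<lambda>y x. F y (h x)) \<in> BM"
  by (auto simp: BM_def intro: measurable_compose)

lemma BM_pow_T: "F \<in> BM \<Longrightarrow> (\<lambda>y x. F y ((T i ^^ n) x)) \<in> BM"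
  by (rule BM_compose) simp_all

lemma BM_pow_S: "F \<in> BM \<Longrightarrow> (\<lambda>y x. F y ((S i ^^ n) x)) \<in> BM"
  by (rule BM_compose) simp_all

lemma BM_reindex: "F \<in> BM \<Longrightarrow> (\<lambda>y. F (g y)) \<in> BM"
  by (auto simp: BM_def)

lemmas BM_intros = BM_const BM_add BM_diff BM_mult BM_divide BM_sum BM_prod BM_abs
  BM_pow_T BM_pow_S

text \<open>Only finite additivity is demanded, because the class has to contain ultralimits of
  integrals. Invariance concerns the point of the system alone; the parameters are inert.\<close>

definition invariant_mean :: "((nat list \<Rightarrow> 'a \<Rightarrow> real) \<Rightarrow> real) \<Rightarrow> bool" where
  "invariant_mean e \<longleftrightarrow>
     (\<forall>F\<in>BM. \<forall>G\<in>BM. e (\<lambda>y x. F y x + G y x) = e F + e G) \<and>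
     (\<forall>F\<in>BM. \<forall>c. e (\<lambda>y x. c * F y x) = c * e F) \<and>
     (\<forall>F\<in>BM. \<forall>G\<in>BM. (\<forall>y x. F y x \<le> G y x) \<longrightarrow> e F \<le> e G) \<and>
     e (\<lambda>_ _. 1) = 1 \<and>
     (\<forall>F\<in>BM. \<forall>i. e (\<lambda>y x. F y (T i x)) = e F)"

context
  fixes e assumes e: "invariant_mean e"
begin

lemma mean_add: "F \<in> BM \<Longrightarrow> G \<in> BM \<Longrightarrow> e (\<lambda>y x. F y x + G y x) = e F + e G"
  and mean_cmult: "F \<in> BM \<Longrightarrow> e (\<lambda>y x. c * F y x) = c * e F"
  and mean_mono: "F \<in> BM \<Longrightarrow> G \<in> BM \<Longrightarrow> (\<And>y x. F y x \<le> G y x) \<Longrightarrow> e F \<le> e G"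
  and mean_one: "e (\<lambda>_ _. 1) = 1"
  and mean_T: "F \<in> BM \<Longrightarrow> e (\<lambda>y x. F y (T i x)) = e F"
  using e unfolding invariant_mean_def by blast+

lemma mean_const: "e (\<lambda>_ _. c) = c"
  using mean_cmult[OF BM_const[of 1], of c] by (simp add: mean_one)

lemma mean_divide: "F \<in> BM \<Longrightarrow> e (\<lambda>y x. F y x / c) = e F / c"
  using mean_cmult[of F "1 / c"] by simp

lemma mean_sum:
  "(\<And>i. i \<in> A \<Longrightarrow> F i \<in> BM) \<Longrightarrow> e (\<lambda>y x. \<Sum>i\<in>A. F i y x) = (\<Sum>i\<in>A. e (F i))"
proof (induction A rule: infinite_finite_induct)
  case (insert a A)
  then have "F a \<in> BM" "(\<lambda>y x. \<Sum>i\<in>A. F i y x) \<in> BM"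
    by (auto intro: BM_sum)
  with insert show ?case
    using mean_add[of "F a" "\<lambda>y x. \<Sum>i\<in>A. F i y x"] by simp
qed (simp_all add: mean_const)

lemma mean_pow_T: "F \<in> BM \<Longrightarrow> e (\<lambda>y x. F y ((T i ^^ n) x)) = e F"
proof (induction n)
  case (Suc n)
  then show ?case
    using mean_T[OF BM_pow_T[OF Suc.prems, of n i], of i] by (simp add: funpow_swap1)
qed simp

lemma mean_abs_le:
  assumes "F \<in> BM" "\<And>y x. \<bar>F y x\<bar> \<le> C"
  shows "\<bar>e F\<bar> \<le> C"
proof -
  have "F y x \<le> C" "-C \<le> F y x" for y x
    using assms(2)[of y x] by linarith+
  then show ?thesis
    using mean_mono[OF assms(1) BM_const[of C]] mean_mono[OF BM_const[of "-C"] assms(1)]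
    by (auto simp: mean_const abs_le_iff)
qed

end

text \<open>As in an ultraproduct, a function chosen separately for each index \<open>k\<close>
  counts as one function: the index is the head of its parameter list.\<close>

definition ult :: "(nat \<Rightarrow> (nat list \<Rightarrow> 'a \<Rightarrow> real) \<Rightarrow> real) \<Rightarrow> (nat list \<Rightarrow> 'a \<Rightarrow> real) \<Rightarrow> real"
  where "ult e F = ulim (\<lambda>k. e k (\<lambda>y. F (k # y)))"

lemma mean_section_le:
  assumes "\<And>k. invariant_mean (e k)" "F \<in> BM" "\<And>y x. \<bar>F y x\<bar> \<le> C"
  shows "\<bar>e k (\<lambda>y. F (k # y))\<bar> \<le> C"
  by (rule mean_abs_le[OF assms(1)]) (use assms in \<open>auto intro: BM_reindex\<close>)

lemma tendsto_ult:
  assumes "\<And>k. invariant_mean (e k)" "F \<in> BM"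
  shows "((\<lambda>k. e k (\<lambda>y. F (k # y))) \<longlongrightarrow> ult e F) ultra"
proof -
  obtain C where "C > 0" and C: "\<And>y x. \<bar>F y x\<bar> \<le> C" by (rule BM_bound[OF assms(2)]) (rule that)
  have "\<bar>e k (\<lambda>y. F (k # y))\<bar> \<le> C" for k
    by (rule mean_section_le) (fact assms C)+
  then show ?thesis
    unfolding ult_def by (rule tendsto_ulim)
qed

lemma invariant_mean_ult:
  assumes e: "\<And>k. invariant_mean (e k)"
  shows "invariant_mean (ult e)"
proof -
  note lim = tendsto_ult[of e, OF e]
  have "ult e (\<lambda>y x. F y x + G y x) = ult e F + ult e G" if F: "F \<in> BM" and G: "G \<in> BM" for F G
    unfolding ult_def[of e "\<lambda>y x. F y x + G y x"]
    using tendsto_add[OF lim[OF F] lim[OF G]]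
    by (intro ulim_eqI) (simp add: mean_add[OF e] BM_reindex F G)
  moreover have "ult e (\<lambda>y x. c * F y x) = c * ult e F" if F: "F \<in> BM" for F c
    unfolding ult_def[of e "\<lambda>y x. c * F y x"]
    using tendsto_mult[OF tendsto_const lim[OF F]]
    by (intro ulim_eqI) (simp add: mean_cmult[OF e] BM_reindex F)
  moreover have "ult e F \<le> ult e G" if F: "F \<in> BM" and G: "G \<in> BM" and le: "\<forall>y x. F y x \<le> G y x" for F G
    by (rule tendsto_le[OF ultra_nontrivial lim[OF G] lim[OF F]])
       (use F G le in \<open>auto intro!: always_eventually mean_mono[OF e] BM_reindex\<close>)
  moreover have "ult e (\<lambda>_ _. 1) = 1"
    by (simp add: ult_def mean_one[OF e])
  moreover have "ult e (\<lambda>y x. F y (T i x)) = ult e F" if F: "F \<in> BM" for F i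
    unfolding ult_def by (simp add: mean_T[OF e BM_reindex[OF F]])
  ultimately show ?thesis
    unfolding invariant_mean_def by blast
qed

text \<open>The averaging variable is the head of the list seen by \<open>e\<close>. Once
  \<open>ult\<close> is applied it therefore stands in second place, behind the index.\<close>

lemma invariant_mean_average:
  assumes e: "invariant_mean e" and N: "N > 0"
  shows "invariant_mean (\<lambda>F. (\<Sum>m\<in>{b..<b+N}. e (\<lambda>y. F (m # y))) / real N)"
  unfolding invariant_mean_def
  using N by (auto simp: mean_add[OF e] mean_cmult[OF e] mean_T[OF e BM_reindex] mean_one[OF e] BM_reindex
      sum.distrib add_divide_distrib sum_distrib_left
      intro!: divide_right_mono sum_mono mean_mono[OF e])

section \<open>Averages over a window, and removal of one slot\<close>

definition avg :: "nat set \<Rightarrow> (nat \<Rightarrow> nat list \<Rightarrow> 'a \<Rightarrow> real) \<Rightarrow> nat \<Rightarrow> nat \<Rightarrow> nat list \<Rightarrow> 'a \<Rightarrow> real"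
  where "avg J f a N y x = (\<Sum>n\<in>{a..<a+N}. \<Prod>i\<in>J. f i y ((T i ^^ n) x)) / real N"

lemma BM_avg: "(\<And>i. i \<in> J \<Longrightarrow> f i \<in> BM) \<Longrightarrow> avg J f a N \<in> BM"
  unfolding avg_def by (intro BM_intros)

lemma avg_insert:
  assumes "finite J" "j \<notin> J"
  shows "avg (insert j J) (f(j := g)) a N y x =
    (\<Sum>n\<in>{a..<a+N}. g y ((T j ^^ n) x) * (\<Prod>i\<in>J. f i y ((T i ^^ n) x))) / real N"
proof -
  have "(\<Prod>i\<in>J. (f(j := g)) i y ((T i ^^ n) x)) = (\<Prod>i\<in>J. f i y ((T i ^^ n) x))" for n
    using assms by (intro prod.cong) auto
  then show ?thesis
    using assms by (simp add: avg_def)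
qed

text \<open>
  The shifted windows \<open>{b..<b+N}\<close> and \<open>{b+l..<b+l+N}\<close> differ by few points, so
  \<open>T j ^^ l\<close> can be moved off a function of the form \<open>\<sigma>\<close> at the cost of a small error;
  this removes the slot \<open>j\<close> from the average.
\<close>

lemma average_reducible:
  fixes f :: "nat \<Rightarrow> 'a \<Rightarrow> real" and s :: "'a \<Rightarrow> real" and b :: nat and j :: nat
  assumes f: "\<And>i x. i \<in> J \<Longrightarrow> \<bar>f i x\<bar> \<le> 1" and s: "\<And>x. \<bar>s x\<bar> \<le> 1" and N: "N > 0"
  defines "\<sigma> \<equiv> \<lambda>z. (\<Sum>m\<in>{b..<b+N}. s ((S j ^^ m) z) * (\<Prod>i\<in>J. f i ((T i ^^ m) ((S j ^^ m) z)))) / real N"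
  shows "\<bar>(\<Sum>l\<in>{a..<a+n}. \<sigma> ((T j ^^ l) x) * (\<Prod>i\<in>J. f i ((T i ^^ l) x))) / real n
      - (\<Sum>m\<in>{b..<b+N}. s ((S j ^^ m) x) *
          ((\<Sum>l\<in>{a..<a+n}. \<Prod>i\<in>J. f i ((T i ^^ l) x) * f i ((T i ^^ m) ((S j ^^ m) ((T i ^^ l) x)))) / real n)) / real N\<bar>
    \<le> 2 * real (a + n) / real N"
proof -
  define p where "p l = (\<Prod>i\<in>J. f i ((T i ^^ l) x))" for l
  define q where "q m l = (\<Prod>i\<in>J. f i ((T i ^^ m) ((S j ^^ m) ((T i ^^ l) x))))" for m l
  define \<tau> where "\<tau> l = (\<Sum>m\<in>{b..<b+N}. s ((S j ^^ m) x) * q m l) / real N" for l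
  have p1: "\<bar>p l\<bar> \<le> 1" for l
    unfolding p_def by (rule abs_prod_le_1) (rule f)
  \<comment> \<open>At \<open>(T j ^^ l) x\<close> the term of \<open>\<sigma>\<close> with index
    \<open>m + l\<close> contains \<open>s\<close> only at \<open>(S j ^^ m) x\<close>, free of
    \<open>l\<close>. So \<open>\<tau>\<close> is \<open>\<sigma>\<close> up to a shift of the
    window by \<open>l\<close>.\<close>
  have close: "\<bar>\<sigma> ((T j ^^ l) x) - \<tau> l\<bar> \<le> 2 * real l / real N" for l
  proof -
    define g where "g m = s ((S j ^^ m) ((T j ^^ l) x)) * (\<Prod>i\<in>J. f i ((T i ^^ m) ((S j ^^ m) ((T j ^^ l) x))))" for m
    have "\<bar>g m\<bar> \<le> 1" for m
      unfolding g_def abs_mult using abs_prod_le_1[of J, OF f] s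
      by (intro mult_le_one) auto
    from window_shift[where g = g, OF this, where b = b and N = N and l = l]
    have "\<bar>(\<Sum>m\<in>{b..<b+N}. g m) - (\<Sum>m\<in>{b..<b+N}. g (m + l))\<bar> / real N \<le> 2 * real l / real N"
      by (rule divide_right_mono) simp
    moreover have "g (m + l) = s ((S j ^^ m) x) * q m l" for m
    proof -
      have "(T i ^^ (m + l)) ((S j ^^ m) x) = (T i ^^ m) ((S j ^^ m) ((T i ^^ l) x))" for i
        by (simp add: funpow_add pow_S_T)
      then show ?thesis
        by (simp add: g_def q_def pow_S_add_pow_T)
    qed
    ultimately show ?thesis
      by (simp add: \<sigma>_def \<tau>_def g_def abs_divide flip: diff_divide_distrib)
  qed
  have "(\<Sum>m\<in>{b..<b+N}. s ((S j ^^ m) x) *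
      ((\<Sum>l\<in>{a..<a+n}. \<Prod>i\<in>J. f i ((T i ^^ l) x) * f i ((T i ^^ m) ((S j ^^ m) ((T i ^^ l) x)))) / real n)) / real N
    = (\<Sum>m\<in>{b..<b+N}. \<Sum>l\<in>{a..<a+n}. s ((S j ^^ m) x) * q m l * p l) / (real n * real N)"
    by (simp add: prod.distrib p_def q_def sum_distrib_left sum_divide_distrib mult_ac)
  also have "\<dots> = (\<Sum>l\<in>{a..<a+n}. \<tau> l * p l) / real n"
    by (subst sum.swap) (simp add: \<tau>_def sum_distrib_right sum_divide_distrib mult.commute[of "real n"])
  finally have "(\<Sum>l\<in>{a..<a+n}. \<sigma> ((T j ^^ l) x) * p l) / real n
      - (\<Sum>m\<in>{b..<b+N}. s ((S j ^^ m) x) *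
          ((\<Sum>l\<in>{a..<a+n}. \<Prod>i\<in>J. f i ((T i ^^ l) x) * f i ((T i ^^ m) ((S j ^^ m) ((T i ^^ l) x)))) / real n)) / real N
      = (\<Sum>l\<in>{a..<a+n}. (\<sigma> ((T j ^^ l) x) - \<tau> l) * p l) / real n"
    by (simp add: left_diff_distrib sum_subtractf diff_divide_distrib)
  moreover have "\<bar>\<Sum>l\<in>{a..<a+n}. (\<sigma> ((T j ^^ l) x) - \<tau> l) * p l\<bar> \<le> (\<Sum>l\<in>{a..<a+n}. 2 * real (a + n) / real N)"
  proof (rule order_trans[OF sum_abs sum_mono])
    fix l assume "l \<in> {a..<a+n}"
    then have "2 * real l / real N \<le> 2 * real (a + n) / real N"
      by (intro divide_right_mono) auto
    with close[of l] have "\<bar>\<sigma> ((T j ^^ l) x) - \<tau> l\<bar> \<le> 2 * real (a + n) / real N"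
      by linarith
    then show "\<bar>(\<sigma> ((T j ^^ l) x) - \<tau> l) * p l\<bar> \<le> 2 * real (a + n) / real N"
      unfolding abs_mult using mult_mono[OF _ p1[of l]] by fastforce
  qed
  ultimately show ?thesis
    by (cases "n = 0") (simp_all add: p_def abs_divide divide_le_eq mult.commute)
qed

section \<open>The Cauchy property, with one bound for all pairs of window starts, by induction on
  the slots\<close>

definition cauchy_avg :: "(nat \<Rightarrow> (nat list \<Rightarrow> 'a \<Rightarrow> real) \<Rightarrow> real) \<Rightarrow> nat set \<Rightarrow>
    (nat \<Rightarrow> nat list \<Rightarrow> 'a \<Rightarrow> real) \<Rightarrow> bool" where
  "cauchy_avg e J f \<longleftrightarrow> (\<forall>\<epsilon>>0. \<exists>N0. \<forall>N\<ge>N0. \<forall>N'\<ge>N0. \<forall>a a'.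
     ult e (\<lambda>y x. \<bar>avg J f a N y x - avg J f a' N' y x\<bar>) \<le> \<epsilon>)"

text \<open>Let \<open>v\<close> minimise the quadratic distance to \<open>F\<close> up to
  \<open>\<epsilon>\<^sup>2\<close>. Replacing it by \<open>v + t * \<sigma>\<close>, with
  \<open>t\<close> the correlation in question, lowers the distance by at least
  \<open>t\<^sup>2\<close>, since \<open>\<sigma>\<close> is bounded by 1. Near minimality thus
  bounds \<open>t\<close>, and no exact minimiser has to exist.\<close>

lemma near_projection:
  assumes E: "invariant_mean E" and V: "V \<subseteq> BM" "(\<lambda>_ _. 0) \<in> V"
    and lin: "\<And>u v c. u \<in> V \<Longrightarrow> v \<in> V \<Longrightarrow> (\<lambda>y x. u y x + c * v y x) \<in> V"
    and F: "F \<in> BM" and "\<epsilon> > 0"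
  shows "\<exists>v\<in>V. \<forall>\<sigma>\<in>V \<inter> BM1. \<bar>E (\<lambda>y x. (F y x - v y x) * \<sigma> y x)\<bar> \<le> \<epsilon>"
proof -
  define Q where "Q v = E (\<lambda>y x. (F y x - v y x) * (F y x - v y x))" for v
  have Q_BM: "(\<lambda>y x. (F y x - v y x) * (F y x - v y x)) \<in> BM" if "v \<in> V" for v
    using that V F by (intro BM_intros) auto
  have "0 \<le> Q v" if "v \<in> V" for v
    using mean_mono[OF E BM_const[of 0] Q_BM[OF that]] unfolding Q_def by (simp add: mean_const[OF E])
  then have bdd: "bdd_below (Q ` V)"
    by (auto intro!: bdd_belowI2[of _ 0])
  obtain v where v: "v \<in> V" "Q v < Inf (Q ` V) + \<epsilon>\<^sup>2"
    using cInf_lessD[of "Q ` V" "Inf (Q ` V) + \<epsilon>\<^sup>2"] V(2) \<open>\<epsilon> > 0\<close> by auto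
  show ?thesis
  proof (intro bexI[OF _ v(1)] ballI)
    fix \<sigma> assume \<sigma>: "\<sigma> \<in> V \<inter> BM1"
    define t where "t = E (\<lambda>y x. (F y x - v y x) * \<sigma> y x)"
    have BM: "F \<in> BM" "v \<in> BM" "\<sigma> \<in> BM"
      using F v(1) \<sigma> V(1) by auto
    have "Inf (Q ` V) \<le> Q (\<lambda>y x. v y x + t * \<sigma> y x)"
      using \<sigma> v(1) by (intro cINF_lower[OF bdd] lin) auto
    also have "\<dots> = E (\<lambda>y x. ((F y x - v y x) * (F y x - v y x) + (- 2 * t) * ((F y x - v y x) * \<sigma> y x))
        + t\<^sup>2 * (\<sigma> y x * \<sigma> y x))"
      unfolding Q_def by (simp add: algebra_simps power2_eq_square)
    also have "\<dots> = Q v + (- 2 * t) * t + t\<^sup>2 * E (\<lambda>y x. \<sigma> y x * \<sigma> y x)"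
    proof -
      have 1: "(\<lambda>y x. (F y x - v y x) * \<sigma> y x) \<in> BM" "(\<lambda>y x. \<sigma> y x * \<sigma> y x) \<in> BM"
        "(\<lambda>y x. (F y x - v y x) * (F y x - v y x)) \<in> BM"
        using BM by (auto intro!: BM_intros)
      then have 2: "(\<lambda>y x. (- 2 * t) * ((F y x - v y x) * \<sigma> y x)) \<in> BM" "(\<lambda>y x. t\<^sup>2 * (\<sigma> y x * \<sigma> y x)) \<in> BM"
        by - (rule BM_mult[OF BM_const], assumption)+
      show ?thesis
        unfolding mean_add[OF E BM_add[OF 1(3) 2(1)] 2(2)] mean_add[OF E 1(3) 2(1)]
          mean_cmult[OF E 1(1)] mean_cmult[OF E 1(2)] Q_def t_def[symmetric] ..
    qed
    also have "t\<^sup>2 * E (\<lambda>y x. \<sigma> y x * \<sigma> y x) \<le> t\<^sup>2 * 1"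
    proof (intro mult_left_mono)
      have "\<sigma> y x * \<sigma> y x \<le> 1" for y x
        using BM1_bound[of \<sigma> y x] \<sigma> by (simp add: abs_square_le_1 flip: power2_eq_square)
      then show "E (\<lambda>y x. \<sigma> y x * \<sigma> y x) \<le> 1"
        using mean_mono[OF E BM_mult[OF BM(3) BM(3)] BM_const[of 1]] by (simp add: mean_const[OF E])
    qed simp
    finally have "t\<^sup>2 \<le> \<epsilon>\<^sup>2"
      using v(2) by (simp add: power2_eq_square)
    then show "\<bar>E (\<lambda>y x. (F y x - v y x) * \<sigma> y x)\<bar> \<le> \<epsilon>"
      using \<open>\<epsilon> > 0\<close> abs_le_square_iff[of t \<epsilon>] unfolding t_def by simp
  qed
qed

text \<open>
  If the averages of \<open>h\<close> do not become small, then \<open>h\<close> correlates with a function for which the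
  averages converge by the induction hypothesis. The window lengths \<open>n k\<close> tend to infinity along
  the ultrafilter, so the error in \<open>average_reducible\<close> vanishes in the ultralimit.
\<close>

lemma correlates_with_reducible:
  assumes J: "finite J" "j \<notin> J"
    and IH: "\<And>e f. (\<And>k. invariant_mean (e k)) \<Longrightarrow> (\<And>i. f i \<in> BM1) \<Longrightarrow> cauchy_avg e J f"
    and e: "\<And>k. invariant_mean (e k)" and f: "\<And>i. f i \<in> BM1" and h: "h \<in> BM" and "\<delta> > 0"
    and large: "\<And>N0. \<exists>N\<ge>N0. \<exists>a. ult e (\<lambda>y x. \<bar>avg (insert j J) (f(j := h)) a N y x\<bar>) > \<delta>"
  shows "\<exists>\<sigma>\<in>BM1. cauchy_avg e (insert j J) (f(j := \<sigma>)) \<and> \<delta> \<le> ult e (\<lambda>y x. h y x * \<sigma> y x)"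
proof -
  define A where "A = avg (insert j J) (f(j := h))"
  have A_BM: "A a N \<in> BM" for a N
    unfolding A_def using f h by (intro BM_avg) (auto simp: BM1_BM)
  define good where "good k N \<longleftrightarrow> (\<exists>a. e k (\<lambda>y x. \<bar>A a N (k # y) x\<bar>) > \<delta>)" for k N
  \<comment> \<open>The longest window, of length at most \<open>k\<close>, on which the
    \<open>k\<close>-th mean sees a large average. The cap makes the set finite and the default 1
    makes it nonempty.\<close>
  define n where "n k = Max ({N. 1 \<le> N \<and> N \<le> k \<and> good k N} \<union> {1})" for k
  define b where "b k = (SOME a. e k (\<lambda>y x. \<bar>A a (n k) (k # y) x\<bar>) > \<delta>)" for k
  have n_in: "n k \<in> {N. 1 \<le> N \<and> N \<le> k \<and> good k N} \<union> {1}" for k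
    unfolding n_def by (rule Max_in) auto
  have n_pos: "n k > 0" for k
    using n_in[of k] by auto
  \<comment> \<open>For a fixed length, an ultralimit above \<open>\<delta>\<close> is seen by
    almost every \<open>k\<close>; such a length is then admissible and bounds \<open>n k\<close>
    from below.\<close>
  have n_large: "eventually (\<lambda>k. n k \<ge> r \<and> good k (n k)) ultra" for r
  proof -
    obtain N a where N: "N \<ge> max r 1" and Na: "ult e (\<lambda>y x. \<bar>A a N y x\<bar>) > \<delta>"
      using large[of "max r 1"] unfolding A_def by blast
    have "eventually (\<lambda>k. e k (\<lambda>y x. \<bar>A a N (k # y) x\<bar>) > \<delta>) ultra"
      using order_tendstoD(1)[OF tendsto_ult[of e, OF e BM_abs[OF A_BM]] Na] by simp
    moreover have "eventually (\<lambda>k. k \<ge> N) ultra"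
      by (rule filter_leD[OF ultra_le_sequentially eventually_ge_at_top])
    ultimately show ?thesis
    proof eventually_elim
      case (elim k)
      then have "good k N" "N \<in> {N. 1 \<le> N \<and> N \<le> k \<and> good k N} \<union> {1}"
        using N by (auto simp: good_def)
      then have "N \<le> n k"
        unfolding n_def by (intro Max_ge) auto
      then show ?case
        using N n_in[of k] \<open>good k N\<close> by (cases "n k = 1") (auto simp: le_antisym)
    qed
  qed
  have b: "e k (\<lambda>y x. \<bar>A (b k) (n k) (k # y) x\<bar>) > \<delta>" if "good k (n k)" for k
    using someI_ex[OF that[unfolded good_def]] unfolding b_def .

  \<comment> \<open>Multiplying by the sign turns the large average into its absolute value.\<close>
  define s where "s y x = sgn (A (b (hd y)) (n (hd y)) y x)" for y x
  have s_meas: "s y \<in> borel_measurable M" for y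
  proof -
    have [measurable]: "A (b (hd y)) (n (hd y)) y \<in> borel_measurable M"
      by (rule BM_measurable[OF A_BM])
    show ?thesis
      unfolding s_def sgn_if by measurable
  qed
  have s_le: "\<bar>s y x\<bar> \<le> 1" for y x
    by (simp add: s_def abs_sgn_eq)
  have s_BM: "s \<in> BM1"
    by (rule BM1I) (fact s_meas s_le)+
  have f_meas [measurable]: "f i y \<in> borel_measurable M" for i y
    by (rule BM_measurable[OF BM1_BM[OF f]])
  have f_le: "\<bar>f i y x\<bar> \<le> 1" for i y x
    by (rule BM1_bound[OF f])
  \<comment> \<open>The dual function: substituting \<open>(T j ^^ m) x\<close> for \<open>x\<close>
    in its \<open>m\<close>-th term, which the mean does not notice, cancels the inverse powers.
    Pairing \<open>h\<close> with \<open>\<sigma>\<close> is then pairing the average of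
    \<open>h\<close> with its own sign.\<close>
  define \<sigma> where "\<sigma> y z = (\<Sum>m\<in>{b (hd y)..<b (hd y) + n (hd y)}. s y ((S j ^^ m) z) *
      (\<Prod>i\<in>J. f i y ((T i ^^ m) ((S j ^^ m) z)))) / real (n (hd y))" for y z
  have \<sigma>: "\<sigma> \<in> BM1"
  proof (rule BM1I)
    note s_meas [measurable]
    show "\<sigma> y \<in> borel_measurable M" for y
      unfolding \<sigma>_def by measurable
    show "\<bar>\<sigma> y z\<bar> \<le> 1" for y z
      unfolding \<sigma>_def
      by (rule abs_average_le)
         (use s_le f_le in \<open>auto simp: abs_mult intro!: mult_le_one abs_prod_le_1\<close>)
  qed
  have corr: "e k (\<lambda>y x. h (k # y) x * \<sigma> (k # y) x) = e k (\<lambda>y x. \<bar>A (b k) (n k) (k # y) x\<bar>)" for k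
  proof -
    define G where "G m y x = h (k # y) x * (s (k # y) ((S j ^^ m) x) *
      (\<Prod>i\<in>J. f i (k # y) ((T i ^^ m) ((S j ^^ m) x))))" for m y x
    have BMk: "(\<lambda>y. h (k # y)) \<in> BM" "(\<lambda>y. s (k # y)) \<in> BM" "(\<lambda>y. f i (k # y)) \<in> BM" for i
      using h s_BM f by (auto intro: BM_reindex BM1_BM)
    have G_BM: "G m \<in> BM" for m
      unfolding G_def
      by (intro BM_mult BM_prod BMk(1) BM_pow_S[OF BMk(2)] BM_pow_S[OF BM_pow_T[OF BMk(3)]])
    have "e k (\<lambda>y x. h (k # y) x * \<sigma> (k # y) x) = e k (\<lambda>y x. (\<Sum>m\<in>{b k..<b k + n k}. G m y x) / real (n k))"
      by (simp add: \<sigma>_def G_def sum_distrib_left)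
    also have "\<dots> = (\<Sum>m\<in>{b k..<b k + n k}. e k (G m)) / real (n k)"
      by (simp add: mean_divide[OF e] mean_sum[OF e] BM_sum G_BM)
    also have "\<dots> = (\<Sum>m\<in>{b k..<b k + n k}. e k (\<lambda>y x. G m y ((T j ^^ m) x))) / real (n k)"
      by (simp add: mean_pow_T[OF e G_BM])
    also have "\<dots> = e k (\<lambda>y x. (\<Sum>m\<in>{b k..<b k + n k}. G m y ((T j ^^ m) x)) / real (n k))"
      by (simp add: mean_divide[OF e] mean_sum[OF e] BM_sum BM_pow_T G_BM)
    also have "\<dots> = e k (\<lambda>y x. \<bar>A (b k) (n k) (k # y) x\<bar>)"
    proof -
      have "(\<Sum>m\<in>{b k..<b k + n k}. G m y ((T j ^^ m) x)) / real (n k) = \<bar>A (b k) (n k) (k # y) x\<bar>" for y x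
      proof -
        have "(\<Sum>m\<in>{b k..<b k + n k}. G m y ((T j ^^ m) x)) / real (n k) = s (k # y) x * A (b k) (n k) (k # y) x"
          unfolding A_def avg_insert[OF J] by (simp add: G_def pow_S_pow_T sum_distrib_left mult_ac)
        also have "\<dots> = \<bar>A (b k) (n k) (k # y) x\<bar>"
          by (simp add: s_def abs_sgn mult.commute)
        finally show ?thesis .
      qed
      then show ?thesis by simp
    qed
    finally show ?thesis .
  qed
  have h\<sigma>: "(\<lambda>y x. h y x * \<sigma> y x) \<in> BM"
    using h \<sigma> by (intro BM_mult) (auto intro: BM1_BM)
  have "\<delta> \<le> ult e (\<lambda>y x. h y x * \<sigma> y x)"
  proof (rule tendsto_le[OF ultra_nontrivial tendsto_ult[of e, OF e h\<sigma>] tendsto_const])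
    show "eventually (\<lambda>k. \<delta> \<le> e k (\<lambda>y x. h (k # y) x * \<sigma> (k # y) x)) ultra"
      using n_large[of 0] by eventually_elim (use b corr in \<open>auto intro: less_imp_le\<close>)
  qed

  moreover have "cauchy_avg e (insert j J) (f(j := \<sigma>))"
  proof -
    \<comment> \<open>The sum over \<open>m\<close> is absorbed into the mean, so that one
      application of the induction hypothesis controls the average over \<open>m\<close>. Separate
      rates for each \<open>m\<close> would not combine, as the range of \<open>m\<close> grows with
      \<open>k\<close>.\<close>
    define e' where "e' k F = (\<Sum>m\<in>{b k..<b k + n k}. e k (\<lambda>y. F (m # y))) / real (n k)" for k F
    have e': "invariant_mean (e' k)" for k
      unfolding e'_def by (rule invariant_mean_average[OF e n_pos])
    \<comment> \<open>After the shift, the remaining factors depend on \<open>m\<close>, which is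
      the second entry of the list \<open>k # m # y\<close>. The original \<open>f\<close> is read
      from the list with that entry deleted.\<close>
    define f' where "f' i w x = f i (hd w # tl (tl w)) x *
        f i (hd w # tl (tl w)) ((T i ^^ hd (tl w)) ((S j ^^ hd (tl w)) x))" for i w x
    have f': "f' i \<in> BM1" for i
    proof (rule BM1I)
      show "f' i w \<in> borel_measurable M" for w
        unfolding f'_def by measurable
      show "\<bar>f' i w x\<bar> \<le> 1" for w x
        unfolding f'_def abs_mult by (intro mult_le_one f_le) auto
    qed
    define D where "D a N a' N' y x = \<bar>avg (insert j J) (f(j := \<sigma>)) a N y x - avg (insert j J) (f(j := \<sigma>)) a' N' y x\<bar>"
      for a N a' N' y x
    define D' where "D' a N a' N' y x = \<bar>avg J f' a N y x - avg J f' a' N' y x\<bar>" for a N a' N' y x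
    have D_BM: "D a N a' N' \<in> BM" for a N a' N'
      unfolding D_def using f \<sigma> by (intro BM_abs BM_diff BM_avg) (auto simp: BM1_BM)
    have D'_BM: "D' a N a' N' \<in> BM" for a N a' N'
      unfolding D'_def by (intro BM_abs BM_diff BM_avg BM1_BM[OF f'])
    have reduce: "\<bar>avg (insert j J) (f(j := \<sigma>)) a N (k # y) x -
        (\<Sum>m\<in>{b k..<b k + n k}. s (k # y) ((S j ^^ m) x) * avg J f' a N (k # m # y) x) / real (n k)\<bar>
        \<le> 2 * real (a + N) / real (n k)" for a N k y x
      unfolding avg_insert[OF J]
      using average_reducible[where J = J and f = "\<lambda>i. f i (k # y)" and s = "s (k # y)" and b = "b k" and N = "n k"
          and j = j and a = a and n = N and x = x, OF f_le s_le n_pos]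
      by (simp add: \<sigma>_def avg_def f'_def)
    have pointwise: "D a N a' N' (k # y) x \<le> (\<Sum>m\<in>{b k..<b k + n k}. D' a N a' N' (k # m # y) x) / real (n k)
        + 2 * real (a + N + a' + N') / real (n k)" for a N a' N' k y x
    proof -
      let ?B = "\<lambda>a N. (\<Sum>m\<in>{b k..<b k + n k}. s (k # y) ((S j ^^ m) x) * avg J f' a N (k # m # y) x) / real (n k)"
      have "\<bar>?B a N - ?B a' N'\<bar> = \<bar>\<Sum>m\<in>{b k..<b k + n k}. s (k # y) ((S j ^^ m) x) *
          (avg J f' a N (k # m # y) x - avg J f' a' N' (k # m # y) x)\<bar> / real (n k)"
        by (simp add: abs_divide sum_subtractf right_diff_distrib flip: diff_divide_distrib)
      also have "\<dots> \<le> (\<Sum>m\<in>{b k..<b k + n k}. D' a N a' N' (k # m # y) x) / real (n k)"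
      proof (intro divide_right_mono order_trans[OF sum_abs sum_mono])
        show "\<bar>s (k # y) ((S j ^^ m) x) * (avg J f' a N (k # m # y) x - avg J f' a' N' (k # m # y) x)\<bar>
            \<le> D' a N a' N' (k # m # y) x" for m
          unfolding D'_def abs_mult using s_le by (intro mult_left_le_one_le) auto
      qed simp
      finally have "\<bar>?B a N - ?B a' N'\<bar> \<le> \<dots>" .
      moreover have "2 * real (a + N + a' + N') / real (n k) = 2 * real (a + N) / real (n k) + 2 * real (a' + N') / real (n k)"
        by (simp add: add_divide_distrib)
      ultimately show ?thesis
        using reduce[of a N k y x] reduce[of a' N' k y x] unfolding D_def by linarith
    qed
    have le: "ult e (D a N a' N') \<le> ult e' (D' a N a' N')" for a N a' N'
    proof -
      have "filterlim n at_top ultra"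
        unfolding filterlim_at_top using n_large by (blast intro: eventually_mono)
      then have "filterlim (\<lambda>k. real (n k)) at_top ultra"
        by (rule filterlim_compose[OF filterlim_real_sequentially])
      then have "((\<lambda>k. 2 * real (a + N + a' + N') / real (n k)) \<longlongrightarrow> 0) ultra"
        by (rule tendsto_divide_0[OF tendsto_const filterlim_at_top_imp_at_infinity])
      from tendsto_add[OF tendsto_ult[of e', OF e' D'_BM] this]
      have lim: "((\<lambda>k. e' k (\<lambda>y. D' a N a' N' (k # y)) + 2 * real (a + N + a' + N') / real (n k))
          \<longlongrightarrow> ult e' (D' a N a' N')) ultra"
        by simp
      show ?thesis
      proof (rule tendsto_le[OF ultra_nontrivial lim tendsto_ult[of e, OF e D_BM]], intro always_eventually allI)
        fix k
        have 1: "(\<lambda>y x. \<Sum>m\<in>{b k..<b k + n k}. D' a N a' N' (k # m # y) x) \<in> BM"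
          by (intro BM_sum BM_reindex[OF D'_BM])
        have "e k (\<lambda>y. D a N a' N' (k # y)) \<le>
            e k (\<lambda>y x. (\<Sum>m\<in>{b k..<b k + n k}. D' a N a' N' (k # m # y) x) / real (n k) + 2 * real (a + N + a' + N') / real (n k))"
          by (rule mean_mono[OF e BM_reindex[OF D_BM] BM_add[OF BM_divide[OF 1] BM_const] pointwise])
        also have "\<dots> = e' k (\<lambda>y. D' a N a' N' (k # y)) + 2 * real (a + N + a' + N') / real (n k)"
          unfolding mean_add[OF e BM_divide[OF 1] BM_const] mean_divide[OF e 1] mean_const[OF e] e'_def
          by (subst mean_sum[OF e]) (auto intro: BM_reindex[OF D'_BM])
        finally show "e k (\<lambda>y. D a N a' N' (k # y)) \<le> \<dots>" .
      qed
    qed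
    have "cauchy_avg e' J f'"
      by (rule IH) (fact e' f')+
    then show ?thesis
      unfolding cauchy_avg_def using le unfolding D_def D'_def by (meson order_trans)
  qed
  ultimately show ?thesis
    using \<sigma> by blast
qed

text \<open>The sequence of means is kept general because the induction step replaces it by one
  averaged over windows. The constant sequence of integrals and parameter-free functions give norm
  convergence.\<close>

theorem multiple_averages_cauchy:
  assumes "finite J" "\<And>k. invariant_mean (e k)" "\<And>i. f i \<in> BM1"
  shows "cauchy_avg e J f"
  using assms
proof (induction J arbitrary: e f rule: finite_induct)
  case empty
  have "ult e (\<lambda>y x. \<bar>avg {} f a N y x - avg {} f a' N' y x\<bar>) = 0" if "N \<ge> 1" "N' \<ge> 1" for a N a' N'
    using that by (simp add: avg_def mean_const[OF invariant_mean_ult[of e, OF empty(1)]])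
  then show ?case
    unfolding cauchy_avg_def by (auto intro!: exI[of _ 1])
next
  case (insert j J)
  note J = insert(1,2) and e = insert(4) and f = insert(5)
  let ?E = "ult e"
  let ?A = "\<lambda>g. avg (insert j J) (f(j := g))"
  have E: "invariant_mean ?E"
    by (rule invariant_mean_ult[OF e])
  have A_BM: "?A g a N \<in> BM" if "g \<in> BM" for g a N
    using that f by (intro BM_avg) (auto simp: BM1_BM)
  have D_BM: "(\<lambda>y x. \<bar>?A g a N y x - ?A g a' N' y x\<bar>) \<in> BM" if "g \<in> BM" for g a N a' N'
    by (intro BM_abs BM_diff A_BM that)
  have A_lin: "?A (\<lambda>y x. u y x + c * v y x) a N y x = ?A u a N y x + c * ?A v a N y x" for u v c a N y x
    unfolding avg_insert[OF J]
    by (simp add: distrib_right sum.distrib add_divide_distrib sum_distrib_left mult.assoc)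
  \<comment> \<open>All slots other than \<open>j\<close> stay frozen at \<open>f\<close>, which
    makes this condition linear in the function in slot \<open>j\<close>.\<close>
  define V where "V = {g \<in> BM. cauchy_avg e (insert j J) (f(j := g))}"
  have V_lin: "(\<lambda>y x. u y x + c * v y x) \<in> V" if "u \<in> V" "v \<in> V" for u v c
  proof -
    have BM: "u \<in> BM" "v \<in> BM" using that by (auto simp: V_def)
    have "\<exists>N0. \<forall>N\<ge>N0. \<forall>N'\<ge>N0. \<forall>a a'.
       ?E (\<lambda>y x. \<bar>?A (\<lambda>y x. u y x + c * v y x) a N y x - ?A (\<lambda>y x. u y x + c * v y x) a' N' y x\<bar>) \<le> \<epsilon>"
      if "\<epsilon> > 0" for \<epsilon>
    proof -
      have "\<epsilon> / 2 > 0" "\<epsilon> / (2 * (\<bar>c\<bar> + 1)) > 0" using that by auto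
      then obtain N1 N2 where
        N1: "\<And>N N' a a'. N \<ge> N1 \<Longrightarrow> N' \<ge> N1 \<Longrightarrow> ?E (\<lambda>y x. \<bar>?A u a N y x - ?A u a' N' y x\<bar>) \<le> \<epsilon> / 2" and
        N2: "\<And>N N' a a'. N \<ge> N2 \<Longrightarrow> N' \<ge> N2 \<Longrightarrow> ?E (\<lambda>y x. \<bar>?A v a N y x - ?A v a' N' y x\<bar>) \<le> \<epsilon> / (2 * (\<bar>c\<bar> + 1))"
        using \<open>u \<in> V\<close> \<open>v \<in> V\<close> unfolding V_def cauchy_avg_def mem_Collect_eq by meson
      show ?thesis
      proof (intro exI[of _ "max N1 N2"] allI impI)
        fix N N' a a' assume N: "N \<ge> max N1 N2" "N' \<ge> max N1 N2"
        let ?Du = "\<lambda>y x. \<bar>?A u a N y x - ?A u a' N' y x\<bar>" and ?Dv = "\<lambda>y x. \<bar>?A v a N y x - ?A v a' N' y x\<bar>"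
        have "?E (\<lambda>y x. \<bar>?A (\<lambda>y x. u y x + c * v y x) a N y x - ?A (\<lambda>y x. u y x + c * v y x) a' N' y x\<bar>)
          \<le> ?E (\<lambda>y x. ?Du y x + \<bar>c\<bar> * ?Dv y x)"
        proof (rule mean_mono[OF E])
          show "\<bar>?A (\<lambda>y x. u y x + c * v y x) a N y x - ?A (\<lambda>y x. u y x + c * v y x) a' N' y x\<bar>
              \<le> ?Du y x + \<bar>c\<bar> * ?Dv y x" for y x
          proof -
            have "\<bar>p + c * q - (p' + c * q')\<bar> \<le> \<bar>p - p'\<bar> + \<bar>c\<bar> * \<bar>q - q'\<bar>" for p q p' q' :: real
            proof -
              have "\<bar>c\<bar> * \<bar>q - q'\<bar> = \<bar>c * q - c * q'\<bar>"
                by (simp add: abs_mult flip: right_diff_distrib)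
              then show ?thesis by linarith
            qed
            then show ?thesis unfolding A_lin .
          qed
        qed (intro D_BM BM_add BM_mult BM_const BM)+
        also have "\<dots> = ?E ?Du + \<bar>c\<bar> * ?E ?Dv"
          unfolding mean_add[OF E D_BM[OF BM(1)] BM_mult[OF BM_const D_BM[OF BM(2)]]]
            mean_cmult[OF E D_BM[OF BM(2)]] ..
        also have "\<dots> \<le> \<epsilon> / 2 + \<bar>c\<bar> * (\<epsilon> / (2 * (\<bar>c\<bar> + 1)))"
          using N by (intro add_mono mult_left_mono N1 N2) auto
        also have "\<dots> \<le> \<epsilon> / 2 + \<epsilon> / 2"
          using that by (intro add_left_mono) (simp add: divide_le_eq)
        finally show "?E (\<lambda>y x. \<bar>?A (\<lambda>y x. u y x + c * v y x) a N y x - ?A (\<lambda>y x. u y x + c * v y x) a' N' y x\<bar>) \<le> \<epsilon>"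
          by simp
      qed
    qed
    then show ?thesis
      unfolding V_def cauchy_avg_def by (auto intro!: BM_add BM_mult BM_const BM)
  qed
  have V_0: "(\<lambda>_ _. 0) \<in> V"
    unfolding V_def cauchy_avg_def avg_insert[OF J] by (auto simp: BM_const mean_const[OF E])
  \<comment> \<open>Large averages of \<open>h\<close> would force a correlation of at least
    \<open>\<delta>\<close> with some \<open>\<sigma>\<close> that itself lies in \<open>V\<close>;
    the bound \<open>\<delta> / 2\<close> excludes this.\<close>
  have small: "\<exists>N0. \<forall>N\<ge>N0. \<forall>a. ?E (\<lambda>y x. \<bar>?A h a N y x\<bar>) \<le> \<delta>"
    if h: "h \<in> BM" and "\<delta> > 0" and orth: "\<And>\<sigma>. \<sigma> \<in> V \<inter> BM1 \<Longrightarrow> \<bar>?E (\<lambda>y x. h y x * \<sigma> y x)\<bar> \<le> \<delta> / 2" for h \<delta>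
  proof (rule ccontr)
    assume "\<not> ?thesis"
    then have large: "\<exists>N\<ge>N0. \<exists>a. ?E (\<lambda>y x. \<bar>?A h a N y x\<bar>) > \<delta>" for N0
      by (auto simp: not_le)
    have "\<exists>\<sigma>\<in>BM1. cauchy_avg e (insert j J) (f(j := \<sigma>)) \<and> \<delta> \<le> ?E (\<lambda>y x. h y x * \<sigma> y x)"
    proof (rule correlates_with_reducible)
      show "cauchy_avg e J f"
        if "\<And>k. invariant_mean (e k)" "\<And>i. f i \<in> BM1" for e f
        using that by (rule insert.IH)
    qed (fact J e f h \<open>\<delta> > 0\<close> large)+
    then obtain \<sigma> where \<sigma>: "\<sigma> \<in> BM1" "cauchy_avg e (insert j J) (f(j := \<sigma>))" "\<delta> \<le> ?E (\<lambda>y x. h y x * \<sigma> y x)"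
      by blast
    then have "\<sigma> \<in> V \<inter> BM1" by (auto simp: V_def BM1_BM)
    from orth[OF this] \<sigma>(3) \<open>\<delta> > 0\<close> show False by linarith
  qed
  have "f j \<in> V"
    unfolding V_def cauchy_avg_def mem_Collect_eq
  proof (intro conjI allI impI)
    show "f j \<in> BM" by (rule BM1_BM[OF f])
    fix \<epsilon> :: real assume "\<epsilon> > 0"
    \<comment> \<open>One third is for comparing averages of the projection \<open>v\<close>, one
      for each of the two averages of the remainder \<open>h\<close>. Half of a third is the
      correlation bound that \<open>small\<close> asks for.\<close>
    then have \<epsilon>: "\<epsilon> / 3 > 0" "\<epsilon> / 3 / 2 > 0" by simp_all
    have V_BM: "V \<subseteq> BM" by (auto simp: V_def)
    from near_projection[OF E V_BM V_0 V_lin BM1_BM[OF f[of j]] \<epsilon>(2)]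
    obtain v where v: "v \<in> V"
      and orth: "\<And>\<sigma>. \<sigma> \<in> V \<inter> BM1 \<Longrightarrow> \<bar>?E (\<lambda>y x. (f j y x - v y x) * \<sigma> y x)\<bar> \<le> \<epsilon> / 3 / 2"
      by blast
    have v_BM: "v \<in> BM" using v by (simp add: V_def)
    define h where "h y x = f j y x - v y x" for y x
    have h: "h \<in> BM"
      unfolding h_def by (rule BM_diff[OF BM1_BM[OF f] v_BM])
    obtain N1 where N1: "\<And>N a. N \<ge> N1 \<Longrightarrow> ?E (\<lambda>y x. \<bar>?A h a N y x\<bar>) \<le> \<epsilon> / 3"
      using small[OF h \<epsilon>(1)] orth unfolding h_def by blast
    obtain N2 where N2: "\<And>N N' a a'. N \<ge> N2 \<Longrightarrow> N' \<ge> N2 \<Longrightarrow> ?E (\<lambda>y x. \<bar>?A v a N y x - ?A v a' N' y x\<bar>) \<le> \<epsilon> / 3"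
      using v \<epsilon>(1) unfolding V_def cauchy_avg_def mem_Collect_eq by meson
    have split: "?A (f j) a N y x = ?A v a N y x + ?A h a N y x" for a N y x
      using A_lin[of v 1 h a N y x] by (simp add: h_def)
    show "\<exists>N0. \<forall>N\<ge>N0. \<forall>N'\<ge>N0. \<forall>a a'. ?E (\<lambda>y x. \<bar>?A (f j) a N y x - ?A (f j) a' N' y x\<bar>) \<le> \<epsilon>"
    proof (intro exI[of _ "max N1 N2"] allI impI)
      fix N N' a a' assume N: "N \<ge> max N1 N2" "N' \<ge> max N1 N2"
      let ?D = "\<lambda>y x. \<bar>?A v a N y x - ?A v a' N' y x\<bar>"
      have le: "\<bar>?A (f j) a N y x - ?A (f j) a' N' y x\<bar> \<le> ?D y x + (\<bar>?A h a N y x\<bar> + \<bar>?A h a' N' y x\<bar>)" for y x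
        using split[of a N y x] split[of a' N' y x] by linarith
      have "?E (\<lambda>y x. \<bar>?A (f j) a N y x - ?A (f j) a' N' y x\<bar>)
          \<le> ?E (\<lambda>y x. ?D y x + (\<bar>?A h a N y x\<bar> + \<bar>?A h a' N' y x\<bar>))"
        by (rule mean_mono[OF E D_BM[OF BM1_BM[OF f]] BM_add[OF D_BM[OF v_BM] BM_add[OF BM_abs[OF A_BM[OF h]] BM_abs[OF A_BM[OF h]]]] le])
      also have "\<dots> = ?E ?D + (?E (\<lambda>y x. \<bar>?A h a N y x\<bar>) + ?E (\<lambda>y x. \<bar>?A h a' N' y x\<bar>))"
        unfolding mean_add[OF E D_BM[OF v_BM] BM_add[OF BM_abs[OF A_BM[OF h]] BM_abs[OF A_BM[OF h]]]]
          mean_add[OF E BM_abs[OF A_BM[OF h]] BM_abs[OF A_BM[OF h]]] ..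
      also have "\<dots> \<le> \<epsilon> / 3 + (\<epsilon> / 3 + \<epsilon> / 3)"
        using N by (intro add_mono N1 N2) auto
      finally show "?E (\<lambda>y x. \<bar>?A (f j) a N y x - ?A (f j) a' N' y x\<bar>) \<le> \<epsilon>" by simp
    qed
  qed
  then show ?case
    by (simp add: V_def)
qed

end

section \<open>Standard Borel spaces as retracts of the Cantor space\<close>

abbreviation cantor :: "('i \<Rightarrow> bool) measure" where
  "cantor \<equiv> PiM UNIV (\<lambda>_. count_space UNIV)"

text \<open>The code of a point records, for each scale, which members of a dense sequence lie
  within that scale. \<open>\<rho>\<close> takes the first one at each scale and passes to the
  limit. It is defined on all bit patterns, since a weak limit of measures on codes of points may
  charge patterns outside the image of \<open>\<phi>\<close>.\<close>

lemma standard_borel_retract: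
  fixes M :: "'a measure"
  assumes "standard_borel M" "space M \<noteq> {}"
  obtains \<phi> :: "'a \<Rightarrow> nat \<times> nat \<Rightarrow> bool" and \<rho>
  where "\<And>p. {x \<in> space M. \<phi> x p} \<in> sets M" "\<rho> \<in> measurable cantor M"
    "\<And>x. x \<in> space M \<Longrightarrow> \<rho> (\<phi> x) = x"
proof -
  obtain X where X: "completely_metrizable_space X" "second_countable X"
    and space: "space M = topspace X" and sets: "sets M = sigma_sets (topspace X) {U. openin X U}"
    using assms(1) unfolding standard_borel_def by blast
  obtain m d where "Metric_space m d" and mc: "Metric_space.mcomplete m d"
    and X_eq: "X = Metric_space.mtopology m d"
    using X(1) unfolding completely_metrizable_space_def by blast
  interpret Metric_space m d by fact
  have top: "topspace X = m" by (simp add: X_eq)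
  obtain C where C: "countable C" "C \<subseteq> m" "mtopology closure_of C = m"
    using second_countable_imp_separable_space[OF X(2)] unfolding separable_space_def top X_eq by auto
  have "m \<noteq> {}" using assms(2) by (simp add: space top)
  then have "C \<noteq> {}" using C(3) by auto
  define c where "c = from_nat_into C"
  have range_c: "range c = C"
    unfolding c_def using C(1) \<open>C \<noteq> {}\<close> by (rule range_from_nat_into[rotated])
  then have c_in: "c n \<in> m" for n using C(2) by auto
  have dense: "\<exists>n. d x (c n) < r" if x: "x \<in> m" "r > 0" for x r
  proof -
    have "x \<in> mtopology closure_of C" using x C(3) by simp
    then obtain y where "y \<in> C" "y \<in> mball x r"
      using x(2) unfolding metric_closure_of by blast
    then show ?thesis using range_c by auto
  qed
  define \<phi> where "\<phi> x p = (d x (c (snd p)) < (1/2) ^ fst p)" for x and p :: "nat \<times> nat"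
  define ix where "ix b i = (LEAST n. b (i, n))" for b :: "nat \<times> nat \<Rightarrow> bool" and i
  define z where "z b i = c (ix b i)" for b i
  define ok where "ok b \<longleftrightarrow> (\<forall>i. (\<exists>n. b (i, n)) \<and> d (z b i) (z b (Suc i)) < 2 * (1/2) ^ i)" for b
  define lm where "lm b = (SOME l. limitin mtopology (z b) l sequentially)" for b
  define \<rho> where "\<rho> b = (if ok b then lm b else c 0)" for b
  have z_in: "z b i \<in> m" for b i by (simp add: z_def c_in)
  \<comment> \<open>The subtracted term is the tail of the geometric series, without which the
    estimate would not be inductive.\<close>
  have step: "d (z b i) (z b (i + k)) \<le> 4 * (1/2) ^ i - 4 * (1/2) ^ (i + k)" if "ok b" for b i k
  proof (induction k)
    case (Suc k)
    have "d (z b i) (z b (i + Suc k)) \<le> d (z b i) (z b (i + k)) + d (z b (i + k)) (z b (Suc (i + k)))"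
      using triangle[OF z_in z_in z_in] by simp
    also have "d (z b (i + k)) (z b (Suc (i + k))) \<le> 2 * (1/2) ^ (i + k)"
      using that unfolding ok_def by (auto intro: less_imp_le)
    finally show ?case using Suc by simp
  qed (simp add: z_in)
  have step': "d (z b i) (z b (i + k)) \<le> 4 * (1/2) ^ i" if "ok b" for b i k
  proof -
    have "(0::real) \<le> 4 * (1/2) ^ (i + k)" by simp
    with step[OF that, of i k] show ?thesis by linarith
  qed
  have pow_small: "\<exists>i. r * (1/2) ^ i < e" if "e > 0" "r > 0" for e r :: real
    using real_arch_pow_inv[of "e / r" "1/2"] that by (auto simp: pos_less_divide_eq mult.commute)
  have limit: "limitin mtopology (z b) (lm b) sequentially" if "ok b" for b
  proof -
    have "MCauchy (z b)"
      unfolding MCauchy_def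
    proof (intro conjI allI impI)
      show "range (z b) \<subseteq> m" using z_in by auto
      fix e :: real assume "e > 0"
      then obtain i where i: "8 * (1/2) ^ i < e" using pow_small[of e 8] by auto
      show "\<exists>N. \<forall>n n'. N \<le> n \<longrightarrow> N \<le> n' \<longrightarrow> d (z b n) (z b n') < e"
      proof (intro exI allI impI)
        fix n n' assume "i \<le> n" "i \<le> n'"
        then have "d (z b i) (z b n) \<le> 4 * (1/2) ^ i" "d (z b i) (z b n') \<le> 4 * (1/2) ^ i"
          using step'[OF that, of i "n - i"] step'[OF that, of i "n' - i"] by auto
        moreover have "d (z b n) (z b n') \<le> d (z b n) (z b i) + d (z b i) (z b n')"
          by (rule triangle) (rule z_in)+
        moreover have "d (z b n) (z b i) = d (z b i) (z b n)"
          by (rule commute)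
        ultimately show "d (z b n) (z b n') < e" using i by linarith
      qed
    qed
    then have "\<exists>l. limitin mtopology (z b) l sequentially"
      using mc unfolding mcomplete_def by blast
    then show ?thesis unfolding lm_def by (rule someI_ex)
  qed
  have lm_in: "lm b \<in> m" if "ok b" for b
    using limit[OF that] by (simp add: limitin_def)
  have near: "d (z b i) (lm b) \<le> 4 * (1/2) ^ i" if "ok b" for b i
  proof (rule field_le_epsilon)
    fix e :: real assume "e > 0"
    then have "eventually (\<lambda>n. z b n \<in> mball (lm b) e) sequentially"
      using limit[OF that] lm_in[OF that] unfolding limitin_def by auto
    then obtain N where "\<And>n. n \<ge> N \<Longrightarrow> z b n \<in> mball (lm b) e"
      unfolding eventually_sequentially by blast
    from this[of "i + N"] have "d (lm b) (z b (i + N)) < e" by simp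
    moreover have "d (z b i) (lm b) \<le> d (z b i) (z b (i + N)) + d (z b (i + N)) (lm b)"
      by (rule triangle[OF z_in z_in lm_in[OF that]])
    ultimately show "d (z b i) (lm b) \<le> 4 * (1/2) ^ i + e"
      using step'[OF that, of i N] by (simp add: commute)
  qed
  have retract: "\<rho> (\<phi> x) = x" if "x \<in> m" for x
  proof -
    have ex: "\<exists>n. \<phi> x (i, n)" for i using dense[OF that, of "(1/2) ^ i"] by (simp add: \<phi>_def)
    then have "\<phi> x (i, ix (\<phi> x) i)" for i unfolding ix_def by (rule LeastI_ex)
    then have z: "d x (z (\<phi> x) i) < (1/2) ^ i" for i by (simp add: \<phi>_def z_def)
    have "d (z (\<phi> x) i) (z (\<phi> x) (Suc i)) < 2 * (1/2) ^ i" for i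
    proof -
      have "d (z (\<phi> x) i) (z (\<phi> x) (Suc i)) \<le> d x (z (\<phi> x) i) + d x (z (\<phi> x) (Suc i))"
        using triangle[OF z_in that z_in] by (simp add: commute)
      moreover have "(1/2) ^ Suc i \<le> (1/2 :: real) ^ i" by simp
      ultimately show ?thesis using z[of i] z[of "Suc i"] by linarith
    qed
    then have ok: "ok (\<phi> x)" unfolding ok_def using ex by blast
    have "d x (lm (\<phi> x)) \<le> 0"
    proof (rule field_le_epsilon)
      fix e :: real assume "e > 0"
      then obtain i where i: "5 * (1/2) ^ i < e" using pow_small[of e 5] by auto
      have "d x (lm (\<phi> x)) \<le> d x (z (\<phi> x) i) + d (z (\<phi> x) i) (lm (\<phi> x))"
        by (rule triangle[OF that z_in lm_in[OF ok]])
      then show "d x (lm (\<phi> x)) \<le> 0 + e" using z[of i] near[OF ok, of i] i by linarith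
    qed
    then show ?thesis
      using ok that lm_in[OF ok] nonneg[of x "lm (\<phi> x)"] by (auto simp: \<rho>_def)
  qed
  have "{x \<in> space M. \<phi> x p} \<in> sets M" for p
  proof -
    have "{x \<in> space M. \<phi> x p} = mball (c (snd p)) ((1/2) ^ fst p)"
      by (auto simp: space top \<phi>_def c_in commute)
    then show ?thesis by (auto simp: sets X_eq intro: sigma_sets.Basic)
  qed
  moreover have "\<rho> \<in> measurable cantor M"
  proof (rule measurable_sigma_sets[OF sets])
    have [measurable]: "Measurable.pred cantor (\<lambda>b. b p)" for p :: "nat \<times> nat"
      by measurable
    have ix [measurable]: "(\<lambda>b. ix b i) \<in> measurable cantor (count_space UNIV)" for i
      unfolding ix_def by measurable
    have z_meas [measurable]: "Measurable.pred cantor (\<lambda>b. P (z b i))" for P i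
      unfolding z_def by (rule measurable_compose[OF ix]) simp
    have "Measurable.pred cantor (\<lambda>b. \<exists>p q. ix b i = p \<and> ix b j = q \<and> Q (c p) (c q))" for Q i j
      by measurable
    then have [measurable]: "Measurable.pred cantor (\<lambda>b. Q (z b i) (z b j))" for Q i j
      by (simp add: z_def)
    have [measurable]: "Measurable.pred cantor ok"
      unfolding ok_def by measurable
    fix U assume "U \<in> {U. openin X U}"
    then have U: "openin mtopology U" by (simp add: X_eq)
    \<comment> \<open>The limit is within \<open>4 * (1/2) ^ i\<close> of the \<open>i\<close>-th
      centre, so membership in an open set becomes a countable condition on the centres, which
      depend measurably on \<open>b\<close>. Twice that radius gives the 8.\<close>
    have lm_iff: "lm b \<in> U \<longleftrightarrow> (\<exists>i. mcball (z b i) (4 * (1/2) ^ i) \<subseteq> U)" if "ok b" for b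
    proof
      assume "lm b \<in> U"
      then obtain r where r: "r > 0" "mball (lm b) r \<subseteq> U"
        using U unfolding openin_mtopology by blast
      obtain i where i: "8 * (1/2) ^ i < r" using pow_small[OF r(1), of 8] by auto
      have "mcball (z b i) (4 * (1/2) ^ i) \<subseteq> mball (lm b) r"
      proof
        fix y assume y: "y \<in> mcball (z b i) (4 * (1/2) ^ i)"
        have "d (lm b) y \<le> d (lm b) (z b i) + d (z b i) y"
          using y by (intro triangle[OF lm_in[OF that] z_in]) auto
        with near[OF that, of i] y i show "y \<in> mball (lm b) r"
          using lm_in[OF that] by (auto simp: commute)
      qed
      with r show "\<exists>i. mcball (z b i) (4 * (1/2) ^ i) \<subseteq> U" by blast
    next
      assume "\<exists>i. mcball (z b i) (4 * (1/2) ^ i) \<subseteq> U"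
      then show "lm b \<in> U" using near[OF that] lm_in[OF that] z_in by (auto simp: subset_iff)
    qed
    have "\<rho> -` U \<inter> space cantor =
        {b \<in> space cantor. (ok b \<and> (\<exists>i. mcball (z b i) (4 * (1/2) ^ i) \<subseteq> U)) \<or> (\<not> ok b \<and> c 0 \<in> U)}"
    proof (rule set_eqI)
      show "b \<in> \<rho> -` U \<inter> space cantor \<longleftrightarrow> b \<in> {b \<in> space cantor.
          (ok b \<and> (\<exists>i. mcball (z b i) (4 * (1/2) ^ i) \<subseteq> U)) \<or> (\<not> ok b \<and> c 0 \<in> U)}" for b
        by (cases "ok b") (simp_all add: \<rho>_def lm_iff conj_commute)
    qed
    also have "\<dots> \<in> sets cantor" by measurable
    finally show "\<rho> -` U \<inter> space cantor \<in> sets cantor" .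
  qed (use openin_subset[of mtopology] in \<open>auto simp: top X_eq \<rho>_def lm_in c_in\<close>)
  ultimately show ?thesis
    by (rule that) (use retract in \<open>simp add: space top\<close>)
qed

section \<open>Measures on the Cantor space as limits of empirical measures\<close>

lemma compact_UNIV_cantor: "compact (UNIV :: ('i \<Rightarrow> bool) set)"
proof -
  have "compact_space (euclidean :: bool topology)"
    by (simp add: compact_space_def finite_imp_compact)
  then have "compact_space (product_topology (\<lambda>_ :: 'i. euclidean :: bool topology) UNIV)"
    by (simp add: compact_space_product_topology)
  then show ?thesis
    by (simp add: euclidean_product_topology compact_space_def)
qed

lemma clopen_coordinate: "open {\<omega> :: 'i \<Rightarrow> bool. \<omega> p}" "closed {\<omega> :: 'i \<Rightarrow> bool. \<omega> p}"
proof -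
  have cont: "continuous_on UNIV (\<lambda>\<omega> :: 'i \<Rightarrow> bool. \<omega> p)"
    by (rule continuous_on_product_coordinates)
  have *: "{\<omega> :: 'i \<Rightarrow> bool. \<omega> p} = (\<lambda>\<omega>. \<omega> p) -` {True}" by auto
  show "open {\<omega> :: 'i \<Rightarrow> bool. \<omega> p}" unfolding *
    by (rule open_vimage[OF discrete_topology_class.open_discrete cont])
  show "closed {\<omega> :: 'i \<Rightarrow> bool. \<omega> p}" unfolding *
    by (rule closed_vimage[OF _ cont]) simp
qed

text \<open>Only the value true is prescribed. Such sets are closed under intersection, they
  generate because the other value is a complement, and their indicators are products of coordinate
  conditions.\<close>

definition cylinder :: "'i set \<Rightarrow> ('i \<Rightarrow> bool) set" where
  "cylinder P = {\<omega>. \<forall>p\<in>P. \<omega> p}"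

lemma sets_cantor_cylinder:
  "sets (cantor :: ('i \<Rightarrow> bool) measure) = sigma_sets UNIV (cylinder ` {P. finite P})"
proof (rule antisym)
  let ?G = "cylinder ` {P :: 'i set. finite P}"
  interpret sigma_algebra UNIV "sigma_sets UNIV ?G"
    by (rule sigma_algebra_sigma_sets) simp
  have "{\<omega>. \<omega> i \<in> A} \<in> sigma_sets UNIV ?G" for i :: 'i and A
  proof -
    have "cylinder {i} \<in> sigma_sets UNIV ?G" by (rule sigma_sets.Basic) auto
    then have 1: "{\<omega>. \<omega> i} \<in> sigma_sets UNIV ?G" by (simp add: cylinder_def)
    from compl_sets[OF this] have 2: "{\<omega>. \<not> \<omega> i} \<in> sigma_sets UNIV ?G"
      by (simp add: Compl_eq_Diff_UNIV[symmetric] Collect_neg_eq)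
    have "{\<omega>. \<omega> i \<in> A} = (if True \<in> A then {\<omega>. \<omega> i} else {}) \<union> (if False \<in> A then {\<omega>. \<not> \<omega> i} else {})"
      by (auto split: if_splits) (metis (full_types))+
    then show ?thesis using 1 2 by auto
  qed
  moreover have "sets cantor = sigma_sets UNIV {{\<omega>. \<omega> i \<in> A} | (i :: 'i) A. True}"
    by (simp add: sets_PiM_single PiE_UNIV_domain)
  ultimately show "sets cantor \<subseteq> sigma_sets UNIV ?G"
    by (auto intro!: sigma_sets_mono)
  have "cylinder P \<in> sets cantor" if "finite P" for P :: "'i set"
  proof -
    have "{\<omega> \<in> space cantor. \<forall>p\<in>P. \<omega> p} \<in> sets cantor"
      using that by (intro sets.sets_Collect_finite_All) measurable
    then show ?thesis by (simp add: cylinder_def space_PiM PiE_UNIV_domain)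
  qed
  then show "sigma_sets UNIV ?G \<subseteq> sets cantor"
    using sets.sigma_sets_subset[of ?G cantor] by (auto simp: space_PiM PiE_UNIV_domain)
qed

lemma Int_stable_cylinder: "Int_stable (cylinder ` {P. finite P})"
proof (rule Int_stableI)
  fix A B :: "('i \<Rightarrow> bool) set"
  assume "A \<in> cylinder ` {P. finite P}" "B \<in> cylinder ` {P. finite P}"
  then obtain P Q where "finite P" "finite Q" "A = cylinder P" "B = cylinder Q" by auto
  then show "A \<inter> B \<in> cylinder ` {P. finite P}"
    by (intro image_eqI[of _ _ "P \<union> Q"]) (auto simp: cylinder_def)
qed

text \<open>Compactness makes countable additivity automatic on clopen sets: a decreasing sequence
  of them with empty intersection is empty from some index on. Caratheodory's extension then applies
  to any finitely additive \<open>c\<close>.\<close>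

lemma ex_cantor_measure:
  fixes c :: "('i \<Rightarrow> bool) set \<Rightarrow> real"
  assumes nonneg: "\<And>A. c A \<ge> 0" and total: "c UNIV = 1" and empty: "c {} = 0"
    and add: "\<And>A B. A \<inter> B = {} \<Longrightarrow> c (A \<union> B) = c A + c B"
  shows "\<exists>\<kappa>. prob_space \<kappa> \<and> sets \<kappa> = sets cantor \<and> (\<forall>P. finite P \<longrightarrow> measure \<kappa> (cylinder P) = c (cylinder P))"
proof -
  define G where "G = {A :: ('i \<Rightarrow> bool) set. open A \<and> closed A}"
  interpret G: algebra UNIV G
    unfolding algebra_iff_Un G_def by (auto simp: Compl_eq_Diff_UNIV[symmetric])
  have "\<exists>\<mu> :: ('i \<Rightarrow> bool) set \<Rightarrow> ennreal. (\<forall>A\<in>G. \<mu> A = ennreal (c A)) \<and> measure_space UNIV (sigma_sets UNIV G) \<mu>"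
  proof (rule G.caratheodory_empty_continuous)
    show "positive G (\<lambda>A. ennreal (c A))" by (simp add: positive_def empty)
    show "additive G (\<lambda>A. ennreal (c A))"
      unfolding additive_def by (auto simp: add nonneg ennreal_plus simp del: ennreal_plus[symmetric])
    fix A :: "nat \<Rightarrow> ('i \<Rightarrow> bool) set"
    assume A: "range A \<subseteq> G" "decseq A" "(\<Inter>i. A i) = {}"
    obtain D where D: "finite D" "UNIV \<subseteq> (\<Union>i\<in>D. - A i)"
    proof (rule compactE_image[OF compact_UNIV_cantor, of UNIV "\<lambda>i. - A i"])
      show "open (- A i)" for i using A(1) by (auto simp: G_def)
      show "UNIV \<subseteq> (\<Union>i. - A i)" using A(3) by auto
    qed auto
    define n where "n = Max (insert 0 D)"
    have "A n \<subseteq> A i" if "i \<in> D" for i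
      using that D(1) unfolding n_def by (intro decseqD[OF A(2)] Max_ge) auto
    then have "A n = {}" using D(2) by blast
    then have "A i = {}" if "i \<ge> n" for i using decseqD[OF A(2) that] by auto
    then have "eventually (\<lambda>i. ennreal (c (A i)) = 0) sequentially"
      unfolding eventually_sequentially by (auto simp: empty intro!: exI[of _ n])
    then show "(\<lambda>i. ennreal (c (A i))) \<longlonglongrightarrow> 0" by (rule tendsto_eventually)
  qed auto
  then obtain \<mu> where \<mu>: "\<And>A. A \<in> G \<Longrightarrow> \<mu> A = ennreal (c A)" "measure_space UNIV (sigma_sets UNIV G) \<mu>"
    by blast
  let ?K = "measure_of UNIV G \<mu>"
  have sets_K: "sets ?K = sigma_sets UNIV G" and space_K: "space ?K = UNIV" by simp_all
  have em: "emeasure ?K A = \<mu> A" if "A \<in> sigma_sets UNIV G" for A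
    using \<mu>(2) that unfolding measure_space_def by (intro emeasure_measure_of[OF refl]) auto
  have cyl: "cylinder P \<in> G" if "finite P" for P :: "'i set"
  proof -
    have *: "cylinder P = (\<Inter>p\<in>P. {\<omega>. \<omega> p})" by (auto simp: cylinder_def)
    show ?thesis
      unfolding * G_def mem_Collect_eq
      by (intro conjI open_INT closed_INT that ballI clopen_coordinate)
  qed
  \<comment> \<open>Pushing forward along the identity restricts the measure to the product
    sigma-algebra.\<close>
  have id: "(\<lambda>\<omega>. \<omega>) \<in> measurable ?K cantor"
    by (rule measurable_sigma_sets[OF sets_cantor_cylinder])
       (use cyl in \<open>auto simp: sets_K space_K intro: sigma_sets.Basic\<close>)
  let ?D = "distr ?K cantor (\<lambda>\<omega>. \<omega>)"
  have D: "emeasure ?D (cylinder P) = ennreal (c (cylinder P))" if "finite P" for P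
    using cyl[OF that] that
    by (subst emeasure_distr[OF id])
       (auto simp: space_K em \<mu>(1) sets_cantor_cylinder sigma_sets.Basic)
  have "cylinder {} = (UNIV :: ('i \<Rightarrow> bool) set)" by (simp add: cylinder_def)
  with D[of "{}"] have "prob_space ?D"
    by (intro prob_spaceI) (simp add: total space_PiM PiE_UNIV_domain)
  moreover have "measure ?D (cylinder P) = c (cylinder P)" if "finite P" for P
    using D[OF that] by (simp add: measure_def nonneg)
  ultimately show ?thesis by (intro exI[of _ ?D]) auto
qed

text \<open>Ultralimits of visit frequencies form a finitely additive set function on all sets. The
  measure retains its values on cylinders, and the frequencies themselves do not have to
  converge.\<close>

lemma ex_empirical_limit:
  fixes \<theta> :: "nat \<Rightarrow> 'i \<Rightarrow> bool" and N :: "nat \<Rightarrow> nat"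
  assumes N: "\<And>k. N k > 0"
  shows "\<exists>\<kappa>. prob_space \<kappa> \<and> sets \<kappa> = sets cantor \<and> (\<forall>P. finite P \<longrightarrow>
    measure \<kappa> (cylinder P) = ulim (\<lambda>k. (\<Sum>n<N k. indicator (cylinder P) (\<theta> n)) / real (N k)))"
proof (rule ex_cantor_measure)
  let ?f = "\<lambda>A k. (\<Sum>n<N k. indicator A (\<theta> n)) / real (N k)"
  have nonneg: "0 \<le> ?f A k" for A k by (simp add: sum_nonneg)
  have "\<bar>?f A k\<bar> \<le> 1" for A k
    using abs_average_le[of "\<lambda>n. indicator A (\<theta> n)" 1 0 "N k"]
    by (simp add: indicator_def atLeast0LessThan)
  note ulim = tendsto_ulim[of "?f A" 1 for A, OF this]
  show "0 \<le> ulim (?f A)" for A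
    by (rule tendsto_lowerbound[OF ulim]) (simp_all add: nonneg)
  show "ulim (?f UNIV) = 1"
    using N by (simp add: less_imp_neq[symmetric])
  show "ulim (?f {}) = 0" by simp
  fix A B :: "('i \<Rightarrow> bool) set" assume "A \<inter> B = {}"
  then have "?f (A \<union> B) = (\<lambda>k. ?f A k + ?f B k)"
    by (auto simp: indicator_disj_union[OF \<open>A \<inter> B = {}\<close>] sum.distrib add_divide_distrib)
  then show "ulim (?f (A \<union> B)) = ulim (?f A) + ulim (?f B)"
    using ulim_eqI[OF tendsto_add[OF ulim[of A] ulim[of B]]] by simp
qed

section \<open>Window averages in a probability space\<close>

context prob_space
begin

text \<open>Convergence in \<open>L\<^sup>1\<close>, uniform in the start of the window. For
  uniformly bounded functions this implies the same in \<open>L\<^sup>2\<close>, and it is easier to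
  estimate.\<close>

definition window_conv :: "(nat \<Rightarrow> nat \<Rightarrow> 'a \<Rightarrow> 'b) \<Rightarrow> ('a \<Rightarrow> 'b::real_normed_vector) \<Rightarrow> bool" where
  "window_conv u g \<longleftrightarrow> (\<forall>\<epsilon>>0. \<exists>N0. \<forall>N\<ge>N0. \<forall>a. (\<integral>x. norm (u a N x - g x) \<partial>M) \<le> \<epsilon>)"

lemma window_convE:
  assumes "window_conv u g" "\<epsilon> > 0"
  obtains N0 where "\<And>N a. N \<ge> N0 \<Longrightarrow> (\<integral>x. norm (u a N x - g x) \<partial>M) \<le> \<epsilon>"
  using assms unfolding window_conv_def by blast

lemma integrable_bounded:
  fixes f :: "'a \<Rightarrow> 'b::{banach, second_countable_topology}"
  assumes "f \<in> borel_measurable M" "\<And>x. norm (f x) \<le> C"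
  shows "integrable M f"
  by (rule integrable_const_bound[of _ C]) (use assms in auto)

lemma window_limit:
  fixes u :: "nat \<Rightarrow> nat \<Rightarrow> 'a \<Rightarrow> real"
  assumes [measurable]: "\<And>a N. u a N \<in> borel_measurable M" and le: "\<And>a N x. \<bar>u a N x\<bar> \<le> 1"
    and cauchy: "\<And>\<epsilon>. \<epsilon> > 0 \<Longrightarrow> \<exists>N0. \<forall>N\<ge>N0. \<forall>N'\<ge>N0. \<forall>a a'. (\<integral>x. \<bar>u a N x - u a' N' x\<bar> \<partial>M) \<le> \<epsilon>"
  shows "\<exists>g\<in>borel_measurable M. (\<forall>x. \<bar>g x\<bar> \<le> 1) \<and> window_conv u g"
proof -
  have int: "integrable M (u a N)" for a N
    by (rule integrable_bounded[of _ 1]) (use le in auto)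
  have "\<exists>N0. \<forall>i\<ge>N0. \<forall>j\<ge>N0. (\<integral>x. norm (u 0 i x - u 0 j x) \<partial>M) < \<epsilon>" if "\<epsilon> > 0" for \<epsilon>
  proof -
    have "\<epsilon> / 2 > 0" using that by simp
    from cauchy[OF this] obtain N0 where
      N0: "\<And>N N' a a'. N \<ge> N0 \<Longrightarrow> N' \<ge> N0 \<Longrightarrow> (\<integral>x. \<bar>u a N x - u a' N' x\<bar> \<partial>M) \<le> \<epsilon> / 2"
      by blast
    have "(\<integral>x. norm (u 0 i x - u 0 j x) \<partial>M) < \<epsilon>" if "i \<ge> N0" "j \<ge> N0" for i j
      using N0[OF that, of 0 0] \<open>\<epsilon> > 0\<close> by simp
    then show ?thesis by blast
  qed
  from cauchy_L1_AE_cauchy_subseq[OF int this]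
  obtain r where r: "strict_mono r" "AE x in M. Cauchy (\<lambda>i. u 0 (r i) x)" by blast
  \<comment> \<open>Clamping secures the bound everywhere, although the subsequence converges only
    almost everywhere. Where it converges nothing changes, as the averages lie in the
    interval.\<close>
  define g where "g x = max (-1) (min 1 (lim (\<lambda>i. u 0 (r i) x)))" for x
  have g_meas [measurable]: "g \<in> borel_measurable M"
    unfolding g_def by measurable
  have g_le: "\<bar>g x\<bar> \<le> 1" for x by (auto simp: g_def)
  have lim: "AE x in M. (\<lambda>i. u 0 (r i) x) \<longlonglongrightarrow> g x"
    using r(2)
  proof eventually_elim
    case (elim x)
    then have l: "(\<lambda>i. u 0 (r i) x) \<longlonglongrightarrow> lim (\<lambda>i. u 0 (r i) x)"
      by (simp add: Cauchy_convergent_iff convergent_LIMSEQ_iff)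
    have "(\<lambda>i. max (-1) (min 1 (u 0 (r i) x))) \<longlonglongrightarrow> g x"
      unfolding g_def by (intro tendsto_intros l)
    moreover have "max (-1) (min 1 (u 0 (r i) x)) = u 0 (r i) x" for i
      using le[of 0 "r i" x] by auto
    ultimately show ?case by simp
  qed
  have "\<exists>N0. \<forall>N\<ge>N0. \<forall>a. (\<integral>x. \<bar>u a N x - g x\<bar> \<partial>M) \<le> \<epsilon>" if \<epsilon>: "\<epsilon> > 0" for \<epsilon>
  proof -
    obtain N0 where N0: "\<And>N N' a a'. N \<ge> N0 \<Longrightarrow> N' \<ge> N0 \<Longrightarrow> (\<integral>x. \<bar>u a N x - u a' N' x\<bar> \<partial>M) \<le> \<epsilon>"
      using cauchy[OF \<epsilon>] by blast
    show ?thesis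
    proof (intro exI[of _ N0] allI impI)
      fix N a assume "N \<ge> N0"
      have "(\<lambda>i. \<integral>x. \<bar>u a N x - u 0 (r i) x\<bar> \<partial>M) \<longlonglongrightarrow> (\<integral>x. \<bar>u a N x - g x\<bar> \<partial>M)"
      proof (rule integral_dominated_convergence[where w = "\<lambda>_. 2"])
        show "AE x in M. (\<lambda>i. \<bar>u a N x - u 0 (r i) x\<bar>) \<longlonglongrightarrow> \<bar>u a N x - g x\<bar>"
          using lim by eventually_elim (intro tendsto_intros)
        show "AE x in M. norm \<bar>u a N x - u 0 (r i) x\<bar> \<le> 2" for i
        proof (intro AE_I2)
          show "norm \<bar>u a N x - u 0 (r i) x\<bar> \<le> 2" for x
            using le[of a N x] le[of 0 "r i" x] by simp
        qed
      qed auto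
      moreover have "(\<integral>x. \<bar>u a N x - u 0 (r i) x\<bar> \<partial>M) \<le> \<epsilon>" if "i \<ge> N0" for i
        using N0[OF \<open>N \<ge> N0\<close>, of "r i" a 0] seq_suble[OF r(1), of i] that by simp
      ultimately show "(\<integral>x. \<bar>u a N x - g x\<bar> \<partial>M) \<le> \<epsilon>"
        by (blast intro: LIMSEQ_le_const2)
    qed
  qed
  with g_meas g_le show ?thesis by (intro bexI[of _ g]) (auto simp: window_conv_def)
qed

lemma window_conv_lin:
  fixes u v :: "nat \<Rightarrow> nat \<Rightarrow> 'a \<Rightarrow> 'b::{real_normed_field, banach, second_countable_topology}"
  assumes conv: "window_conv u g" "window_conv v k"
    and u: "\<And>a N. integrable M (u a N)" "integrable M g"
    and v: "\<And>a N. integrable M (v a N)" "integrable M k"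
  shows "window_conv (\<lambda>a N x. u a N x + c * v a N x) (\<lambda>x. g x + c * k x)"
  unfolding window_conv_def
proof (intro allI impI)
  fix \<epsilon> :: real assume "\<epsilon> > 0"
  define \<delta> where "\<delta> = \<epsilon> / (1 + norm c)"
  have c: "1 + norm c > 0" by (simp add: add_pos_nonneg)
  then have "\<delta> > 0" "\<delta> * (1 + norm c) = \<epsilon>"
    using \<open>\<epsilon> > 0\<close> by (simp_all add: \<delta>_def)
  then have \<delta>: "\<delta> + norm c * \<delta> = \<epsilon>" by (simp add: algebra_simps)
  obtain N1 where N1: "\<And>N a. N \<ge> N1 \<Longrightarrow> (\<integral>x. norm (u a N x - g x) \<partial>M) \<le> \<delta>"
    using window_convE[OF conv(1) \<open>\<delta> > 0\<close>] by blast
  obtain N2 where N2: "\<And>N a. N \<ge> N2 \<Longrightarrow> (\<integral>x. norm (v a N x - k x) \<partial>M) \<le> \<delta>"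
    using window_convE[OF conv(2) \<open>\<delta> > 0\<close>] by blast
  show "\<exists>N0. \<forall>N\<ge>N0. \<forall>a. (\<integral>x. norm (u a N x + c * v a N x - (g x + c * k x)) \<partial>M) \<le> \<epsilon>"
  proof (intro exI[of _ "max N1 N2"] allI impI)
    fix N a assume N: "N \<ge> max N1 N2"
    have "(\<integral>x. norm (u a N x + c * v a N x - (g x + c * k x)) \<partial>M)
        \<le> (\<integral>x. norm (u a N x - g x) + norm c * norm (v a N x - k x) \<partial>M)"
    proof (rule integral_mono)
      fix x
      have "u a N x + c * v a N x - (g x + c * k x) = (u a N x - g x) + c * (v a N x - k x)"
        by (simp add: algebra_simps)
      then show "norm (u a N x + c * v a N x - (g x + c * k x)) \<le> norm (u a N x - g x) + norm c * norm (v a N x - k x)"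
        by (metis norm_triangle_ineq norm_mult)
    qed (use u v in auto)
    also have "\<dots> = (\<integral>x. norm (u a N x - g x) \<partial>M) + norm c * (\<integral>x. norm (v a N x - k x) \<partial>M)"
      using u v by simp
    also have "\<dots> \<le> \<delta> + norm c * \<delta>"
      using N by (intro add_mono mult_left_mono N1 N2) auto
    finally show "(\<integral>x. norm (u a N x + c * v a N x - (g x + c * k x)) \<partial>M) \<le> \<epsilon>"
      by (simp only: \<delta>)
  qed
qed

lemma window_conv_approx:
  fixes u :: "nat \<Rightarrow> nat \<Rightarrow> 'a \<Rightarrow> 'b::{banach, second_countable_topology}"
  assumes int: "\<And>k a N. integrable M (v k a N)" "\<And>k. integrable M (h k)"
      "\<And>a N. integrable M (u a N)" "integrable M g"
    and conv: "\<And>k. window_conv (v k) (h k)"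
    and "\<delta> \<longlonglongrightarrow> 0" and le: "\<And>k a N. (\<integral>x. norm (u a N x - v k a N x) \<partial>M) \<le> \<delta> k"
      "\<And>k. (\<integral>x. norm (g x - h k x) \<partial>M) \<le> \<delta> k"
  shows "window_conv u g"
  unfolding window_conv_def
proof (intro allI impI)
  fix \<epsilon> :: real assume "\<epsilon> > 0"
  then have \<epsilon>: "\<epsilon> / 3 > 0" by simp
  obtain k where k: "\<delta> k < \<epsilon> / 3"
    using order_tendstoD(2)[OF \<open>\<delta> \<longlonglongrightarrow> 0\<close> \<epsilon>] by (auto dest: eventually_happens)
  obtain N0 where N0: "\<And>N a. N \<ge> N0 \<Longrightarrow> (\<integral>x. norm (v k a N x - h k x) \<partial>M) \<le> \<epsilon> / 3"
    using window_convE[OF conv \<epsilon>] by blast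
  have "(\<integral>x. norm (u a N x - g x) \<partial>M) \<le> \<epsilon>" if "N \<ge> N0" for N a
  proof -
    have "(\<integral>x. norm (u a N x - g x) \<partial>M)
        \<le> (\<integral>x. norm (u a N x - v k a N x) + norm (v k a N x - h k x) + norm (g x - h k x) \<partial>M)"
    proof (rule integral_mono)
      show "norm (u a N x - g x) \<le> norm (u a N x - v k a N x) + norm (v k a N x - h k x) + norm (g x - h k x)" for x
        using norm_triangle_ineq[of "u a N x - v k a N x" "v k a N x - h k x"]
          norm_triangle_ineq4[of "u a N x - h k x" "g x - h k x"] by simp
    qed (use int in auto)
    also have "\<dots> = (\<integral>x. norm (u a N x - v k a N x) \<partial>M) + (\<integral>x. norm (v k a N x - h k x) \<partial>M) + (\<integral>x. norm (g x - h k x) \<partial>M)"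
      using int by simp
    also have "\<dots> \<le> \<epsilon>"
      using le(1)[of a N k] le(2)[of k] N0[OF that, of a] k by linarith
    finally show ?thesis .
  qed
  then show "\<exists>N0. \<forall>N\<ge>N0. \<forall>a. (\<integral>x. norm (u a N x - g x) \<partial>M) \<le> \<epsilon>" by blast
qed

lemma window_conv_integral:
  fixes u :: "nat \<Rightarrow> nat \<Rightarrow> 'a \<Rightarrow> 'b::{banach, second_countable_topology}"
  assumes "window_conv u g" "\<And>a N. integrable M (u a N)" "integrable M g"
  shows "(\<lambda>N. \<integral>x. u a N x \<partial>M) \<longlonglongrightarrow> (\<integral>x. g x \<partial>M)"
proof (rule LIMSEQ_I)
  fix r :: real assume "r > 0"
  then have "r / 2 > 0" by simp
  then obtain N0 where N0: "\<And>N a. N \<ge> N0 \<Longrightarrow> (\<integral>x. norm (u a N x - g x) \<partial>M) \<le> r / 2"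
    using window_convE[OF assms(1)] by blast
  have "norm ((\<integral>x. u a N x \<partial>M) - (\<integral>x. g x \<partial>M)) < r" if "N \<ge> N0" for N
  proof -
    have "(\<integral>x. u a N x \<partial>M) - (\<integral>x. g x \<partial>M) = (\<integral>x. u a N x - g x \<partial>M)"
      using assms by simp
    also have "norm \<dots> \<le> (\<integral>x. norm (u a N x - g x) \<partial>M)"
      by (rule integral_norm_bound)
    also have "\<dots> < r" using N0[OF that, of a] \<open>r > 0\<close> by linarith
    finally show ?thesis .
  qed
  then show "\<exists>N0. \<forall>N\<ge>N0. norm ((\<integral>x. u a N x \<partial>M) - (\<integral>x. g x \<partial>M)) < r" by blast
qed

text \<open>Windows starting at 0 for \<open>v\<close> are windows starting at \<open>a\<close> for
  \<open>u\<close>, and the limit does not see the start. In this way a time shift becomes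
  invariance of the limit.\<close>

lemma window_conv_unique:
  fixes u v :: "nat \<Rightarrow> nat \<Rightarrow> 'a \<Rightarrow> 'b::{banach, second_countable_topology}"
  assumes conv: "window_conv u g" "window_conv v h" and eq: "\<And>N x. v 0 N x = u a N x"
    and int: "\<And>a N. integrable M (u a N)" "integrable M g" "integrable M h"
  shows "AE x in M. h x = g x"
proof -
  have "(\<integral>x. norm (h x - g x) \<partial>M) \<le> 0 + \<epsilon>" if "\<epsilon> > 0" for \<epsilon>
  proof -
    have \<epsilon>: "\<epsilon> / 2 > 0" using that by simp
    obtain N1 where N1: "\<And>N a. N \<ge> N1 \<Longrightarrow> (\<integral>x. norm (u a N x - g x) \<partial>M) \<le> \<epsilon> / 2"
      using window_convE[OF conv(1) \<epsilon>] by blast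
    obtain N2 where N2: "\<And>N a. N \<ge> N2 \<Longrightarrow> (\<integral>x. norm (v a N x - h x) \<partial>M) \<le> \<epsilon> / 2"
      using window_convE[OF conv(2) \<epsilon>] by blast
    let ?N = "max N1 N2"
    have "(\<integral>x. norm (h x - g x) \<partial>M) \<le> (\<integral>x. norm (u a ?N x - g x) + norm (u a ?N x - h x) \<partial>M)"
    proof (rule integral_mono)
      show "norm (h x - g x) \<le> norm (u a ?N x - g x) + norm (u a ?N x - h x)" for x
        using norm_triangle_ineq4[of "u a ?N x - g x" "u a ?N x - h x"] by simp
    qed (use int in auto)
    also have "\<dots> = (\<integral>x. norm (u a ?N x - g x) \<partial>M) + (\<integral>x. norm (u a ?N x - h x) \<partial>M)"
      using int by simp
    also have "\<dots> \<le> \<epsilon> / 2 + \<epsilon> / 2"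
      using N1[of ?N a] N2[of ?N 0] by (intro add_mono) (simp_all add: eq)
    finally show ?thesis by simp
  qed
  from field_le_epsilon[OF this] have "(\<integral>x. norm (h x - g x) \<partial>M) = 0"
    by (intro antisym) (auto intro!: integral_nonneg_AE)
  then have "AE x in M. norm (h x - g x) = 0"
    using int by (subst integral_nonneg_eq_0_iff_AE[symmetric]) auto
  then show ?thesis by auto
qed

end

lemma prod_of_bool: "finite J \<Longrightarrow> (\<Prod>i\<in>J. of_bool (Q i)) = (of_bool (\<forall>i\<in>J. Q i) :: 'b::comm_semiring_1)"
  by (induction J rule: finite_induct) auto

section \<open>Orbit averages in a measure preserving system\<close>

context commuting_maps
begin

definition mavg :: "nat set \<Rightarrow> (nat \<Rightarrow> 'a \<Rightarrow> 'b) \<Rightarrow> nat \<Rightarrow> nat \<Rightarrow> 'a \<Rightarrow> 'b::real_normed_field" where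
  "mavg J f a N x = (\<Sum>n\<in>{a..<a+N}. \<Prod>i\<in>J. f i ((T i ^^ n) x)) / of_nat N"

lemma mavg_measurable [measurable]:
  fixes f :: "nat \<Rightarrow> 'a \<Rightarrow> 'b::{real_normed_field, second_countable_topology}"
  assumes [measurable]: "\<And>i. i \<in> J \<Longrightarrow> f i \<in> borel_measurable M"
  shows "mavg J f a N \<in> borel_measurable M"
proof -
  have [measurable]: "(\<lambda>x. f i ((T i ^^ n) x)) \<in> borel_measurable M" if "i \<in> J" for i n
    using assms[OF that] by measurable
  show ?thesis
    unfolding mavg_def by measurable
qed

lemma norm_mavg_le:
  fixes f :: "nat \<Rightarrow> 'a \<Rightarrow> 'b::real_normed_field"
  assumes "\<And>n. norm (\<Prod>i\<in>J. f i ((T i ^^ n) x)) \<le> C"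
  shows "norm (mavg J f a N x) \<le> C"
proof -
  have "norm (mavg J f a N x) \<le> (\<Sum>n\<in>{a..<a+N}. norm (\<Prod>i\<in>J. f i ((T i ^^ n) x))) / real N"
    unfolding mavg_def norm_divide by (simp add: divide_right_mono norm_sum)
  also have "\<dots> \<le> C"
    by (rule order_trans[OF abs_ge_self abs_average_le]) (simp add: assms)
  finally show ?thesis .
qed

end

locale commuting_prob = commuting_maps M T S + prob_space M
  for M :: "'a measure" and T S +
  assumes distr_T: "distr M M (T i) = M"
begin

lemma distr_pow_T: "distr M M (T i ^^ n) = M"
proof (induction n)
  case (Suc n)
  have "distr M M (T i ^^ Suc n) = distr (distr M M (T i ^^ n)) M (T i)"
    by (subst distr_distr) simp_all
  also have "\<dots> = M" using Suc distr_T by simp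
  finally show ?case .
qed (simp add: distr_id[unfolded id_def] id_def)

lemma integral_pow_T:
  fixes f :: "'a \<Rightarrow> 'b::{banach, second_countable_topology}"
  assumes "f \<in> borel_measurable M"
  shows "(\<integral>x. f ((T i ^^ n) x) \<partial>M) = (\<integral>x. f x \<partial>M)"
  using integral_distr[OF measurable_pow_T[where i = i and n = n] assms] by (simp add: distr_pow_T)

lemma invariant_mean_integral: "invariant_mean (\<lambda>F. \<integral>x. F [] x \<partial>M)"
proof -
  have int: "integrable M (F y)" if F: "F \<in> BM" for F :: "nat list \<Rightarrow> 'a \<Rightarrow> real" and y
  proof -
    obtain C where "\<And>y x. \<bar>F y x\<bar> \<le> C" using F by (auto simp: BM_def)
    then show ?thesis by (intro integrable_bounded[of _ C] BM_measurable[OF F]) simp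
  qed
  have "(\<integral>x. F [] (T i x) \<partial>M) = (\<integral>x. F [] x \<partial>M)" if "F \<in> BM" for F i
    using integral_pow_T[OF BM_measurable[OF that], where i = i and n = 1] by simp
  then show ?thesis
    unfolding invariant_mean_def
    by (auto simp: int prob_space intro!: integral_mono Bochner_Integration.integral_add int)
qed

lemma mavg_cauchy:
  fixes f :: "nat \<Rightarrow> 'a \<Rightarrow> real"
  assumes "finite J" "\<And>i. f i \<in> borel_measurable M" "\<And>i x. \<bar>f i x\<bar> \<le> 1" "\<epsilon> > 0"
  shows "\<exists>N0. \<forall>N\<ge>N0. \<forall>N'\<ge>N0. \<forall>a a'. (\<integral>x. \<bar>mavg J f a N x - mavg J f a' N' x\<bar> \<partial>M) \<le> \<epsilon>"
proof -
  have "cauchy_avg (\<lambda>_ F. \<integral>x. F [] x \<partial>M) J (\<lambda>i _. f i)"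
    by (rule multiple_averages_cauchy)
       (use assms in \<open>auto intro: invariant_mean_integral BM1I\<close>)
  then show ?thesis
    using assms(4) unfolding cauchy_avg_def ult_def avg_def mavg_def by simp
qed

lemma mavg_limit:
  fixes f :: "nat \<Rightarrow> 'a \<Rightarrow> real"
  assumes "finite J" "\<And>i. f i \<in> borel_measurable M" "\<And>i x. \<bar>f i x\<bar> \<le> 1"
  shows "\<exists>g\<in>borel_measurable M. (\<forall>x. \<bar>g x\<bar> \<le> 1) \<and> window_conv (mavg J f) g"
proof (rule window_limit)
  show "mavg J f a N \<in> borel_measurable M" for a N using assms by measurable
  show "\<bar>mavg J f a N x\<bar> \<le> 1" for a N x
  proof -
    have "norm (mavg J f a N x) \<le> 1"
      by (rule norm_mavg_le) (simp add: abs_prod_le_1 assms(3) del: abs_prod)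
    then show ?thesis by simp
  qed
qed (rule mavg_cauchy[OF assms])

end

section \<open>The limiting kernel\<close>

locale coded_prob = commuting_prob M T S
  for M :: "'a measure" and T S +
  fixes D :: "nat set" and \<phi> :: "'a \<Rightarrow> nat \<times> nat \<Rightarrow> bool"
  assumes finite_D: "finite D"
    and measurable_\<phi>_coord: "{x \<in> space M. \<phi> x q} \<in> sets M"
begin

lemma measurable_\<phi> [measurable]: "\<phi> \<in> measurable M cantor"
proof (rule measurable_PiM_single')
  show "(\<lambda>x. \<phi> x q) \<in> measurable M (count_space UNIV)" for q
    using measurable_\<phi>_coord[of q] by (simp add: pred_def)
qed auto

text \<open>The code of the \<open>n\<close>-th orbit point of \<open>(x, \<dots>, x)\<close>. Slots
  outside \<open>D\<close> are constantly false, so a cylinder that mentions one is never visited,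
  and all finite \<open>P\<close> can be treated alike.\<close>

definition code :: "nat \<Rightarrow> 'a \<Rightarrow> nat \<times> (nat \<times> nat) \<Rightarrow> bool" where
  "code n x = (\<lambda>(i, q). i \<in> D \<and> \<phi> ((T i ^^ n) x) q)"

text \<open>The factor of the indicator of \<open>cylinder P\<close> that belongs to slot
  \<open>i\<close>. Through these factors visit frequencies are multiple averages.\<close>

definition cyl_fun :: "(nat \<times> (nat \<times> nat)) set \<Rightarrow> nat \<Rightarrow> 'a \<Rightarrow> real" where
  "cyl_fun P i x = of_bool (\<phi> x \<in> cylinder (P `` {i}))"

definition code_avg :: "(nat \<times> (nat \<times> nat)) set \<Rightarrow> nat \<Rightarrow> nat \<Rightarrow> 'a \<Rightarrow> real" where
  "code_avg P a N x = (\<Sum>n\<in>{a..<a+N}. indicator (cylinder P) (code n x)) / real N"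

lemma cylinder_sets: "finite P \<Longrightarrow> cylinder P \<in> sets cantor"
  unfolding sets_cantor_cylinder by (rule sigma_sets.Basic) auto

lemma cyl_fun_measurable:
  assumes "finite P"
  shows "cyl_fun P i \<in> borel_measurable M"
proof -
  have "finite (P `` {i})" using assms by (rule finite_Image)
  from cylinder_sets[OF this] have [measurable]: "Measurable.pred cantor (\<lambda>w. w \<in> cylinder (P `` {i}))"
    by (simp add: pred_def Int_absorb1 space_PiM PiE_UNIV_domain)
  show ?thesis unfolding cyl_fun_def by measurable
qed

lemma code_avg_eq:
  "code_avg P a N x = (if fst ` P \<subseteq> D then mavg D (cyl_fun P) a N x else 0)"
proof -
  have "indicator (cylinder P) (code n x) =
      (if fst ` P \<subseteq> D then \<Prod>i\<in>D. cyl_fun P i ((T i ^^ n) x) else 0 :: real)" for n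
    unfolding cyl_fun_def prod_of_bool[OF finite_D]
    by (fastforce simp: indicator_def cylinder_def code_def)
  then show ?thesis by (simp add: code_avg_def mavg_def)
qed

lemma code_avg_limit:
  assumes "finite P"
  shows "\<exists>g\<in>borel_measurable M. (\<forall>x. \<bar>g x\<bar> \<le> 1) \<and> window_conv (code_avg P) g"
proof (cases "fst ` P \<subseteq> D")
  case True
  have "\<bar>cyl_fun P i x\<bar> \<le> 1" for i x by (simp add: cyl_fun_def)
  from mavg_limit[OF finite_D cyl_fun_measurable[OF assms] this] True show ?thesis
    by (simp add: code_avg_eq window_conv_def)
next
  case False
  then show ?thesis by (intro bexI[of _ "\<lambda>_. 0"]) (auto simp: code_avg_eq window_conv_def)
qed

lemma code_avg_measurable [measurable]: "finite P \<Longrightarrow> code_avg P a N \<in> borel_measurable M"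
  unfolding code_avg_eq[abs_def]
  by (cases "fst ` P \<subseteq> D") (simp_all add: mavg_measurable cyl_fun_measurable)

lemma code_avg_bounds: "0 \<le> code_avg P a N x" "code_avg P a N x \<le> 1"
proof -
  show "0 \<le> code_avg P a N x" by (simp add: code_avg_def sum_nonneg)
  show "code_avg P a N x \<le> 1"
    using abs_average_le[of "\<lambda>n. indicator (cylinder P) (code n x)" 1 a N]
    by (simp add: code_avg_def indicator_def)
qed

text \<open>A diagonal choice: at stage \<open>k\<close> the first \<open>k + 1\<close> cylinders of
  an enumeration have mean error at most \<open>1 / (k + 1)\<^sup>2\<close> each. The sum of these
  errors is at most \<open>1 / (k + 1)\<close> and dominates the error of every single cylinder from
  its own index on.\<close>

lemma ex_common_subsequence:
  assumes g: "\<And>P. finite P \<Longrightarrow> g P \<in> borel_measurable M" "\<And>P x. finite P \<Longrightarrow> \<bar>g P x\<bar> \<le> 1"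
    and lim: "\<And>P. finite P \<Longrightarrow> window_conv (code_avg P) (g P)"
  shows "\<exists>N :: nat \<Rightarrow> nat. (\<forall>k. N k > 0) \<and>
    (AE x in M. \<forall>P. finite P \<longrightarrow> (\<lambda>k. code_avg P 0 (N k) x) \<longlonglongrightarrow> g P x)"
proof -
  define Pn where "Pn = from_nat_into (Collect finite :: (nat \<times> (nat \<times> nat)) set set)"
  have range: "range Pn = Collect finite"
    unfolding Pn_def by (intro range_from_nat_into countable_Collect_finite) auto
  have fin: "finite (Pn j)" for j using range by auto
  note [measurable] = g(1)[OF fin] code_avg_measurable[OF fin]
  have "\<exists>n>0. \<forall>j\<le>k. (\<integral>x. \<bar>code_avg (Pn j) 0 n x - g (Pn j) x\<bar> \<partial>M) \<le> 1 / real (Suc k) ^ 2" for k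
  proof -
    have "eventually (\<lambda>n. (\<integral>x. \<bar>code_avg (Pn j) 0 n x - g (Pn j) x\<bar> \<partial>M) \<le> 1 / real (Suc k) ^ 2) sequentially" for j
    proof -
      have "1 / real (Suc k) ^ 2 > 0" by simp
      from lim[OF fin[of j], unfolded window_conv_def real_norm_def, rule_format, OF this]
      show ?thesis unfolding eventually_sequentially by blast
    qed
    then have "eventually (\<lambda>n. \<forall>j\<in>{..k}. (\<integral>x. \<bar>code_avg (Pn j) 0 n x - g (Pn j) x\<bar> \<partial>M) \<le> 1 / real (Suc k) ^ 2) sequentially"
      by (intro eventually_ball_finite) auto
    from eventually_happens[OF eventually_conj[OF this eventually_gt_at_top[of 0]]]
    show ?thesis by auto
  qed
  then obtain N where N: "\<And>k. N k > 0"
    and N_le: "\<And>j k. j \<le> k \<Longrightarrow> (\<integral>x. \<bar>code_avg (Pn j) 0 (N k) x - g (Pn j) x\<bar> \<partial>M) \<le> 1 / real (Suc k) ^ 2"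
    by metis
  define v where "v k x = (\<Sum>j\<le>k. \<bar>code_avg (Pn j) 0 (N k) x - g (Pn j) x\<bar>)" for k x
  have int: "integrable M (\<lambda>x. \<bar>code_avg (Pn j) 0 n x - g (Pn j) x\<bar>)" for j n
  proof (rule integrable_bounded[of _ 2])
    show "norm \<bar>code_avg (Pn j) 0 n x - g (Pn j) x\<bar> \<le> 2" for x
      using code_avg_bounds[of "Pn j" 0 n x] g(2)[OF fin, of j x] by simp
  qed measurable
  have v_int: "integrable M (v k)" for k
    unfolding v_def by (intro Bochner_Integration.integrable_sum int)
  have v_nonneg: "0 \<le> v k x" for k x by (simp add: v_def sum_nonneg)
  have "(\<integral>x. norm (v k x) \<partial>M) \<le> 1 / real (Suc k)" for k
  proof -
    have "(\<integral>x. norm (v k x) \<partial>M) = (\<Sum>j\<le>k. \<integral>x. \<bar>code_avg (Pn j) 0 (N k) x - g (Pn j) x\<bar> \<partial>M)"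
      using v_nonneg by (simp add: v_def int abs_of_nonneg sum_nonneg)
    also have "\<dots> \<le> (\<Sum>j\<le>k. 1 / real (Suc k) ^ 2)"
      by (intro sum_mono N_le) auto
    also have "\<dots> = 1 / real (Suc k)"
      by (simp add: power2_eq_square divide_simps)
    finally show ?thesis .
  qed
  then have "(\<lambda>k. \<integral>x. norm (v k x) \<partial>M) \<longlonglongrightarrow> 0"
    by (intro tendsto_sandwich[OF _ _ tendsto_const LIMSEQ_inverse_real_of_nat])
       (auto simp: inverse_eq_divide)
  from tendsto_L1_AE_subseq[OF v_int this]
  obtain r where r: "strict_mono r" "AE x in M. (\<lambda>k. v (r k) x) \<longlonglongrightarrow> 0" by blast
  have "AE x in M. \<forall>P. finite P \<longrightarrow> (\<lambda>k. code_avg P 0 (N (r k)) x) \<longlonglongrightarrow> g P x"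
    using r(2)
  proof eventually_elim
    case (elim x)
    show ?case
    proof (intro allI impI)
      fix P :: "(nat \<times> (nat \<times> nat)) set" assume "finite P"
      then obtain j where j: "P = Pn j" using range by blast
      have "(\<lambda>k. code_avg P 0 (N (r k)) x - g P x) \<longlonglongrightarrow> 0"
      proof (rule Lim_null_comparison[OF _ elim])
        have "norm (code_avg P 0 (N (r k)) x - g P x) \<le> v (r k) x" if "k \<ge> j" for k
          unfolding v_def j using seq_suble[OF r(1), of k] that
            member_le_sum[of j "{..r k}" "\<lambda>j. \<bar>code_avg (Pn j) 0 (N (r k)) x - g (Pn j) x\<bar>"]
          by simp
        then show "eventually (\<lambda>k. norm (code_avg P 0 (N (r k)) x - g P x) \<le> v (r k) x) sequentially"
          unfolding eventually_sequentially by blast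
      qed
      then show "(\<lambda>k. code_avg P 0 (N (r k)) x) \<longlonglongrightarrow> g P x"
        by (simp add: LIM_zero_iff)
    qed
  qed
  then show ?thesis using N by (intro exI[of _ "\<lambda>k. N (r k)"]) auto
qed

text \<open>Outside one null set the ultralimits are genuine limits, so on each cylinder they equal
  a measurable function of \<open>x\<close>. The ultralimit alone would yield a measure for each
  \<open>x\<close> but no measurability in \<open>x\<close>.\<close>

theorem ex_kernel:
  "\<exists>\<kappa>\<in>measurable M (prob_algebra cantor). \<forall>P. finite P \<longrightarrow>
    window_conv (code_avg P) (\<lambda>x. measure (\<kappa> x) (cylinder P))"
proof -
  let ?Q = "\<lambda>P g. finite P \<longrightarrow> g \<in> borel_measurable M \<and> (\<forall>x. \<bar>g x\<bar> \<le> 1) \<and>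
    window_conv (code_avg P) g"
  have "\<forall>P. \<exists>g. ?Q P g"
    using code_avg_limit by (auto simp: Bex_def)
  from choice[OF this] obtain g where Q: "\<And>P. ?Q P (g P)" by blast
  then have g: "\<And>P. finite P \<Longrightarrow> g P \<in> borel_measurable M" "\<And>P x. finite P \<Longrightarrow> \<bar>g P x\<bar> \<le> 1"
    and g_lim: "\<And>P. finite P \<Longrightarrow> window_conv (code_avg P) (g P)"
    by simp_all
  have "\<exists>N :: nat \<Rightarrow> nat. (\<forall>k. N k > 0) \<and>
      (AE x in M. \<forall>P. finite P \<longrightarrow> (\<lambda>k. code_avg P 0 (N k) x) \<longlonglongrightarrow> g P x)"
    by (rule ex_common_subsequence) (simp_all add: g g_lim)
  then obtain N :: "nat \<Rightarrow> nat" where N: "\<And>k. N k > 0"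
    and AE_lim: "AE x in M. \<forall>P. finite P \<longrightarrow> (\<lambda>k. code_avg P 0 (N k) x) \<longlonglongrightarrow> g P x"
    by blast
  obtain Z where Z': "\<And>x. x \<in> space M - Z \<Longrightarrow> \<forall>P. finite P \<longrightarrow> (\<lambda>k. code_avg P 0 (N k) x) \<longlonglongrightarrow> g P x"
    and Z: "Z \<in> null_sets M"
    using AE_lim by (rule AE_E3) (rule that)
  have conv: "(\<lambda>k. code_avg P 0 (N k) x) \<longlonglongrightarrow> g P x" if "x \<in> space M - Z" "finite P" for x P
    using Z'[OF that(1)] that(2) by blast
  note [measurable] = null_setsD2[OF Z]
  have "\<forall>x. \<exists>\<kappa>. prob_space \<kappa> \<and> sets \<kappa> = sets cantor \<and>
      (\<forall>P. finite P \<longrightarrow> measure \<kappa> (cylinder P) = ulim (\<lambda>k. code_avg P 0 (N k) x))"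
    using ex_empirical_limit[of N "\<lambda>n. code n x" for x, OF N] by (simp add: code_avg_def atLeast0LessThan)
  from choice[OF this] obtain \<kappa>' where \<kappa>': "\<And>x. prob_space (\<kappa>' x)" "\<And>x. sets (\<kappa>' x) = sets cantor"
    and \<kappa>'_cyl: "\<And>x P. finite P \<Longrightarrow> measure (\<kappa>' x) (cylinder P) = ulim (\<lambda>k. code_avg P 0 (N k) x)"
    by blast
  \<comment> \<open>A fixed point mass on the null set keeps the kernel measurable. The all-true
    point lies in every cylinder, whence the value 1 below.\<close>
  define \<kappa> where "\<kappa> x = (if x \<in> Z then return cantor (\<lambda>_. True) else \<kappa>' x)" for x
  have \<kappa>: "prob_space (\<kappa> x)" "sets (\<kappa> x) = sets cantor" for x
    using \<kappa>' by (auto simp: \<kappa>_def space_PiM PiE_UNIV_domain intro: prob_space_return)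
  have \<kappa>_cyl: "measure (\<kappa> x) (cylinder P) = g P x" if "x \<in> space M - Z" "finite P" for x P
    using ulim_eq_limit[OF conv[OF that]] that \<kappa>'_cyl by (simp add: \<kappa>_def)
  have "\<kappa> \<in> measurable M (prob_algebra cantor)"
  proof (rule measurable_prob_algebra_generated[OF sets_cantor_cylinder Int_stable_cylinder])
    fix A :: "(nat \<times> (nat \<times> nat) \<Rightarrow> bool) set" assume "A \<in> cylinder ` {P. finite P}"
    then obtain P where P: "finite P" "A = cylinder P" by auto
    note [measurable] = g(1)[OF P(1)]
    have "(\<lambda>x. if x \<in> Z then 1 else ennreal (g P x)) \<in> borel_measurable M" by measurable
    moreover have "emeasure (\<kappa> x) A = (if x \<in> Z then 1 else ennreal (g P x))" if "x \<in> space M" for x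
    proof (cases "x \<in> Z")
      case True
      then show ?thesis
        using cylinder_sets[OF P(1)] by (simp add: \<kappa>_def P(2)) (simp add: cylinder_def)
    next
      case False
      interpret K: prob_space "\<kappa> x" by (rule \<kappa>)
      show ?thesis using \<kappa>_cyl[of x P] False that P by (simp add: K.emeasure_eq_measure)
    qed
    ultimately show "(\<lambda>x. emeasure (\<kappa> x) A) \<in> borel_measurable M"
      by (simp cong: measurable_cong)
  qed (use \<kappa> in auto)
  moreover have "(\<integral>x. \<bar>code_avg P a n x - measure (\<kappa> x) (cylinder P)\<bar> \<partial>M) = (\<integral>x. \<bar>code_avg P a n x - g P x\<bar> \<partial>M)"
    if "finite P" for P a n
  proof (rule integral_cong_AE)
    note [measurable] = g(1)[OF that] code_avg_measurable[OF that] cylinder_sets[OF that]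
    note [measurable] = \<open>\<kappa> \<in> measurable M (prob_algebra cantor)\<close>
    show "(\<lambda>x. \<bar>code_avg P a n x - measure (\<kappa> x) (cylinder P)\<bar>) \<in> borel_measurable M"
      by measurable
    show "(\<lambda>x. \<bar>code_avg P a n x - g P x\<bar>) \<in> borel_measurable M" by measurable
    show "AE x in M. \<bar>code_avg P a n x - measure (\<kappa> x) (cylinder P)\<bar> = \<bar>code_avg P a n x - g P x\<bar>"
      using AE_not_in[OF Z] AE_space by eventually_elim (use \<kappa>_cyl[OF _ that] in simp)
  qed
  ultimately show ?thesis using g_lim by (intro bexI[of _ \<kappa>] allI impI) (simp_all add: window_conv_def)
qed

end

section \<open>Averages of bounded functions\<close>

text \<open>A functional monotone class argument: from the intersection-stable generator to
  measurable sets, to simple functions, to bounded functions. Limits are taken only under a common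
  bound, so that dominated convergence can establish the closure property.\<close>

lemma bounded_measurable_induct:
  fixes f :: "'a \<Rightarrow> complex"
  assumes sets: "sets N = sigma_sets UNIV G" and G: "Int_stable G"
    and f: "f \<in> borel_measurable N" "\<And>x. norm (f x) \<le> C"
    and base: "\<And>A. A \<in> G \<Longrightarrow> P (indicator A)" and one: "P (\<lambda>_. 1)"
    and lin: "\<And>f g c C. f \<in> borel_measurable N \<Longrightarrow> g \<in> borel_measurable N \<Longrightarrow>
        (\<And>x. norm (f x) \<le> C) \<Longrightarrow> (\<And>x. norm (g x) \<le> C) \<Longrightarrow> P f \<Longrightarrow> P g \<Longrightarrow> P (\<lambda>x. f x + c * g x)"
    and lim: "\<And>s f C. (\<And>k. s k \<in> borel_measurable N) \<Longrightarrow> f \<in> borel_measurable N \<Longrightarrow>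
        (\<And>k x. norm (s k x) \<le> C) \<Longrightarrow> (\<And>k. P (s k)) \<Longrightarrow> (\<And>x. (\<lambda>k. s k x) \<longlonglongrightarrow> f x) \<Longrightarrow> P f"
  shows "P f"
proof -
  have space: "space N = UNIV"
    using sets sets.top[of N] sets.space_closed[of N] sigma_sets_top[of UNIV G] by auto
  have ind_meas: "(indicator A :: 'a \<Rightarrow> complex) \<in> borel_measurable N" if "A \<in> sets N" for A
    using that by (rule borel_measurable_indicator)
  have ind_le: "norm (indicator A x :: complex) \<le> 1" for A and x :: 'a
    by (simp add: indicator_def)
  have G_Pow: "G \<subseteq> Pow UNIV" by simp
  have zero: "P (\<lambda>_. 0)"
    using lin[of "\<lambda>_. 1" "\<lambda>_. 1" 1 "-1"] one by simp
  have ind: "P (indicator A)" if "A \<in> sets N" for A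
    using G G_Pow that[unfolded sets]
  proof (induction rule: sigma_sets_induct_disjoint)
    case empty
    then show ?case using zero by (simp add: indicator_def[abs_def])
  next
    case (compl A)
    have "P (\<lambda>x. 1 + (-1) * indicator A x)"
      using compl ind_meas[of A] sets ind_le
      by (intro lin[where C = 1] one) auto
    moreover have "(\<lambda>x. 1 + (-1) * indicator A x) = (indicator (UNIV - A) :: 'a \<Rightarrow> complex)"
      by (auto simp: indicator_def)
    ultimately show ?case by simp
  next
    case (union A)
    have A: "A i \<in> sets N" for i using union(2) by (auto simp: sets)
    have "P (indicator (\<Union>i<k. A i))" for k
    proof (induction k)
      case (Suc k)
      have "A i \<inter> A k = {}" if "i < k" for i
        using disjoint_family_onD[OF union(1), of i k] that by simp
      then have "(\<Union>i<k. A i) \<inter> A k = {}" by blast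
      then have "indicator (\<Union>i<Suc k. A i) x = (indicator (\<Union>i<k. A i) x + 1 * indicator (A k) x :: complex)" for x
        unfolding lessThan_Suc UN_insert Un_commute[of "A k"] by (auto simp: indicator_def)
      moreover have "P (\<lambda>x. indicator (\<Union>i<k. A i) x + 1 * indicator (A k) x)"
      proof (rule lin[where C = 1])
        show "(indicator (\<Union>i<k. A i) :: 'a \<Rightarrow> complex) \<in> borel_measurable N"
          by (rule ind_meas) (auto intro: A)
      qed (fact ind_meas[OF A] ind_le Suc union(3))+
      ultimately show ?case
        by (metis (no_types, lifting) ext)
    qed (use zero in \<open>simp add: indicator_def[abs_def]\<close>)
    then show ?case
    proof (rule lim[where C = 1, rotated 3])
      show "(indicator (\<Union>i<k. A i) :: 'a \<Rightarrow> complex) \<in> borel_measurable N" for k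
        by (rule ind_meas) (auto intro: A)
      show "(indicator (\<Union>i. A i) :: 'a \<Rightarrow> complex) \<in> borel_measurable N"
        by (rule ind_meas) (auto intro: A)
    qed (rule ind_le LIMSEQ_indicator_UN)+
  qed (rule base)
  have simple: "P g" if g: "simple_function N g" for g
  proof -
    define simp_part where "simp_part Y x = (\<Sum>y\<in>Y. y * indicator (g -` {y}) x)" for Y x
    have g_sets: "g -` {y} \<in> sets N" for y
      using measurable_sets[OF borel_measurable_simple_function[OF g], of "{y}"] by (simp add: space)
    have sum_meas: "simp_part Y \<in> borel_measurable N" for Y
      unfolding simp_part_def[abs_def] by (intro borel_measurable_sum borel_measurable_times borel_measurable_const ind_meas g_sets)
    have sum_le: "norm (simp_part Y x) \<le> (\<Sum>y\<in>Y. norm y)" for Y x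
      unfolding simp_part_def by (rule sum_norm_le) (simp add: norm_mult indicator_def)
    have fin: "finite (range g)" using simple_functionD(1)[OF g] by (simp add: space)
    have "P (simp_part Y)" if "finite Y" for Y
      using that
    proof (induction Y rule: finite_induct)
      case (insert y Y)
      have "P (\<lambda>x. simp_part Y x + y * indicator (g -` {y}) x)"
      proof (rule lin[where C = "1 + (\<Sum>y\<in>Y. norm y)"])
        show "norm (simp_part Y x) \<le> 1 + (\<Sum>y\<in>Y. norm y)" for x
          using sum_le[of Y x] by linarith
        show "norm (indicator (g -` {y}) x :: complex) \<le> 1 + (\<Sum>y\<in>Y. norm y)" for x
          by (rule order_trans[OF ind_le]) (simp add: sum_nonneg)
      qed (use insert.IH in \<open>auto intro: ind ind_meas g_sets sum_meas\<close>)
      moreover have "simp_part (insert y Y) = (\<lambda>x. simp_part Y x + y * indicator (g -` {y}) x)"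
        by (rule ext) (simp only: simp_part_def sum.insert[OF insert.hyps] add.commute)
      ultimately show ?case by simp
    qed (simp add: simp_part_def[abs_def] zero)
    moreover have "simp_part (range g) x = g x" for x
      unfolding simp_part_def using fin by (simp add: indicator_def if_distrib cong: if_cong)
    ultimately show ?thesis using fin by (metis ext)
  qed
  obtain s where s: "\<And>k. simple_function N (s k)" "\<And>x. (\<lambda>k. s k x) \<longlonglongrightarrow> f x"
    and s_le: "\<And>k x. norm (s k x) \<le> 2 * norm (f x)"
    using borel_measurable_implies_sequence_metric[OF f(1), of 0] by (auto simp: space)
  show "P f"
  proof (rule lim[where s = s and C = "2 * C"])
    show "norm (s k x) \<le> 2 * C" for k x
      using s_le[of k x] f(2)[of x] by linarith
  qed (use s f(1) simple in \<open>auto intro: borel_measurable_simple_function\<close>)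
qed

lemma norm_prod_bounded:
  fixes f :: "'i \<Rightarrow> 'c \<Rightarrow> 'b::real_normed_field"
  assumes "\<And>i. i \<in> J \<Longrightarrow> \<exists>C. \<forall>x. norm (f i x) \<le> C"
  obtains B where "B > 0" "\<And>w. norm (\<Prod>i\<in>J. f i (w i)) \<le> B"
proof -
  obtain C where C: "\<And>i x. i \<in> J \<Longrightarrow> norm (f i x) \<le> C i"
    using assms by metis
  have "norm (\<Prod>i\<in>J. f i (w i)) \<le> (\<Prod>i\<in>J. max 1 (C i))" for w
    unfolding prod_norm[symmetric] by (intro prod_mono) (auto intro: order_trans[OF C])
  moreover have "(\<Prod>i\<in>J. max 1 (C i)) > 0"
    by (intro prod_pos) auto
  ultimately show ?thesis by (intro that[of "\<Prod>i\<in>J. max 1 (C i)"])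
qed

section \<open>From cylinders to bounded functions on the Cantor space\<close>

locale kernel_prob = coded_prob M T S D \<phi>
  for M :: "'a measure" and T S D \<phi> +
  fixes \<kappa> :: "'a \<Rightarrow> (nat \<times> (nat \<times> nat) \<Rightarrow> bool) measure"
  assumes measurable_\<kappa>: "\<kappa> \<in> measurable M (prob_algebra cantor)"
    and code_avg_tendsto: "finite P \<Longrightarrow> window_conv (code_avg P) (\<lambda>x. measure (\<kappa> x) (cylinder P))"
begin

lemma measurable_\<kappa>_subprob [measurable]: "\<kappa> \<in> measurable M (subprob_algebra cantor)"
  by (rule measurable_prob_algebraD[OF measurable_\<kappa>])

lemma prob_space_\<kappa>: "x \<in> space M \<Longrightarrow> prob_space (\<kappa> x)"
  and sets_\<kappa>: "x \<in> space M \<Longrightarrow> sets (\<kappa> x) = sets cantor"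
  using measurable_space[OF measurable_\<kappa>] by (auto simp: space_prob_algebra)

lemma space_\<kappa>: "x \<in> space M \<Longrightarrow> space (\<kappa> x) = UNIV"
  using sets_eq_imp_space_eq[OF sets_\<kappa>] by (simp add: space_PiM PiE_UNIV_domain)

definition coord :: "nat \<Rightarrow> (nat \<times> (nat \<times> nat) \<Rightarrow> bool) \<Rightarrow> nat \<times> nat \<Rightarrow> bool" where
  "coord i \<omega> = (\<lambda>q. \<omega> (i, q))"

lemma measurable_coord [measurable]: "coord i \<in> measurable cantor cantor"
  unfolding coord_def by (rule measurable_PiM_single') auto

definition bounded_fun :: "((nat \<times> nat \<Rightarrow> bool) \<Rightarrow> complex) \<Rightarrow> bool" where
  "bounded_fun h \<longleftrightarrow> h \<in> borel_measurable cantor \<and> (\<exists>C. \<forall>w. norm (h w) \<le> C)"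

definition limit_fun :: "(nat \<Rightarrow> (nat \<times> nat \<Rightarrow> bool) \<Rightarrow> complex) \<Rightarrow> 'a \<Rightarrow> complex" where
  "limit_fun F x = (\<integral>\<omega>. (\<Prod>i\<in>D. F i (coord i \<omega>)) \<partial>\<kappa> x)"

definition converges :: "(nat \<Rightarrow> (nat \<times> nat \<Rightarrow> bool) \<Rightarrow> complex) \<Rightarrow> bool" where
  "converges F \<longleftrightarrow> window_conv (mavg D (\<lambda>i x. F i (\<phi> x))) (limit_fun F)"

lemma bounded_fun_prod:
  assumes F: "\<And>i. i \<in> J \<Longrightarrow> bounded_fun (F i)"
  obtains B where "B > 0" "\<And>w. norm (\<Prod>i\<in>J. F i (w i)) \<le> B"
proof (rule norm_prod_bounded)
  show "\<exists>C. \<forall>w. norm (F i w) \<le> C" if "i \<in> J" for i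
    using F[OF that] by (simp add: bounded_fun_def)
qed (rule that)

lemma integrable_\<kappa>:
  fixes f :: "_ \<Rightarrow> 'b::{banach, second_countable_topology}"
  assumes "x \<in> space M" "f \<in> borel_measurable cantor" "\<And>\<omega>. norm (f \<omega>) \<le> B"
  shows "integrable (\<kappa> x) f"
proof -
  interpret X: prob_space "\<kappa> x" by (rule prob_space_\<kappa>[OF assms(1)])
  show ?thesis
    using assms by (intro X.integrable_bounded) (simp_all cong: measurable_cong_sets add: sets_\<kappa>)
qed

lemma measurable_slot_fun:
  assumes "bounded_fun h"
  shows "(\<lambda>\<omega>. h (coord i \<omega>)) \<in> borel_measurable cantor"
  using assms measurable_compose[OF measurable_coord] by (auto simp: bounded_fun_def)

lemma measurable_slot_prod:
  assumes "\<And>i. i \<in> J \<Longrightarrow> bounded_fun (F i)"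
  shows "(\<lambda>\<omega>. \<Prod>i\<in>J. F i (coord i \<omega>)) \<in> borel_measurable cantor"
  by (intro borel_measurable_prod measurable_slot_fun assms)

lemma measurable_limit_fun:
  assumes "\<And>i. i \<in> D \<Longrightarrow> bounded_fun (F i)"
  shows "limit_fun F \<in> borel_measurable M"
  unfolding limit_fun_def[abs_def]
  by (rule measurable_compose[OF measurable_\<kappa>_subprob integral_measurable_subprob_algebra])
     (rule measurable_slot_prod[OF assms])

lemma measurable_mavg_code:
  assumes "\<And>i. i \<in> D \<Longrightarrow> bounded_fun (F i)"
  shows "mavg D (\<lambda>i x. F i (\<phi> x)) a N \<in> borel_measurable M"
proof (rule mavg_measurable)
  show "(\<lambda>x. F i (\<phi> x)) \<in> borel_measurable M" if "i \<in> D" for i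
    using assms[OF that] measurable_compose[OF measurable_\<phi>] by (auto simp: bounded_fun_def)
qed

lemma norm_limit_fun_le:
  assumes "x \<in> space M" "\<And>\<omega>. norm (\<Prod>i\<in>D. F i (coord i \<omega>)) \<le> B"
    and "\<And>i. i \<in> D \<Longrightarrow> bounded_fun (F i)"
  shows "norm (limit_fun F x) \<le> B"
proof -
  interpret X: prob_space "\<kappa> x" by (rule prob_space_\<kappa>[OF assms(1)])
  have "norm (limit_fun F x) \<le> (\<integral>\<omega>. norm (\<Prod>i\<in>D. F i (coord i \<omega>)) \<partial>\<kappa> x)"
    unfolding limit_fun_def by (rule integral_norm_bound)
  also have "\<dots> \<le> (\<integral>\<omega>. B \<partial>\<kappa> x)"
    by (intro integral_mono integrable_norm integrable_\<kappa>[OF assms(1) _ assms(2)] measurable_slot_prod assms) auto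
  finally show ?thesis by (simp add: X.prob_space)
qed

lemma integrable_difference:
  assumes F: "\<And>i. i \<in> D \<Longrightarrow> bounded_fun (F i)"
  shows "integrable M (mavg D (\<lambda>i x. F i (\<phi> x)) a N)" "integrable M (limit_fun F)"
proof -
  obtain B where B: "B > 0" "\<And>w. norm (\<Prod>i\<in>D. F i (w i)) \<le> B"
    by (rule bounded_fun_prod[OF F]) auto
  show "integrable M (mavg D (\<lambda>i x. F i (\<phi> x)) a N)"
    by (rule integrable_bounded[OF measurable_mavg_code[OF F] norm_mavg_le[OF B(2)]])
  show "integrable M (limit_fun F)"
    by (rule integrable_const_bound[where B = B])
       (auto intro!: norm_limit_fun_le B(2) F measurable_limit_fun)
qed

context
  fixes F :: "nat \<Rightarrow> (nat \<times> nat \<Rightarrow> bool) \<Rightarrow> complex" and j :: nat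
  assumes j: "j \<in> D" and F: "\<And>i. i \<in> D \<Longrightarrow> bounded_fun (F i)"
begin

lemma prod_slot: "(\<Prod>i\<in>D. (F(j := h)) i (w i)) = h (w j) * (\<Prod>i\<in>D - {j}. F i (w i))"
proof -
  have "(\<Prod>i\<in>D - {j}. (F(j := h)) i (w i)) = (\<Prod>i\<in>D - {j}. F i (w i))"
    by (rule prod.cong) auto
  then show ?thesis by (simp add: prod.remove[OF finite_D j])
qed

lemma mavg_slot: "mavg D (\<lambda>i x. (F(j := h)) i (\<phi> x)) a N x =
    (\<Sum>n\<in>{a..<a+N}. h (\<phi> ((T j ^^ n) x)) * (\<Prod>i\<in>D - {j}. F i (\<phi> ((T i ^^ n) x)))) / of_nat N"
  unfolding mavg_def by (simp only: prod_slot[where w = "\<lambda>i. \<phi> ((T i ^^ _) x)"])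

lemma limit_fun_slot: "limit_fun (F(j := h)) x =
    (\<integral>\<omega>. h (coord j \<omega>) * (\<Prod>i\<in>D - {j}. F i (coord i \<omega>)) \<partial>\<kappa> x)"
  unfolding limit_fun_def by (simp only: prod_slot[where w = "\<lambda>i. coord i _"])

lemma F_upd: "bounded_fun h \<Longrightarrow> i \<in> D \<Longrightarrow> bounded_fun ((F(j := h)) i)"
  using F by simp

lemma integrable_slot:
  assumes "x \<in> space M" "bounded_fun h"
  shows "integrable (\<kappa> x) (\<lambda>\<omega>. h (coord j \<omega>) * (\<Prod>i\<in>D - {j}. F i (coord i \<omega>)))"
proof -
  obtain B where B: "B > 0" "\<And>w. norm (\<Prod>i\<in>D. (F(j := h)) i (w i)) \<le> B"
    by (rule bounded_fun_prod[OF F_upd[OF assms(2)]]) auto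
  show ?thesis
    using integrable_\<kappa>[OF assms(1) measurable_slot_prod[OF F_upd[OF assms(2)]] B(2)]
    by (simp only: prod_slot[where w = "\<lambda>i. coord i _"])
qed

lemma converges_lin:
  assumes h: "bounded_fun h" "bounded_fun h'" and conv: "converges (F(j := h))" "converges (F(j := h'))"
  shows "converges (F(j := \<lambda>w. h w + c * h' w))"
proof -
  let ?H = "\<lambda>w. h w + c * h' w"
  let ?m = "\<lambda>h. mavg D (\<lambda>i x. (F(j := h)) i (\<phi> x))" and ?l = "\<lambda>h. limit_fun (F(j := h))"
  have int: "integrable M (?m h a N)" "integrable M (?l h)" if "bounded_fun h" for h a N
    by (rule integrable_difference, rule F_upd[OF that], assumption)+
  have "window_conv (\<lambda>a N x. ?m h a N x + c * ?m h' a N x) (\<lambda>x. ?l h x + c * ?l h' x)"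
    using conv unfolding converges_def by (rule window_conv_lin) (rule int h)+
  moreover have "?m ?H a N x = ?m h a N x + c * ?m h' a N x" for a N x
    unfolding mavg_slot
    by (simp add: distrib_right sum.distrib add_divide_distrib mult.assoc sum_distrib_left)
  moreover have "?l ?H x = ?l h x + c * ?l h' x" if x: "x \<in> space M" for x
    unfolding limit_fun_slot distrib_right mult.assoc
    using integrable_slot[OF x h(1)] integrable_slot[OF x h(2)] by simp
  ultimately show ?thesis
    unfolding converges_def window_conv_def by (simp cong: Bochner_Integration.integral_cong)
qed

text \<open>Since \<open>T j\<close> preserves \<open>M\<close>, changing slot \<open>j\<close> from
  \<open>h\<close> to \<open>s k\<close> costs at most \<open>B\<close> times the mean of
  \<open>r k\<close>, the same for all windows. For the limit functions, dominated convergence is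
  used twice, over \<open>\<kappa> x\<close> and then over \<open>M\<close>.\<close>

lemma converges_lim:
  assumes s: "\<And>k. s k \<in> borel_measurable cantor" and h: "h \<in> borel_measurable cantor"
    and C: "\<And>k w. norm (s k w) \<le> C" and conv: "\<And>k. converges (F(j := s k))"
    and lim: "\<And>w. (\<lambda>k. s k w) \<longlonglongrightarrow> h w"
  shows "converges (F(j := h))"
proof -
  let ?m = "\<lambda>h a N. mavg D (\<lambda>i x. (F(j := h)) i (\<phi> x)) a N" and ?l = "\<lambda>h. limit_fun (F(j := h))"
  have int: "integrable M (?m h a N)" "integrable M (?l h)" if "bounded_fun h" for h a N
    by (rule integrable_difference, rule F_upd[OF that], assumption)+
  have h_le: "norm (h w) \<le> C" for w
    by (rule LIMSEQ_le_const2[OF tendsto_norm[OF lim]]) (use C in auto)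
  then have bs: "bounded_fun (s k)" and bh: "bounded_fun h" for k
    using s h C by (auto simp: bounded_fun_def intro!: exI[of _ C])
  obtain B where B: "B > 0" "\<And>w. norm (\<Prod>i\<in>D - {j}. F i (w i)) \<le> B"
    by (rule bounded_fun_prod[of "D - {j}" F]) (use F in auto)
  have slot_le: "norm (z * (\<Prod>i\<in>D - {j}. F i (w i))) \<le> B * norm z" for z w
    unfolding norm_mult by (subst mult.commute) (intro mult_right_mono B(2) norm_ge_zero)
  define r where "r k x = norm (h (\<phi> x) - s k (\<phi> x))" for k x
  have r_meas: "r k \<in> borel_measurable M" for k
  proof -
    note [measurable] = s h
    show ?thesis unfolding r_def by measurable
  qed
  have r_le: "norm (r k x) \<le> 2 * C" for k x
    unfolding r_def using norm_triangle_ineq4[of "h (\<phi> x)" "s k (\<phi> x)"] h_le[of "\<phi> x"] C[of k "\<phi> x"] by simp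
  have int_r: "integrable M (\<lambda>x. r k ((T j ^^ n) x))" for k n
    by (rule integrable_bounded[OF measurable_compose[OF measurable_pow_T r_meas] r_le])
  have "(\<lambda>k. \<integral>x. r k x \<partial>M) \<longlonglongrightarrow> (\<integral>x. 0 \<partial>M)"
  proof (rule integral_dominated_convergence[where w = "\<lambda>_. 2 * C"])
    show "AE x in M. (\<lambda>k. r k x) \<longlonglongrightarrow> 0"
    proof (intro AE_I2)
      show "(\<lambda>k. r k x) \<longlonglongrightarrow> 0" for x
        unfolding r_def using tendsto_norm[OF tendsto_diff[OF tendsto_const lim[of "\<phi> x"], of "h (\<phi> x)"]] by simp
    qed
  qed (use r_meas r_le in auto)
  then have r_lim: "(\<lambda>k. B * (\<integral>x. r k x \<partial>M)) \<longlonglongrightarrow> 0"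
    using tendsto_mult_right_zero by force
  have avg: "(\<integral>x. norm (?m h a N x - ?m (s k) a N x) \<partial>M) \<le> B * (\<integral>x. r k x \<partial>M)" for k a N
  proof -
    have "norm (?m h a N x - ?m (s k) a N x) \<le> (\<Sum>n\<in>{a..<a+N}. B * r k ((T j ^^ n) x)) / real N" for x
    proof -
      have "?m h a N x - ?m (s k) a N x = (\<Sum>n\<in>{a..<a+N}. (h (\<phi> ((T j ^^ n) x)) - s k (\<phi> ((T j ^^ n) x)))
          * (\<Prod>i\<in>D - {j}. F i (\<phi> ((T i ^^ n) x)))) / of_nat N"
        unfolding mavg_slot by (simp add: left_diff_distrib sum_subtractf diff_divide_distrib)
      also have "norm \<dots> \<le> (\<Sum>n\<in>{a..<a+N}. B * r k ((T j ^^ n) x)) / real N"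
        unfolding norm_divide norm_of_nat r_def
        by (intro divide_right_mono sum_norm_le slot_le[of _ "\<lambda>i. \<phi> ((T i ^^ _) x)"]) simp
      finally show ?thesis .
    qed
    then have "(\<integral>x. norm (?m h a N x - ?m (s k) a N x) \<partial>M)
        \<le> (\<integral>x. (\<Sum>n\<in>{a..<a+N}. B * r k ((T j ^^ n) x)) / real N \<partial>M)"
      by (intro integral_mono integrable_norm Bochner_Integration.integrable_diff int bs bh
          integrable_divide Bochner_Integration.integrable_sum integrable_mult_right int_r)
    also have "\<dots> = (\<Sum>n\<in>{a..<a+N}. B * (\<integral>x. r k x \<partial>M)) / real N"
      using integral_pow_T[OF r_meas] by (simp add: int_r)
    also have "\<dots> \<le> B * (\<integral>x. r k x \<partial>M)"
      using B(1) by (cases "N = 0") (simp_all add: r_def)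
    finally show ?thesis .
  qed
  have l_lim: "(\<lambda>k. ?l (s k) x) \<longlonglongrightarrow> ?l h x" if x: "x \<in> space M" for x
    unfolding limit_fun_slot
  proof (rule integral_dominated_convergence[where w = "\<lambda>_. B * C"])
    interpret X: prob_space "\<kappa> x" by (rule prob_space_\<kappa>[OF x])
    show "integrable (\<kappa> x) (\<lambda>_. B * C)" by simp
    show "AE \<omega> in \<kappa> x. norm (s k (coord j \<omega>) * (\<Prod>i\<in>D - {j}. F i (coord i \<omega>))) \<le> B * C" for k
    proof (intro AE_I2)
      fix \<omega>
      have "B * norm (s k (coord j \<omega>)) \<le> B * C" using B(1) C by (intro mult_left_mono) auto
      with slot_le[of _ "\<lambda>i. coord i \<omega>"]
      show "norm (s k (coord j \<omega>) * (\<Prod>i\<in>D - {j}. F i (coord i \<omega>))) \<le> B * C" by (rule order_trans)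
    qed
    show "AE \<omega> in \<kappa> x. (\<lambda>k. s k (coord j \<omega>) * (\<Prod>i\<in>D - {j}. F i (coord i \<omega>)))
        \<longlonglongrightarrow> h (coord j \<omega>) * (\<Prod>i\<in>D - {j}. F i (coord i \<omega>))"
      by (intro AE_I2 tendsto_mult_right lim)
  qed (rule borel_measurable_integrable[OF integrable_slot[OF x bh]] borel_measurable_integrable[OF integrable_slot[OF x bs]])+
  have l_le: "norm (?l g x) \<le> B * C" if x: "x \<in> space M" and g: "bounded_fun g" "\<And>w. norm (g w) \<le> C" for g x
  proof (rule norm_limit_fun_le[OF x _ F_upd[OF g(1)]])
    show "norm (\<Prod>i\<in>D. (F(j := g)) i (coord i \<omega>)) \<le> B * C" for \<omega>
      unfolding prod_slot[where w = "\<lambda>i. coord i \<omega>"]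
      using order_trans[OF slot_le[of _ "\<lambda>i. coord i \<omega>"] mult_left_mono[OF g(2)]] B(1) by simp
  qed
  have "(\<lambda>k. \<integral>x. norm (?l h x - ?l (s k) x) \<partial>M) \<longlonglongrightarrow> (\<integral>x. 0 \<partial>M)"
  proof (rule integral_dominated_convergence[where w = "\<lambda>_. 2 * (B * C)"])
    show "AE x in M. (\<lambda>k. norm (?l h x - ?l (s k) x)) \<longlonglongrightarrow> 0"
    proof (intro AE_I2)
      show "(\<lambda>k. norm (?l h x - ?l (s k) x)) \<longlonglongrightarrow> 0" if "x \<in> space M" for x
        using tendsto_norm[OF tendsto_diff[OF tendsto_const l_lim[OF that], of "?l h x"]] by simp
    qed
    show "AE x in M. norm (norm (?l h x - ?l (s k) x)) \<le> 2 * (B * C)" for k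
    proof (intro AE_I2)
      fix x assume x: "x \<in> space M"
      show "norm (norm (?l h x - ?l (s k) x)) \<le> 2 * (B * C)"
        using norm_triangle_ineq4[of "?l h x" "?l (s k) x"] l_le[OF x bh h_le] l_le[OF x bs[of k] C] by simp
    qed
  qed (use int[OF bh] int[OF bs] in auto)
  then have "(\<lambda>k. B * (\<integral>x. r k x \<partial>M) + (\<integral>x. norm (?l h x - ?l (s k) x) \<partial>M)) \<longlonglongrightarrow> 0"
    using tendsto_add[OF r_lim] by simp
  then show ?thesis
    unfolding converges_def
  proof (rule window_conv_approx[OF int[OF bs] int[OF bh] conv[unfolded converges_def]])
    have "0 \<le> (\<integral>x. norm (?l h x - ?l (s k) x) \<partial>M)" "0 \<le> B * (\<integral>x. r k x \<partial>M)" for k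
      using B(1) by (simp_all add: r_def)
    then show "(\<integral>x. norm (?m h a N x - ?m (s k) a N x) \<partial>M) \<le> B * (\<integral>x. r k x \<partial>M) + (\<integral>x. norm (?l h x - ?l (s k) x) \<partial>M)"
      "(\<integral>x. norm (?l h x - ?l (s k) x) \<partial>M) \<le> B * (\<integral>x. r k x \<partial>M) + (\<integral>x. norm (?l h x - ?l (s k) x) \<partial>M)" for k a N
      using avg[of a N k] by (simp_all add: add_increasing2 add_increasing)
  qed
qed

end

text \<open>One cylinder per slot amounts to a single cylinder of the joint code, for which
  \<open>\<kappa>\<close> was constructed.\<close>

lemma converges_cylinders:
  assumes Q: "\<And>i. finite (Q i)"
  shows "converges (\<lambda>i. indicator (cylinder (Q i)))"
proof -
  define P where "P = Sigma D Q"
  have P: "finite P" unfolding P_def by (intro finite_SigmaI finite_D Q)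
  have ind: "(\<Prod>i\<in>D. indicator (cylinder (Q i)) (w i)) = (of_bool (\<forall>i\<in>D. w i \<in> cylinder (Q i)) :: complex)" for w
    by (simp only: indicator_def of_bool_def[symmetric] if_distrib prod_of_bool[OF finite_D])
  have avg: "mavg D (\<lambda>i x. indicator (cylinder (Q i)) (\<phi> x)) a N x = complex_of_real (code_avg P a N x)" for a N x
  proof -
    have "indicator (cylinder P) (code n x) = (of_bool (\<forall>i\<in>D. \<phi> ((T i ^^ n) x) \<in> cylinder (Q i)) :: real)" for n
      by (auto simp: indicator_def P_def cylinder_def code_def)
    then show ?thesis
      unfolding mavg_def code_avg_def ind[of "\<lambda>i. \<phi> ((T i ^^ _) x)"] by (simp add: of_bool_def if_distrib[of complex_of_real] cong: if_cong)
  qed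
  have lim: "limit_fun (\<lambda>i. indicator (cylinder (Q i))) x = complex_of_real (measure (\<kappa> x) (cylinder P))" if x: "x \<in> space M" for x
  proof -
    interpret X: prob_space "\<kappa> x" by (rule prob_space_\<kappa>[OF x])
    have [measurable]: "cylinder P \<in> sets (\<kappa> x)" using cylinder_sets[OF P] by (simp add: sets_\<kappa>[OF x])
    have "(of_bool (\<forall>i\<in>D. (coord i \<omega>) \<in> cylinder (Q i)) :: complex) = complex_of_real (indicator (cylinder P) \<omega>)" for \<omega>
      by (auto simp: indicator_def P_def cylinder_def coord_def)
    then show ?thesis
      unfolding limit_fun_def ind[of "\<lambda>i. coord i _"] by (simp add: space_\<kappa>[OF x])
  qed
  have "norm (complex_of_real p - complex_of_real q) = \<bar>p - q\<bar>" for p q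
    by (simp flip: of_real_diff)
  then show ?thesis
    using code_avg_tendsto[OF P] unfolding converges_def window_conv_def
    by (simp add: avg lim cong: Bochner_Integration.integral_cong)
qed

lemma bounded_fun_cylinder: "finite Q \<Longrightarrow> bounded_fun (indicator (cylinder Q))"
  unfolding bounded_fun_def
  by (intro conjI borel_measurable_indicator cylinder_sets exI[of _ 1]) (simp_all add: indicator_def)

text \<open>The slots are released from cylinder indicators to bounded functions one at a time.\<close>

lemma converges_bounded_aux:
  assumes "finite K" "K \<subseteq> D" "\<And>i. i \<in> K \<Longrightarrow> bounded_fun (F i)"
    "\<And>i. i \<notin> K \<Longrightarrow> \<exists>Q. finite Q \<and> F i = indicator (cylinder Q)"
  shows "converges F"
  using assms
proof (induction K arbitrary: F rule: finite_induct)
  case empty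
  then have "\<forall>i. \<exists>Q. finite Q \<and> F i = indicator (cylinder Q)" by simp
  from choice[OF this] obtain Q where Q: "\<And>i. finite (Q i)" "\<And>i. F i = indicator (cylinder (Q i))"
    by auto
  from converges_cylinders[of Q, OF Q(1)] show ?case unfolding Q(2)[symmetric] by simp
next
  case (insert j K)
  have j: "j \<in> D" using insert.prems(1) by simp
  have F: "bounded_fun (F i)" for i
    using insert.prems(2,3)[of i] bounded_fun_cylinder by (cases "i \<in> insert j K") auto
  have IH: "converges (F(j := indicator (cylinder Q)))" if "finite Q" for Q
    using insert.prems insert.hyps that by (intro insert.IH) (auto split: if_splits)
  have F_meas: "F j \<in> borel_measurable cantor" using F[of j] by (simp add: bounded_fun_def)
  obtain C where C: "\<And>w. norm (F j w) \<le> C" using F[of j] by (auto simp: bounded_fun_def)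
  have "converges (F(j := F j))"
  proof (rule bounded_measurable_induct[OF sets_cantor_cylinder Int_stable_cylinder F_meas C,
        where P = "\<lambda>h. converges (F(j := h))"])
    show "converges (F(j := indicator A))" if A: "A \<in> cylinder ` {P. finite P}" for A
      using A IH by auto
    have one: "(\<lambda>_. 1) = (indicator (cylinder {}) :: (nat \<times> nat \<Rightarrow> bool) \<Rightarrow> complex)"
      by (auto simp: cylinder_def indicator_def)
    show "converges (F(j := \<lambda>_. 1))" unfolding one by (rule IH) simp
    show "converges (F(j := \<lambda>x. f x + c * g x))"
      if "f \<in> borel_measurable cantor" "g \<in> borel_measurable cantor" "\<And>x. norm (f x) \<le> C" "\<And>x. norm (g x) \<le> C"
        "converges (F(j := f))" "converges (F(j := g))" for f g c C
      using that by (intro converges_lin[OF j F]) (auto simp: bounded_fun_def)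
    show "converges (F(j := f))"
      if "\<And>k. s k \<in> borel_measurable cantor" "f \<in> borel_measurable cantor" "\<And>k x. norm (s k x) \<le> C"
        "\<And>k. converges (F(j := s k))" "\<And>x. (\<lambda>k. s k x) \<longlonglongrightarrow> f x" for s f C
      using j F that by (rule converges_lim)
  qed
  then show ?case by simp
qed

theorem converges_bounded:
  assumes "\<And>i. i \<in> D \<Longrightarrow> bounded_fun (F i)"
  shows "converges F"
proof -
  let ?F = "\<lambda>i. if i \<in> D then F i else indicator (cylinder {})"
  have "converges ?F"
    by (rule converges_bounded_aux[OF finite_D order_refl]) (use assms in auto)
  moreover have "(\<Prod>i\<in>D. ?F i (w i)) = (\<Prod>i\<in>D. F i (w i))" for w
    by (rule prod.cong) auto
  ultimately show ?thesis
    unfolding converges_def mavg_def limit_fun_def by simp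
qed

end

section \<open>The limit measures on the product space\<close>

locale limit_kernel = kernel_prob M T S D \<phi> \<kappa>
  for M :: "'a measure" and T S D \<phi> \<kappa> +
  fixes \<rho> :: "(nat \<times> nat \<Rightarrow> bool) \<Rightarrow> 'a"
  assumes measurable_\<rho> [measurable]: "\<rho> \<in> measurable cantor M"
    and \<rho>_\<phi>: "x \<in> space M \<Longrightarrow> \<rho> (\<phi> x) = x"
begin

abbreviation PX :: "(nat \<Rightarrow> 'a) measure" where
  "PX \<equiv> PiM D (\<lambda>_. M)"

definition decode :: "(nat \<times> (nat \<times> nat) \<Rightarrow> bool) \<Rightarrow> nat \<Rightarrow> 'a" where
  "decode \<omega> = (\<lambda>i\<in>D. \<rho> (coord i \<omega>))"

definition encode :: "(nat \<Rightarrow> 'a) \<Rightarrow> nat \<times> (nat \<times> nat) \<Rightarrow> bool" where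
  "encode \<xi> = (\<lambda>(i, q). i \<in> D \<and> \<phi> (\<xi> i) q)"

definition \<mu>F :: "'a \<Rightarrow> (nat \<Rightarrow> 'a) measure" where
  "\<mu>F x = distr (\<kappa> x) PX decode"

lemma measurable_decode [measurable]: "decode \<in> measurable cantor PX"
  unfolding decode_def by (intro measurable_restrict measurable_compose[OF measurable_coord measurable_\<rho>])

lemma measurable_encode [measurable]: "encode \<in> measurable PX cantor"
proof (rule measurable_PiM_single')
  show "(\<lambda>\<xi>. encode \<xi> p) \<in> measurable PX (count_space UNIV)" for p
  proof (cases "fst p \<in> D")
    case True
    have "(\<lambda>x. \<phi> x (snd p)) \<in> measurable M (count_space UNIV)"
      by (rule measurable_compose[OF measurable_\<phi> measurable_component_singleton]) simp
    from measurable_compose[OF measurable_component_singleton[OF True] this]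
    show ?thesis using True by (simp add: encode_def case_prod_beta)
  qed (simp add: encode_def case_prod_beta)
qed auto

lemma decode_encode: "\<xi> \<in> space PX \<Longrightarrow> decode (encode \<xi>) = \<xi>"
  by (auto simp: decode_def encode_def coord_def space_PiM PiE_iff \<rho>_\<phi> extensional_def fun_eq_iff restrict_def)

text \<open>Products of sets that are determined by finitely many bits of the code. For finite
  \<open>P\<close> they form a countable family, which takes over the role of the cylinders.\<close>

definition rect :: "(nat \<times> (nat \<times> nat)) set \<Rightarrow> (nat \<Rightarrow> 'a) set" where
  "rect P = encode -` cylinder P \<inter> space PX"

lemma rect_sets: "finite P \<Longrightarrow> rect P \<in> sets PX"
  unfolding rect_def by (rule measurable_sets[OF measurable_encode cylinder_sets])

lemma indicator_rect:
  assumes "fst ` P \<subseteq> D" "\<xi> \<in> space PX"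
  shows "indicator (rect P) \<xi> = (\<Prod>i\<in>D. cyl_fun P i (\<xi> i))"
  unfolding cyl_fun_def prod_of_bool[OF finite_D] using assms
  by (fastforce simp: indicator_def cylinder_def rect_def encode_def)

lemma rect_empty: "\<not> fst ` P \<subseteq> D \<Longrightarrow> rect P = {}"
  by (fastforce simp: rect_def cylinder_def encode_def)

text \<open>Agreement on rectangles is agreement on cylinders of the images under
  \<open>encode\<close>. Applying \<open>decode\<close>, a left inverse of \<open>encode\<close> on
  the space, brings the equality back.\<close>

lemma PX_measure_eqI:
  assumes sets: "sets m1 = sets PX" "sets m2 = sets PX"
    and fin: "emeasure m1 (space PX) \<noteq> \<infinity>"
    and eq: "\<And>P. finite P \<Longrightarrow> emeasure m1 (rect P) = emeasure m2 (rect P)"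
  shows "m1 = m2"
proof -
  have space: "space m1 = space PX" "space m2 = space PX"
    using sets by (auto dest: sets_eq_imp_space_eq)
  have enc: "encode \<in> measurable m1 cantor" "encode \<in> measurable m2 cantor"
    using measurable_encode sets by (simp_all cong: measurable_cong_sets)
  have "distr m1 cantor encode = distr m2 cantor encode"
  proof (rule measure_eqI_generator_eq[OF Int_stable_cylinder, where \<Omega> = UNIV and A = "\<lambda>_. UNIV"])
    show "emeasure (distr m1 cantor encode) X = emeasure (distr m2 cantor encode) X"
      if "X \<in> cylinder ` {P. finite P}" for X
      using that eq by (auto simp: emeasure_distr[OF enc(1)] emeasure_distr[OF enc(2)] cylinder_sets space rect_def)
    show "range (\<lambda>_ :: nat. UNIV) \<subseteq> cylinder ` {P :: (nat \<times> (nat \<times> nat)) set. finite P}"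
      by (auto simp: cylinder_def intro!: image_eqI[of _ _ "{}"])
    have "encode -` UNIV \<inter> space m1 = space PX" by (auto simp: space)
    then show "emeasure (distr m1 cantor encode) UNIV \<noteq> \<infinity>" for n :: nat
      using fin sets.top[of cantor] by (subst emeasure_distr[OF enc(1)]) (simp_all add: space_PiM PiE_UNIV_domain)
  qed (auto simp: sets_cantor_cylinder)
  then have "distr (distr m1 cantor encode) PX decode = distr (distr m2 cantor encode) PX decode"
    by simp
  moreover have "distr (distr m cantor encode) PX decode = m"
    if "encode \<in> measurable m cantor" "sets m = sets PX" for m
  proof -
    have "distr (distr m cantor encode) PX decode = distr m PX (decode \<circ> encode)"
      by (rule distr_distr[OF measurable_decode that(1)])
    also have "\<dots> = distr m m (\<lambda>\<xi>. \<xi>)"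
      by (rule distr_cong) (auto simp: that(2) decode_encode sets_eq_imp_space_eq[OF that(2)])
    finally show ?thesis by (simp add: distr_id[unfolded id_def])
  qed
  ultimately show ?thesis using enc sets by metis
qed

lemma measurable_\<mu>F: "\<mu>F \<in> measurable M (prob_algebra PX)"
  unfolding \<mu>F_def[abs_def]
  by (rule measurable_compose[OF measurable_\<kappa> measurable_distr_prob_space[OF measurable_decode]])

lemma measurable_\<mu>F_subprob [measurable]: "\<mu>F \<in> measurable M (subprob_algebra PX)"
  by (rule measurable_prob_algebraD[OF measurable_\<mu>F])

lemma prob_space_\<mu>F: "x \<in> space M \<Longrightarrow> prob_space (\<mu>F x)"
  and sets_\<mu>F: "x \<in> space M \<Longrightarrow> sets (\<mu>F x) = sets PX"
  using measurable_space[OF measurable_\<mu>F] by (auto simp: space_prob_algebra)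

lemma space_\<mu>F: "x \<in> space M \<Longrightarrow> space (\<mu>F x) = space PX"
  by (rule sets_eq_imp_space_eq[OF sets_\<mu>F])

lemma integrable_\<mu>F:
  fixes g :: "_ \<Rightarrow> 'b::{banach, second_countable_topology}"
  assumes x: "x \<in> space M" and g: "g \<in> borel_measurable PX" "\<And>\<xi>. norm (g \<xi>) \<le> C"
  shows "integrable (\<mu>F x) g"
proof -
  interpret X: prob_space "\<mu>F x" by (rule prob_space_\<mu>F[OF x])
  show ?thesis
    by (rule X.integrable_bounded[OF _ g(2)]) (use g(1) in \<open>simp cong: measurable_cong_sets add: sets_\<mu>F[OF x]\<close>)
qed

section \<open>Averages of bounded functions as integrals over the limit measures\<close>

definition bounded_tuple :: "(nat \<Rightarrow> 'a \<Rightarrow> 'b::real_normed_field) \<Rightarrow> bool" where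
  "bounded_tuple f \<longleftrightarrow> (\<forall>i\<in>D. f i \<in> borel_measurable M \<and> (\<exists>C. \<forall>x. norm (f i x) \<le> C))"

definition mean_limit :: "(nat \<Rightarrow> 'a \<Rightarrow> 'b) \<Rightarrow> 'a \<Rightarrow> 'b::{real_normed_field, banach, second_countable_topology}" where
  "mean_limit f x = (\<integral>\<xi>. (\<Prod>i\<in>D. f i (\<xi> i)) \<partial>\<mu>F x)"

lemma measurable_prod_tuple:
  fixes f :: "nat \<Rightarrow> 'a \<Rightarrow> 'b::{real_normed_field, second_countable_topology}"
  assumes "bounded_tuple f"
  shows "(\<lambda>\<xi>. \<Prod>i\<in>D. f i (\<xi> i)) \<in> borel_measurable PX"
proof (rule borel_measurable_prod)
  show "(\<lambda>\<xi>. f i (\<xi> i)) \<in> borel_measurable PX" if "i \<in> D" for i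
    by (rule measurable_compose[OF measurable_component_singleton[OF that]])
       (use assms that in \<open>simp add: bounded_tuple_def\<close>)
qed

lemma bounded_tuple_prod:
  fixes f :: "nat \<Rightarrow> 'a \<Rightarrow> 'b::real_normed_field"
  assumes "bounded_tuple f"
  obtains B where "B > 0" "\<And>w. norm (\<Prod>i\<in>D. f i (w i)) \<le> B"
proof (rule norm_prod_bounded)
  show "\<exists>C. \<forall>x. norm (f i x) \<le> C" if "i \<in> D" for i
    using assms that by (simp add: bounded_tuple_def)
qed (rule that)

lemma integrable_prod_tuple:
  fixes f :: "nat \<Rightarrow> 'a \<Rightarrow> 'b::{real_normed_field, banach, second_countable_topology}"
  assumes "x \<in> space M" "bounded_tuple f"
  shows "integrable (\<mu>F x) (\<lambda>\<xi>. \<Prod>i\<in>D. f i (\<xi> i))"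
proof -
  obtain B where B: "B > 0" "\<And>w. norm (\<Prod>i\<in>D. f i (w i)) \<le> B"
    by (rule bounded_tuple_prod[OF assms(2)]) auto
  show ?thesis
    by (rule integrable_\<mu>F[OF assms(1) measurable_prod_tuple[OF assms(2)] B(2)])
qed

lemma measurable_mean_limit:
  fixes f :: "nat \<Rightarrow> 'a \<Rightarrow> 'b::{real_normed_field, banach, second_countable_topology}"
  assumes "bounded_tuple f"
  shows "mean_limit f \<in> borel_measurable M"
  unfolding mean_limit_def[abs_def]
  by (rule measurable_compose[OF measurable_\<mu>F_subprob integral_measurable_subprob_algebra[OF measurable_prod_tuple[OF assms]]])

lemma norm_mean_limit_le:
  fixes f :: "nat \<Rightarrow> 'a \<Rightarrow> 'b::{real_normed_field, banach, second_countable_topology}"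
  assumes x: "x \<in> space M" and f: "bounded_tuple f" and B: "\<And>w. norm (\<Prod>i\<in>D. f i (w i)) \<le> B"
  shows "norm (mean_limit f x) \<le> B"
proof -
  interpret X: prob_space "\<mu>F x" by (rule prob_space_\<mu>F[OF x])
  have "norm (mean_limit f x) \<le> (\<integral>\<xi>. norm (\<Prod>i\<in>D. f i (\<xi> i)) \<partial>\<mu>F x)"
    unfolding mean_limit_def by (rule integral_norm_bound)
  also have "\<dots> \<le> (\<integral>\<xi>. B \<partial>\<mu>F x)"
    by (intro integral_mono integrable_norm integrable_prod_tuple x f B) auto
  finally show ?thesis by (simp add: X.prob_space)
qed

text \<open>Reading each \<open>f i\<close> through \<open>\<rho>\<close> gives functions of codes;
  their orbit averages are the original ones because \<open>\<rho>\<close> undoes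
  \<open>\<phi>\<close>.\<close>

theorem window_convergence:
  fixes f :: "nat \<Rightarrow> 'a \<Rightarrow> complex"
  assumes f: "bounded_tuple f"
  shows "window_conv (mavg D f) (mean_limit f)"
proof -
  define F where "F i w = f i (\<rho> w)" for i w
  have "bounded_fun (F i)" if i: "i \<in> D" for i
  proof -
    obtain C where "\<And>x. norm (f i x) \<le> C" using f i by (auto simp: bounded_tuple_def)
    then show ?thesis
      unfolding bounded_fun_def F_def
      using f i measurable_compose[OF measurable_\<rho>] by (auto simp: bounded_tuple_def)
  qed
  then have "converges F" by (rule converges_bounded)
  moreover have "mavg D (\<lambda>i x. F i (\<phi> x)) a N x = mavg D f a N x" if "x \<in> space M" for a N x
  proof -
    have "(T i ^^ n) x \<in> space M" for i n
      using measurable_space[OF measurable_pow_T that] .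
    then show ?thesis by (simp add: mavg_def F_def \<rho>_\<phi>)
  qed
  moreover have "limit_fun F x = mean_limit f x" if x: "x \<in> space M" for x
  proof -
    have dec: "decode \<in> measurable (\<kappa> x) PX"
      using measurable_decode by (simp cong: measurable_cong_sets add: sets_\<kappa>[OF x])
    have "(\<Prod>i\<in>D. f i (decode \<omega> i)) = (\<Prod>i\<in>D. F i (coord i \<omega>))" for \<omega>
      by (rule prod.cong) (auto simp: decode_def F_def)
    then show ?thesis
      unfolding mean_limit_def \<mu>F_def integral_distr[OF dec measurable_prod_tuple[OF f]] limit_fun_def by simp
  qed
  ultimately show ?thesis
    unfolding converges_def window_conv_def by (simp cong: Bochner_Integration.integral_cong)
qed

lemma bounded_tuple_of_real: "bounded_tuple f \<Longrightarrow> bounded_tuple (\<lambda>i x. complex_of_real (f i x))"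
  by (auto simp: bounded_tuple_def)

lemma window_convergence_real:
  fixes f :: "nat \<Rightarrow> 'a \<Rightarrow> real"
  assumes f: "bounded_tuple f"
  shows "window_conv (mavg D f) (mean_limit f)"
proof -
  have "mavg D (\<lambda>i x. complex_of_real (f i x)) a N x - mean_limit (\<lambda>i x. complex_of_real (f i x)) x
      = complex_of_real (mavg D f a N x - mean_limit f x)" for a N x
    by (simp add: mavg_def mean_limit_def flip: of_real_prod)
  then show ?thesis
    using window_convergence[OF bounded_tuple_of_real[OF f]] unfolding window_conv_def
    by (simp only: norm_of_real real_norm_def)
qed

lemma integrable_tuple:
  fixes f :: "nat \<Rightarrow> 'a \<Rightarrow> 'b::{real_normed_field, banach, second_countable_topology}"
  assumes f: "bounded_tuple f"
  shows "integrable M (mavg D f a N)" "integrable M (mean_limit f)"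
proof -
  obtain B where B: "B > 0" "\<And>w. norm (\<Prod>i\<in>D. f i (w i)) \<le> B"
    by (rule bounded_tuple_prod[OF f]) auto
  show "integrable M (mavg D f a N)"
    by (rule integrable_bounded[OF mavg_measurable norm_mavg_le[OF B(2)]])
       (use f in \<open>simp add: bounded_tuple_def\<close>)
  show "integrable M (mean_limit f)"
    by (rule integrable_const_bound[where B = B])
       (auto intro!: norm_mean_limit_le B(2) f measurable_mean_limit)
qed

lemma mean_limit_shift:
  fixes f f' :: "nat \<Rightarrow> 'a \<Rightarrow> real"
  assumes f: "bounded_tuple f" "bounded_tuple f'"
    and shift: "\<And>N x. mavg D f' 0 N x = mavg D f a N x"
  shows "AE x in M. mean_limit f' x = mean_limit f x"
  by (rule window_conv_unique[OF window_convergence_real[OF f(1)] window_convergence_real[OF f(2)] shift])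
     (rule integrable_tuple[OF f(1)] integrable_tuple[OF f(2)])+

section \<open>Invariance under the product map\<close>

definition pmap :: "(nat \<Rightarrow> 'a) \<Rightarrow> nat \<Rightarrow> 'a" where
  "pmap \<xi> = (\<lambda>i\<in>D. T i (\<xi> i))"

lemma measurable_pmap [measurable]: "pmap \<in> measurable PX PX"
  unfolding pmap_def
proof (rule measurable_restrict)
  show "(\<lambda>\<xi>. T i (\<xi> i)) \<in> measurable PX M" if "i \<in> D" for i
    by (rule measurable_compose[OF measurable_component_singleton[OF that] measurable_T])
qed

lemma pow_pmap: "i \<in> D \<Longrightarrow> (pmap ^^ n) \<xi> i = (T i ^^ n) (\<xi> i)"
  by (induction n) (simp_all add: pmap_def)

lemma measurable_pow_pmap [measurable]: "pmap ^^ n \<in> measurable PX PX"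
  by (induction n) simp_all

lemma bounded_tuple_cyl:
  assumes "finite P"
  shows "bounded_tuple (\<lambda>i x. cyl_fun P i ((T i ^^ n) x))"
  unfolding bounded_tuple_def
proof (intro ballI conjI exI allI)
  show "(\<lambda>x. cyl_fun P i ((T i ^^ n) x)) \<in> borel_measurable M" for i
    by (rule measurable_compose[OF measurable_pow_T cyl_fun_measurable[OF assms]])
  show "norm (cyl_fun P i ((T i ^^ n) x)) \<le> 1" for i x
    by (simp add: cyl_fun_def)
qed

lemma mean_limit_cyl:
  assumes x: "x \<in> space M" and P: "finite P" "fst ` P \<subseteq> D"
  shows "mean_limit (\<lambda>i x. cyl_fun P i ((T i ^^ n) x)) x = measure (\<mu>F x) ((pmap ^^ n) -` rect P \<inter> space PX)"
proof -
  interpret X: prob_space "\<mu>F x" by (rule prob_space_\<mu>F[OF x])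
  have "mean_limit (\<lambda>i x. cyl_fun P i ((T i ^^ n) x)) x = (\<integral>\<xi>. indicator ((pmap ^^ n) -` rect P \<inter> space PX) \<xi> \<partial>\<mu>F x)"
    unfolding mean_limit_def
  proof (rule Bochner_Integration.integral_cong[OF refl])
    fix \<xi> assume "\<xi> \<in> space (\<mu>F x)"
    then have \<xi>: "\<xi> \<in> space PX" by (simp add: space_\<mu>F[OF x])
    have "(\<Prod>i\<in>D. cyl_fun P i ((T i ^^ n) (\<xi> i))) = (\<Prod>i\<in>D. cyl_fun P i ((pmap ^^ n) \<xi> i))"
      by (rule prod.cong) (simp_all add: pow_pmap)
    also have "\<dots> = indicator (rect P) ((pmap ^^ n) \<xi>)"
      using measurable_space[OF measurable_pow_pmap \<xi>] by (simp add: indicator_rect[OF P(2)])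
    also have "\<dots> = indicator ((pmap ^^ n) -` rect P \<inter> space PX) \<xi>"
      using \<xi> by (simp add: indicator_def)
    finally show "(\<Prod>i\<in>D. cyl_fun P i ((T i ^^ n) (\<xi> i))) = \<dots>" .
  qed
  also have "\<dots> = measure (\<mu>F x) ((pmap ^^ n) -` rect P \<inter> space PX \<inter> space (\<mu>F x))"
    by (rule Bochner_Integration.integral_indicator)
  finally show ?thesis by (simp add: space_\<mu>F[OF x] Int_assoc)
qed

lemma mavg_shift: "mavg D (\<lambda>i x. f i ((T i ^^ h) x)) a N x = mavg D f (a + h) N x"
proof -
  have "(\<Sum>n\<in>{a..<a+N}. \<Prod>i\<in>D. f i ((T i ^^ h) ((T i ^^ n) x))) = (\<Sum>n\<in>{a..<a+N}. \<Prod>i\<in>D. f i ((T i ^^ (n + h)) x))"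
    by (simp add: add.commute[of _ h] funpow_add)
  also have "\<dots> = (\<Sum>n\<in>{a+h..<a+h+N}. \<Prod>i\<in>D. f i ((T i ^^ n) x))"
    using sum.shift_bounds_nat_ivl[of "\<lambda>n. \<Prod>i\<in>D. f i ((T i ^^ n) x)" a h "a + N"] by (simp add: add_ac)
  finally show ?thesis by (simp add: mavg_def)
qed

text \<open>Applying the product map moves the start of the window from 0 to 1, which leaves the
  limit unchanged. Rectangles are countably many and determine a measure.\<close>

lemma AE_invariant: "AE x in M. distr (\<mu>F x) PX pmap = \<mu>F x"
proof -
  have "AE x in M. \<forall>P\<in>{P. finite P \<and> fst ` P \<subseteq> D}.
      measure (\<mu>F x) (pmap -` rect P \<inter> space PX) = measure (\<mu>F x) (rect P)"
  proof (subst AE_ball_countable)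
    show "countable {P :: (nat \<times> (nat \<times> nat)) set. finite P \<and> fst ` P \<subseteq> D}"
      by (rule countable_subset[OF _ countable_Collect_finite]) auto
    show "\<forall>P\<in>{P. finite P \<and> fst ` P \<subseteq> D}. AE x in M.
        measure (\<mu>F x) (pmap -` rect P \<inter> space PX) = measure (\<mu>F x) (rect P)"
    proof
      fix P :: "(nat \<times> (nat \<times> nat)) set" assume "P \<in> {P. finite P \<and> fst ` P \<subseteq> D}"
      then have P: "finite P" "fst ` P \<subseteq> D" by auto
      have "AE x in M. mean_limit (\<lambda>i x. cyl_fun P i ((T i ^^ 1) x)) x = mean_limit (\<lambda>i x. cyl_fun P i ((T i ^^ 0) x)) x"
        by (rule mean_limit_shift[OF bounded_tuple_cyl[OF P(1)] bounded_tuple_cyl[OF P(1)], where a = 1])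
           (simp only: mavg_shift add_0 add_0_right)
      then show "AE x in M. measure (\<mu>F x) (pmap -` rect P \<inter> space PX) = measure (\<mu>F x) (rect P)"
        using AE_space
      proof eventually_elim
        case (elim x)
        have "rect P \<inter> space PX = rect P" by (auto simp: rect_def)
        then show ?case
          using elim mean_limit_cyl[OF elim(2) P, of 0] mean_limit_cyl[OF elim(2) P, of 1] by simp
      qed
    qed
  qed
  then show ?thesis
    using AE_space
  proof eventually_elim
    case (elim x)
    interpret X: prob_space "\<mu>F x" by (rule prob_space_\<mu>F[OF elim(2)])
    have pm: "pmap \<in> measurable (\<mu>F x) PX"
      using measurable_pmap by (simp cong: measurable_cong_sets add: sets_\<mu>F[OF elim(2)])
    interpret Y: prob_space "distr (\<mu>F x) PX pmap" by (rule X.prob_space_distr[OF pm])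
    show ?case
    proof (rule PX_measure_eqI)
      show "emeasure (distr (\<mu>F x) PX pmap) (rect P) = emeasure (\<mu>F x) (rect P)" if "finite P" for P
      proof (cases "fst ` P \<subseteq> D")
        case True
        then show ?thesis
          using elim(1) that unfolding emeasure_distr[OF pm rect_sets[OF that]]
          by (simp add: space_\<mu>F[OF elim(2)] X.emeasure_eq_measure)
      qed (simp add: rect_empty)
    qed (use sets_\<mu>F[OF elim(2)] in simp_all)
  qed
qed

section \<open>Averages along the product map, and ergodicity\<close>

lemma integral_square_deviation:
  fixes g :: "(nat \<Rightarrow> 'a) \<Rightarrow> real"
  assumes x: "x \<in> space M" and g: "g \<in> borel_measurable PX" "\<And>\<xi>. \<bar>g \<xi>\<bar> \<le> 1"
  shows "(\<integral>\<xi>. (g \<xi> - c)\<^sup>2 \<partial>\<mu>F x) = (\<integral>\<xi>. (g \<xi>)\<^sup>2 \<partial>\<mu>F x) - 2 * c * (\<integral>\<xi>. g \<xi> \<partial>\<mu>F x) + c\<^sup>2"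
proof -
  interpret X: prob_space "\<mu>F x" by (rule prob_space_\<mu>F[OF x])
  note [measurable] = g(1)
  have "integrable (\<mu>F x) g"
    by (rule integrable_\<mu>F[OF x g(1), where C = 1]) (use g(2) in simp)
  moreover have "integrable (\<mu>F x) (\<lambda>\<xi>. (g \<xi>)\<^sup>2)"
    by (rule integrable_\<mu>F[OF x, where C = 1]) (use g(2) in \<open>auto simp: abs_square_le_1\<close>)
  moreover have "(g \<xi> - c)\<^sup>2 = (g \<xi>)\<^sup>2 - 2 * c * g \<xi> + c\<^sup>2" for \<xi>
    by (simp add: power2_diff)
  ultimately show ?thesis by (simp add: X.prob_space)
qed

lemma measurable_square_deviation:
  fixes g :: "(nat \<Rightarrow> 'a) \<Rightarrow> real"
  assumes [measurable]: "g \<in> borel_measurable PX" "L \<in> borel_measurable M" and "\<And>\<xi>. \<bar>g \<xi>\<bar> \<le> 1"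
  shows "(\<lambda>x. \<integral>\<xi>. (g \<xi> - L x)\<^sup>2 \<partial>\<mu>F x) \<in> borel_measurable M"
proof -
  have [measurable]: "(\<lambda>x. \<integral>\<xi>. (g \<xi>)\<^sup>2 \<partial>\<mu>F x) \<in> borel_measurable M" "(\<lambda>x. \<integral>\<xi>. g \<xi> \<partial>\<mu>F x) \<in> borel_measurable M"
    by (rule measurable_compose[OF measurable_\<mu>F_subprob integral_measurable_subprob_algebra]; measurable)+
  have "(\<lambda>x. (\<integral>\<xi>. (g \<xi>)\<^sup>2 \<partial>\<mu>F x) - 2 * L x * (\<integral>\<xi>. g \<xi> \<partial>\<mu>F x) + (L x)\<^sup>2) \<in> borel_measurable M"
    by measurable
  then show ?thesis
    by (rule measurable_cong[THEN iffD2, rotated])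
       (rule integral_square_deviation[OF _ assms(1,3)])
qed

definition orbit_avg :: "(nat \<times> (nat \<times> nat)) set \<Rightarrow> nat \<Rightarrow> (nat \<Rightarrow> 'a) \<Rightarrow> real" where
  "orbit_avg P H \<xi> = (\<Sum>h<H. \<Prod>i\<in>D. cyl_fun P i ((T i ^^ h) (\<xi> i))) / real H"

lemma orbit_avg_measurable [measurable]:
  assumes "finite P"
  shows "orbit_avg P H \<in> borel_measurable PX"
proof -
  have [measurable]: "(\<lambda>\<xi>. \<Prod>i\<in>D. cyl_fun P i ((T i ^^ h) (\<xi> i))) \<in> borel_measurable PX" for h
    by (rule measurable_prod_tuple[OF bounded_tuple_cyl[OF assms]])
  show ?thesis unfolding orbit_avg_def[abs_def] by measurable
qed

lemma orbit_avg_le: "\<bar>orbit_avg P H \<xi>\<bar> \<le> 1"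
proof -
  have "\<bar>\<Prod>i\<in>D. cyl_fun P i ((T i ^^ h) (\<xi> i))\<bar> \<le> 1" for h
    by (rule abs_prod_le_1) (simp add: cyl_fun_def)
  then show ?thesis
    unfolding orbit_avg_def
    using abs_average_le[of "\<lambda>h. \<Prod>i\<in>D. cyl_fun P i ((T i ^^ h) (\<xi> i))" 1 0 H]
    by (simp add: atLeast0LessThan)
qed

text \<open>
  By the uniformity in the start of the window, the averages of an indicator along the orbits of
  \<open>pmap\<close> are asymptotically as large in \<open>L\<^sup>2\<close> as their mean, hence close to constant.
\<close>

lemma orbit_average_variance:
  assumes P: "finite P" "fst ` P \<subseteq> D" and "\<epsilon> > 0"
  shows "\<exists>H0. \<forall>H\<ge>H0. (\<integral>x. \<integral>\<xi>. (orbit_avg P H \<xi> - mean_limit (cyl_fun P) x)\<^sup>2 \<partial>\<mu>F x \<partial>M) \<le> \<epsilon>"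
proof -
  define W where "W = orbit_avg P"
  define L where "L = mean_limit (cyl_fun P)"
  define f where "f = cyl_fun P"
  define u where "u n x = (\<Prod>i\<in>D. f i ((T i ^^ n) x))" for n x
  define v where "v h \<xi> = (\<Prod>i\<in>D. f i ((T i ^^ h) (\<xi> i)))" for h \<xi>
  \<comment> \<open>The product over the slots at time \<open>n\<close> is the product of the values
    of \<open>u\<close> at times \<open>n + h\<close> and \<open>n + h'\<close>. These tuples
    express the square of an orbit average through multiple averages.\<close>
  define ff where "ff h h' i x = f i ((T i ^^ h) x) * f i ((T i ^^ h') x)" for h h' i x
  have f_le: "\<bar>f i x\<bar> \<le> 1" for i x by (simp add: f_def cyl_fun_def)
  have tuple: "bounded_tuple (\<lambda>i x. f i ((T i ^^ h) x))" for h
    unfolding f_def by (rule bounded_tuple_cyl[OF P(1)])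
  have tuple0: "bounded_tuple f" using tuple[of 0] by simp
  have f_meas: "(\<lambda>x. f i ((T i ^^ h) x)) \<in> borel_measurable M" for i h
    unfolding f_def by (rule measurable_compose[OF measurable_pow_T cyl_fun_measurable[OF P(1)]])
  have tuple2: "bounded_tuple (ff h h')" for h h'
    unfolding bounded_tuple_def
  proof (intro ballI conjI exI allI)
    show "ff h h' i \<in> borel_measurable M" for i
      unfolding ff_def[abs_def] by (intro borel_measurable_times f_meas)
    show "norm (ff h h' i x) \<le> 1" for i x
      using f_le by (simp add: ff_def abs_mult mult_le_one)
  qed
  have v_le: "\<bar>v h \<xi>\<bar> \<le> 1" for h \<xi>
    unfolding v_def by (rule abs_prod_le_1) (rule f_le)
  have W_eq: "W H \<xi> = (\<Sum>h<H. v h \<xi>) / real H" for H \<xi>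
    by (simp add: W_def orbit_avg_def v_def f_def)
  have L_eq: "L x = mean_limit f x" for x by (simp add: L_def f_def)
  have W_le: "\<bar>W H \<xi>\<bar> \<le> 1" for H \<xi>
    unfolding W_def by (rule orbit_avg_le)
  have L_le: "\<bar>L x\<bar> \<le> 1" if "x \<in> space M" for x
    using norm_mean_limit_le[OF that tuple0, of 1] abs_prod_le_1[of D, OF f_le] by (simp add: L_eq)
  have L_int: "integrable M L" and L_meas [measurable]: "L \<in> borel_measurable M"
    using integrable_tuple[OF tuple0] by (auto simp: L_eq[abs_def])
  have L2_int: "integrable M (\<lambda>x. (L x)\<^sup>2)"
    by (rule integrable_const_bound[where B = 1]) (use L_le in \<open>auto simp: abs_square_le_1\<close>)
  have v_meas [measurable]: "v h \<in> borel_measurable PX" for h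
    unfolding v_def by (rule measurable_prod_tuple[OF tuple])
  have W_meas [measurable]: "W H \<in> borel_measurable PX" for H
    unfolding W_def by (rule orbit_avg_measurable[OF P(1)])
  have v_int: "(\<integral>\<xi>. v h \<xi> \<partial>\<mu>F x) = mean_limit (\<lambda>i x. f i ((T i ^^ h) x)) x" for h x
    by (simp add: v_def mean_limit_def)
  have vv_int: "(\<integral>\<xi>. v h \<xi> * v h' \<xi> \<partial>\<mu>F x) = mean_limit (ff h h') x" for h h' x
    by (simp add: v_def mean_limit_def ff_def prod.distrib)
  have "AE x in M. \<forall>h. (\<integral>\<xi>. v h \<xi> \<partial>\<mu>F x) = L x"
    unfolding AE_all_countable v_int L_eq
    by (intro allI mean_limit_shift[OF tuple0 tuple]) (simp only: mavg_shift)
  \<comment> \<open>The orbit averages have mean \<open>L x\<close> under \<open>\<mu>F x\<close>,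
    so the squared deviation is a variance. An empty average would have mean 0, hence the condition
    on \<open>H\<close>.\<close>
  then have mean: "AE x in M. \<forall>H>0. (\<integral>\<xi>. (W H \<xi> - L x)\<^sup>2 \<partial>\<mu>F x) = (\<integral>\<xi>. (W H \<xi>)\<^sup>2 \<partial>\<mu>F x) - (L x)\<^sup>2"
    using AE_space
  proof eventually_elim
    case (elim x)
    interpret X: prob_space "\<mu>F x" by (rule prob_space_\<mu>F[OF elim(2)])
    have int_v: "integrable (\<mu>F x) (v h)" for h
      by (rule integrable_\<mu>F[OF elim(2) v_meas]) (use v_le in simp)
    note integral_square_deviation[OF elim(2) W_meas W_le, of _ "L x"]
    moreover have "(\<integral>\<xi>. W H \<xi> \<partial>\<mu>F x) = L x" if "H > 0" for H
      unfolding W_eq using elim(1) int_v that by simp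
    ultimately show ?case by (simp add: power2_eq_square)
  qed
  have upper: "(\<integral>x. \<integral>\<xi>. (W H \<xi>)\<^sup>2 \<partial>\<mu>F x \<partial>M) \<le> (\<integral>x. (L x)\<^sup>2 \<partial>M) + \<epsilon>"
    if H: "\<And>a. (\<integral>x. norm (mavg D f a H x - mean_limit f x) \<partial>M) \<le> \<epsilon> / 2" for H
  proof -
    have "(\<integral>\<xi>. (W H \<xi>)\<^sup>2 \<partial>\<mu>F x) = (\<Sum>h<H. \<Sum>h'<H. mean_limit (ff h h') x) / (real H)\<^sup>2" if x: "x \<in> space M" for x
    proof -
      have "integrable (\<mu>F x) (\<lambda>\<xi>. v h \<xi> * v h' \<xi>)" for h h'
        by (rule integrable_\<mu>F[OF x, where C = 1]) (use v_le in \<open>auto simp: abs_mult mult_le_one\<close>)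
      moreover have "(W H \<xi>)\<^sup>2 = (\<Sum>h<H. \<Sum>h'<H. v h \<xi> * v h' \<xi>) / (real H)\<^sup>2" for \<xi>
        by (simp add: W_eq power2_eq_square sum_product)
      ultimately show ?thesis by (simp add: vv_int)
    qed
    then have "(\<integral>x. \<integral>\<xi>. (W H \<xi>)\<^sup>2 \<partial>\<mu>F x \<partial>M) = (\<integral>x. (\<Sum>h<H. \<Sum>h'<H. mean_limit (ff h h') x) / (real H)\<^sup>2 \<partial>M)"
      by (intro Bochner_Integration.integral_cong) auto
    also have "\<dots> = (\<Sum>h<H. \<Sum>h'<H. \<integral>x. mean_limit (ff h h') x \<partial>M) / (real H)\<^sup>2"
      using integrable_tuple(2)[OF tuple2] by simp
    finally have lhs: "(\<integral>x. \<integral>\<xi>. (W H \<xi>)\<^sup>2 \<partial>\<mu>F x \<partial>M) = \<dots>" .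
    have "(\<lambda>N. \<integral>x. mavg D (ff h h') 0 N x \<partial>M) \<longlonglongrightarrow> (\<integral>x. mean_limit (ff h h') x \<partial>M)" for h h'
      by (rule window_conv_integral[OF window_convergence_real[OF tuple2] integrable_tuple[OF tuple2]])
    then have "(\<lambda>N. (\<Sum>h<H. \<Sum>h'<H. \<integral>x. mavg D (ff h h') 0 N x \<partial>M) / (real H)\<^sup>2) \<longlonglongrightarrow> (\<integral>x. \<integral>\<xi>. (W H \<xi>)\<^sup>2 \<partial>\<mu>F x \<partial>M)"
      unfolding lhs divide_inverse by (intro tendsto_intros)
    moreover have "(\<Sum>h<H. \<Sum>h'<H. \<integral>x. mavg D (ff h h') 0 N x \<partial>M) / (real H)\<^sup>2 \<le> (\<integral>x. (L x)\<^sup>2 \<partial>M) + \<epsilon>" if "N \<ge> 1" for N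
    proof -
      have m_le: "\<bar>mavg D f a H x\<bar> \<le> 1" for a x
      proof -
        have "norm (mavg D f a H x) \<le> 1"
          by (rule norm_mavg_le) (simp add: abs_prod_le_1 f_le del: abs_prod)
        then show ?thesis by simp
      qed
      have m_meas [measurable]: "mavg D f a H \<in> borel_measurable M" for a
        using integrable_tuple(1)[OF tuple0] by auto
      have m2_int: "integrable M (\<lambda>x. (mavg D f a H x)\<^sup>2)" for a
        by (rule integrable_bounded[where C = 1]) (use m_le in \<open>auto simp: abs_square_le_1\<close>)
      have square: "(\<integral>x. (mavg D f a H x)\<^sup>2 \<partial>M) \<le> (\<integral>x. (L x)\<^sup>2 \<partial>M) + \<epsilon>" for a
      proof -
        have int: "integrable M (\<lambda>x. \<bar>mavg D f a H x - L x\<bar>)"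
          using integrable_tuple(1)[OF tuple0] L_int by auto
        \<comment> \<open>Both functions are bounded by 1, so their squares differ by at most twice
          their distance; this is where the half in the bound for \<open>H\<close> is spent.\<close>
        have "(\<integral>x. (mavg D f a H x)\<^sup>2 \<partial>M) \<le> (\<integral>x. (L x)\<^sup>2 + 2 * \<bar>mavg D f a H x - L x\<bar> \<partial>M)"
        proof (intro integral_mono m2_int Bochner_Integration.integrable_add L2_int integrable_mult_right int)
          fix x assume x: "x \<in> space M"
          have "(mavg D f a H x)\<^sup>2 - (L x)\<^sup>2 = (mavg D f a H x + L x) * (mavg D f a H x - L x)"
            by (simp add: power2_eq_square algebra_simps)
          also have "\<dots> \<le> \<bar>mavg D f a H x + L x\<bar> * \<bar>mavg D f a H x - L x\<bar>"
            by (simp flip: abs_mult)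
          also have "\<dots> \<le> 2 * \<bar>mavg D f a H x - L x\<bar>"
            using m_le[of a x] L_le[OF x] by (intro mult_right_mono) auto
          finally show "(mavg D f a H x)\<^sup>2 \<le> (L x)\<^sup>2 + 2 * \<bar>mavg D f a H x - L x\<bar>" by simp
        qed
        also have "\<dots> = (\<integral>x. (L x)\<^sup>2 \<partial>M) + 2 * (\<integral>x. \<bar>mavg D f a H x - L x\<bar> \<partial>M)"
          using L2_int int by simp
        finally show ?thesis using H[of a] by (simp add: L_eq)
      qed
      have m_eq: "mavg D f n H x = (\<Sum>h<H. u (n + h) x) / real H" for n x
        using sum.shift_bounds_nat_ivl[of "\<lambda>h. u h x" 0 n H]
        by (simp add: mavg_def u_def[symmetric] add.commute atLeast0LessThan)
      have ff_eq: "mavg D (ff h h') 0 N x = (\<Sum>n<N. u (n + h) x * u (n + h') x) / real N" for h h' x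
        by (simp add: mavg_def ff_def u_def prod.distrib funpow_add add.commute[of _ h] add.commute[of _ h'] atLeast0LessThan)
      \<comment> \<open>Exchanging the sums trades one window of length \<open>N\<close> from 0, for
        each pair of shifts, for windows of length \<open>H\<close> starting at every
        \<open>n\<close> below \<open>N\<close>.\<close>
      have "(\<Sum>h<H. \<Sum>h'<H. mavg D (ff h h') 0 N x) / (real H)\<^sup>2 = (\<Sum>n<N. (mavg D f n H x)\<^sup>2) / real N" for x
      proof -
        have "(\<Sum>h<H. \<Sum>h'<H. mavg D (ff h h') 0 N x) = (\<Sum>n<N. \<Sum>h<H. \<Sum>h'<H. u (n + h) x * u (n + h') x) / real N"
          unfolding ff_eq sum_divide_distrib[symmetric] by (simp add: sum.swap[of _ _ "{..<N}"])
        then show ?thesis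
          by (simp add: m_eq power_divide power2_eq_square sum_product sum_divide_distrib
              mult.commute[of "real N"])
      qed
      then have "(\<integral>x. (\<Sum>h<H. \<Sum>h'<H. mavg D (ff h h') 0 N x) / (real H)\<^sup>2 \<partial>M) = (\<Sum>n<N. \<integral>x. (mavg D f n H x)\<^sup>2 \<partial>M) / real N"
        using m2_int by simp
      moreover have "(\<integral>x. (\<Sum>h<H. \<Sum>h'<H. mavg D (ff h h') 0 N x) / (real H)\<^sup>2 \<partial>M) =
          (\<Sum>h<H. \<Sum>h'<H. \<integral>x. mavg D (ff h h') 0 N x \<partial>M) / (real H)\<^sup>2"
        using integrable_tuple(1)[OF tuple2] by simp
      moreover have "(\<Sum>n<N. \<integral>x. (mavg D f n H x)\<^sup>2 \<partial>M) / real N \<le> (\<integral>x. (L x)\<^sup>2 \<partial>M) + \<epsilon>"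
      proof -
        have "(\<Sum>n<N. \<integral>x. (mavg D f n H x)\<^sup>2 \<partial>M) \<le> (\<Sum>n<N. (\<integral>x. (L x)\<^sup>2 \<partial>M) + \<epsilon>)"
          by (intro sum_mono square)
        then show ?thesis using that by (simp add: divide_le_eq mult.commute)
      qed
      ultimately show ?thesis by simp
    qed
    ultimately show ?thesis by (blast intro: LIMSEQ_le_const2)
  qed
  have "\<epsilon> / 2 > 0" using \<open>\<epsilon> > 0\<close> by simp
  then obtain H0 where
    H0: "\<And>H a. H \<ge> H0 \<Longrightarrow> (\<integral>x. norm (mavg D f a H x - mean_limit f x) \<partial>M) \<le> \<epsilon> / 2"
    using window_convE[OF window_convergence_real[OF tuple0]] by blast
  show ?thesis
    unfolding W_def[symmetric] L_def[symmetric]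
  \<comment> \<open>The successor keeps \<open>H\<close> positive, as \<open>mean\<close>
    demands.\<close>
  proof (intro exI[of _ "Suc H0"] allI impI)
    fix H assume H: "H \<ge> Suc H0"
    have W2_meas: "(\<lambda>x. \<integral>\<xi>. (W H \<xi>)\<^sup>2 \<partial>\<mu>F x) \<in> borel_measurable M"
      by (rule measurable_compose[OF measurable_\<mu>F_subprob integral_measurable_subprob_algebra]) measurable
    have W2_int: "integrable M (\<lambda>x. \<integral>\<xi>. (W H \<xi>)\<^sup>2 \<partial>\<mu>F x)"
    proof (rule integrable_const_bound[where B = 1, OF _ W2_meas], intro AE_I2)
      fix x assume x: "x \<in> space M"
      interpret X: prob_space "\<mu>F x" by (rule prob_space_\<mu>F[OF x])
      have "(\<integral>\<xi>. (W H \<xi>)\<^sup>2 \<partial>\<mu>F x) \<le> (\<integral>\<xi>. 1 \<partial>\<mu>F x)"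
        by (intro integral_mono integrable_\<mu>F[OF x, where C = 1]) (use W_le in \<open>auto simp: abs_square_le_1\<close>)
      then show "norm (\<integral>\<xi>. (W H \<xi>)\<^sup>2 \<partial>\<mu>F x) \<le> 1" by (simp add: X.prob_space)
    qed
    have "(\<integral>x. \<integral>\<xi>. (W H \<xi> - L x)\<^sup>2 \<partial>\<mu>F x \<partial>M) = (\<integral>x. (\<integral>\<xi>. (W H \<xi>)\<^sup>2 \<partial>\<mu>F x) - (L x)\<^sup>2 \<partial>M)"
    proof (rule integral_cong_AE)
      show "(\<lambda>x. \<integral>\<xi>. (W H \<xi> - L x)\<^sup>2 \<partial>\<mu>F x) \<in> borel_measurable M"
        by (rule measurable_square_deviation[OF W_meas L_meas W_le])
      show "AE x in M. (\<integral>\<xi>. (W H \<xi> - L x)\<^sup>2 \<partial>\<mu>F x) = (\<integral>\<xi>. (W H \<xi>)\<^sup>2 \<partial>\<mu>F x) - (L x)\<^sup>2"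
        using mean by eventually_elim (use H in simp)
    qed (use W2_meas in measurable)
    also have "\<dots> = (\<integral>x. \<integral>\<xi>. (W H \<xi>)\<^sup>2 \<partial>\<mu>F x \<partial>M) - (\<integral>x. (L x)\<^sup>2 \<partial>M)"
      by (rule Bochner_Integration.integral_diff[OF W2_int L2_int])
    also have "\<dots> \<le> \<epsilon>"
      using upper[of H] H0[of H] H by simp
    finally show "(\<integral>x. \<integral>\<xi>. (W H \<xi> - L x)\<^sup>2 \<partial>\<mu>F x \<partial>M) \<le> \<epsilon>" .
  qed
qed

text \<open>Smallness in the mean over \<open>x\<close> passes to almost every \<open>x\<close>
  along a subsequence of lengths. For independence it is enough to have, for each
  \<open>\<delta>\<close>, a single good length.\<close>

lemma AE_orbit_averages:
  "AE x in M. \<forall>P\<in>{P. finite P \<and> fst ` P \<subseteq> D}. \<forall>\<delta>>0. \<exists>H>0.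
     (\<integral>\<xi>. (orbit_avg P H \<xi> - measure (\<mu>F x) (rect P))\<^sup>2 \<partial>\<mu>F x) < \<delta>"
proof (subst AE_ball_countable)
  show "countable {P :: (nat \<times> (nat \<times> nat)) set. finite P \<and> fst ` P \<subseteq> D}"
    by (rule countable_subset[OF _ countable_Collect_finite]) auto
  show "\<forall>P\<in>{P. finite P \<and> fst ` P \<subseteq> D}. AE x in M. \<forall>\<delta>>0. \<exists>H>0.
     (\<integral>\<xi>. (orbit_avg P H \<xi> - measure (\<mu>F x) (rect P))\<^sup>2 \<partial>\<mu>F x) < \<delta>"
  proof
    fix P :: "(nat \<times> (nat \<times> nat)) set" assume "P \<in> {P. finite P \<and> fst ` P \<subseteq> D}"
    then have P: "finite P" "fst ` P \<subseteq> D" by auto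
    note [measurable] = orbit_avg_measurable[OF P(1)]
    let ?L = "mean_limit (cyl_fun P)"
    define v where "v H x = (\<integral>\<xi>. (orbit_avg P H \<xi> - ?L x)\<^sup>2 \<partial>\<mu>F x)" for H x
    have tuple: "bounded_tuple (cyl_fun P)" using bounded_tuple_cyl[OF P(1), of 0] by simp
    have [measurable]: "?L \<in> borel_measurable M" by (rule measurable_mean_limit[OF tuple])
    have L: "?L x = measure (\<mu>F x) (rect P)" if "x \<in> space M" for x
    proof -
      have "rect P \<inter> space PX = rect P" by (auto simp: rect_def)
      then show ?thesis using mean_limit_cyl[OF that P, of 0] by simp
    qed
    have L_le: "\<bar>?L x\<bar> \<le> 1" if "x \<in> space M" for x
      using prob_space.prob_le_1[OF prob_space_\<mu>F[OF that]] by (simp add: L[OF that])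
    have v_nonneg: "0 \<le> v H x" for H x by (simp add: v_def)
    have v_meas: "v H \<in> borel_measurable M" for H
      unfolding v_def[abs_def]
      by (rule measurable_square_deviation[OF _ _ orbit_avg_le]) measurable
    have v_int: "integrable M (v H)" for H
    proof (rule integrable_const_bound[where B = 4, OF _ v_meas], intro AE_I2)
      fix x assume x: "x \<in> space M"
      interpret X: prob_space "\<mu>F x" by (rule prob_space_\<mu>F[OF x])
      have le: "(orbit_avg P H \<xi> - ?L x)\<^sup>2 \<le> 4" for \<xi>
      proof -
        have "\<bar>orbit_avg P H \<xi> - ?L x\<bar> \<le> 2"
          using orbit_avg_le[of P H \<xi>] L_le[OF x] by linarith
        then have "(orbit_avg P H \<xi> - ?L x)\<^sup>2 \<le> 2\<^sup>2"
          using abs_le_square_iff[of _ "2 :: real"] by fastforce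
        then show ?thesis by simp
      qed
      have "v H x \<le> (\<integral>\<xi>. 4 \<partial>\<mu>F x)"
        unfolding v_def by (intro integral_mono integrable_\<mu>F[OF x, where C = 4]) (use le in auto)
      then show "norm (v H x) \<le> 4" using v_nonneg by (simp add: X.prob_space)
    qed
    have "(\<lambda>H. \<integral>x. norm (v H x) \<partial>M) \<longlonglongrightarrow> 0"
    proof (rule LIMSEQ_I)
      fix r :: real assume "r > 0"
      then have "r / 2 > 0" by simp
      from orbit_average_variance[OF P this] obtain H0 where
        H0: "\<And>H. H \<ge> H0 \<Longrightarrow> (\<integral>x. v H x \<partial>M) \<le> r / 2"
        unfolding v_def by blast
      have "norm ((\<integral>x. norm (v H x) \<partial>M) - 0) < r" if "H \<ge> H0" for H
        using H0[OF that] \<open>r > 0\<close> v_nonneg by (simp add: integral_nonneg_AE)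
      then show "\<exists>H0. \<forall>H\<ge>H0. norm ((\<integral>x. norm (v H x) \<partial>M) - 0) < r" by blast
    qed
    from tendsto_L1_AE_subseq[OF v_int this]
    obtain r where r: "strict_mono r" "AE x in M. (\<lambda>k. v (r k) x) \<longlonglongrightarrow> 0" by blast
    show "AE x in M. \<forall>\<delta>>0. \<exists>H>0. (\<integral>\<xi>. (orbit_avg P H \<xi> - measure (\<mu>F x) (rect P))\<^sup>2 \<partial>\<mu>F x) < \<delta>"
      using r(2) AE_space
    proof eventually_elim
      case (elim x)
      show ?case
      proof (intro allI impI)
        fix \<delta> :: real assume "\<delta> > 0"
        from order_tendstoD(2)[OF elim(1) this] eventually_gt_at_top[of 0]
        have "eventually (\<lambda>k. v (r k) x < \<delta> \<and> 0 < k) sequentially" by (rule eventually_conj)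
        then obtain k where "v (r k) x < \<delta>" "0 < k"
          by (auto dest: eventually_happens)
        moreover have "0 < r k" using seq_suble[OF r(1), of k] \<open>0 < k\<close> by linarith
        ultimately show "\<exists>H>0. (\<integral>\<xi>. (orbit_avg P H \<xi> - measure (\<mu>F x) (rect P))\<^sup>2 \<partial>\<mu>F x) < \<delta>"
          by (auto simp: v_def L[OF elim(2)])
      qed
    qed
  qed
qed

text \<open>For an invariant \<open>A\<close> the integral over \<open>A\<close> of the rectangle's
  indicator composed with \<open>pmap ^^ h\<close> does not depend on \<open>h\<close>. The
  indicator may thus be replaced by its orbit averages, which are nearly constant in mean
  square.\<close>

lemma invariant_set_independent:
  assumes x: "x \<in> space M" and inv: "distr (\<mu>F x) PX pmap = \<mu>F x"
    and A: "A \<in> sets PX" "pmap -` A \<inter> space PX = A"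
    and P: "finite P" "fst ` P \<subseteq> D"
    and small: "\<And>\<delta>. \<delta> > 0 \<Longrightarrow> \<exists>H>0. (\<integral>\<xi>. (orbit_avg P H \<xi> - measure (\<mu>F x) (rect P))\<^sup>2 \<partial>\<mu>F x) < \<delta>"
  shows "measure (\<mu>F x) (A \<inter> rect P) = measure (\<mu>F x) A * measure (\<mu>F x) (rect P)"
proof -
  interpret X: prob_space "\<mu>F x" by (rule prob_space_\<mu>F[OF x])
  have meas_iff: "g \<in> borel_measurable (\<mu>F x) \<longleftrightarrow> g \<in> borel_measurable PX" for g :: "_ \<Rightarrow> real"
    by (simp cong: measurable_cong_sets add: sets_\<mu>F[OF x])
  note [measurable] = orbit_avg_measurable[OF P(1)] A(1)
  let ?m = "measure (\<mu>F x)" and ?f = "\<lambda>h \<xi>. \<Prod>i\<in>D. cyl_fun P i ((T i ^^ h) (\<xi> i))"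
  have f_le: "\<bar>?f h \<xi>\<bar> \<le> 1" for h \<xi>
    by (rule abs_prod_le_1) (simp add: cyl_fun_def)
  have f_meas [measurable]: "?f h \<in> borel_measurable PX" for h
    by (rule measurable_prod_tuple[OF bounded_tuple_cyl[OF P(1)]])
  have inv_pow: "distr (\<mu>F x) PX (pmap ^^ h) = \<mu>F x" for h
  proof (induction h)
    case 0
    have "distr (\<mu>F x) PX (\<lambda>\<xi>. \<xi>) = distr (\<mu>F x) (\<mu>F x) (\<lambda>\<xi>. \<xi>)"
      by (rule distr_cong) (simp_all add: sets_\<mu>F[OF x])
    then show ?case by (simp add: id_def distr_id[unfolded id_def])
  next
    case (Suc h)
    have "distr (\<mu>F x) PX (pmap ^^ Suc h) = distr (distr (\<mu>F x) PX (pmap ^^ h)) PX pmap"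
      using measurable_pow_pmap by (subst distr_distr) (simp_all cong: measurable_cong_sets add: sets_\<mu>F[OF x])
    also have "\<dots> = \<mu>F x" using Suc inv by simp
    finally show ?case .
  qed
  have A_pow: "(pmap ^^ h) \<xi> \<in> A \<longleftrightarrow> \<xi> \<in> A" if "\<xi> \<in> space PX" for h \<xi>
  proof (induction h)
    case (Suc h)
    have "(pmap ^^ h) \<xi> \<in> space PX" using measurable_space[OF measurable_pow_pmap that] .
    then show ?case using A(2) Suc by auto
  qed simp
  have pow_meas: "pmap ^^ h \<in> measurable (\<mu>F x) PX" for h
    using measurable_pow_pmap by (simp cong: measurable_cong_sets add: sets_\<mu>F[OF x])
  have if_meas: "(\<lambda>\<xi>. indicator A \<xi> * ?f h \<xi>) \<in> borel_measurable PX" for h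
    by (intro borel_measurable_times borel_measurable_indicator A(1) f_meas)
  have shift: "?m (A \<inter> rect P) = (\<integral>\<xi>. indicator A \<xi> * ?f h \<xi> \<partial>\<mu>F x)" for h
  proof -
    have "?m (A \<inter> rect P) = (\<integral>\<xi>. indicator (A \<inter> rect P) \<xi> \<partial>\<mu>F x)"
      using sets.sets_into_space[OF A(1)] by (simp add: space_\<mu>F[OF x] Int_absorb2 le_infI1)
    also have "\<dots> = (\<integral>\<xi>. indicator A \<xi> * ?f 0 \<xi> \<partial>\<mu>F x)"
    proof (rule Bochner_Integration.integral_cong[OF refl])
      fix \<xi> assume "\<xi> \<in> space (\<mu>F x)"
      then have \<xi>: "\<xi> \<in> space PX" by (simp add: space_\<mu>F[OF x])
      show "indicator (A \<inter> rect P) \<xi> = indicator A \<xi> * ?f 0 \<xi>"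
        using indicator_rect[OF P(2) \<xi>] by (simp add: indicator_inter_arith)
    qed
    also have "\<dots> = (\<integral>\<xi>. indicator A \<xi> * ?f 0 \<xi> \<partial>distr (\<mu>F x) PX (pmap ^^ h))"
      by (simp only: inv_pow)
    also have "\<dots> = (\<integral>\<xi>. indicator A ((pmap ^^ h) \<xi>) * ?f 0 ((pmap ^^ h) \<xi>) \<partial>\<mu>F x)"
      by (rule integral_distr[OF pow_meas if_meas])
    also have "\<dots> = (\<integral>\<xi>. indicator A \<xi> * ?f h \<xi> \<partial>\<mu>F x)"
    proof (rule Bochner_Integration.integral_cong[OF refl])
      fix \<xi> assume "\<xi> \<in> space (\<mu>F x)"
      then have \<xi>: "\<xi> \<in> space PX" by (simp add: space_\<mu>F[OF x])
      have "?f 0 ((pmap ^^ h) \<xi>) = ?f h \<xi>"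
        by (rule prod.cong) (simp_all add: pow_pmap)
      then show "indicator A ((pmap ^^ h) \<xi>) * ?f 0 ((pmap ^^ h) \<xi>) = indicator A \<xi> * ?f h \<xi>"
        using A_pow[OF \<xi>] by (simp add: indicator_def)
    qed
    finally show ?thesis .
  qed
  have int: "integrable (\<mu>F x) (\<lambda>\<xi>. indicator A \<xi> * ?f h \<xi>)" for h
    by (rule integrable_\<mu>F[OF x if_meas, where C = 1]) (use f_le in \<open>simp add: indicator_def\<close>)
  have avg: "?m (A \<inter> rect P) = (\<integral>\<xi>. indicator A \<xi> * orbit_avg P H \<xi> \<partial>\<mu>F x)" if "H > 0" for H
  proof -
    have eq: "indicator A \<xi> * orbit_avg P H \<xi> = (\<Sum>h<H. indicator A \<xi> * ?f h \<xi>) / real H" for \<xi>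
      by (simp add: orbit_avg_def flip: sum_distrib_left)
    have "(\<integral>\<xi>. indicator A \<xi> * orbit_avg P H \<xi> \<partial>\<mu>F x) = (\<Sum>h<H. \<integral>\<xi>. indicator A \<xi> * ?f h \<xi> \<partial>\<mu>F x) / real H"
      unfolding eq integral_divide_zero Bochner_Integration.integral_sum[OF int] ..
    then show ?thesis using that by (simp add: shift[symmetric])
  qed
  have "(?m (A \<inter> rect P) - ?m A * ?m (rect P))\<^sup>2 \<le> 0 + \<delta>" if \<delta>: "\<delta> > 0" for \<delta>
  proof -
    from small[OF \<delta>] obtain H where H: "H > 0" "(\<integral>\<xi>. (orbit_avg P H \<xi> - ?m (rect P))\<^sup>2 \<partial>\<mu>F x) < \<delta>"
      by blast
    let ?g = "\<lambda>\<xi>. orbit_avg P H \<xi> - ?m (rect P)" and ?gA = "\<lambda>\<xi>. indicator A \<xi> * (orbit_avg P H \<xi> - ?m (rect P))"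
    have g_le: "\<bar>?g \<xi>\<bar> \<le> 2" for \<xi>
      using orbit_avg_le[of P H \<xi>] X.prob_le_1[of "rect P"] measure_nonneg[of "\<mu>F x" "rect P"] by linarith
    have gA_le: "norm (?gA \<xi>) \<le> 2" for \<xi>
      using g_le[of \<xi>] by (simp add: indicator_def)
    have sq: "norm (c\<^sup>2) \<le> 4" if "\<bar>c\<bar> \<le> 2" for c :: real
      using that abs_le_square_iff[of c 2] by simp
    have W_meas: "orbit_avg P H \<in> borel_measurable PX"
      by (rule orbit_avg_measurable[OF P(1)])
    have A_meas: "(indicator A :: _ \<Rightarrow> real) \<in> borel_measurable PX"
      by (rule borel_measurable_indicator[OF A(1)])
    have g_meas: "?g \<in> borel_measurable PX"
      by (rule borel_measurable_diff[OF W_meas borel_measurable_const])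
    have gA_meas: "?gA \<in> borel_measurable PX"
      by (rule borel_measurable_times[OF A_meas g_meas])
    have int_A: "integrable (\<mu>F x) (indicator A :: _ \<Rightarrow> real)"
      by (rule integrable_\<mu>F[OF x A_meas, where C = 1]) (simp add: indicator_def)
    have int_AW: "integrable (\<mu>F x) (\<lambda>\<xi>. indicator A \<xi> * orbit_avg P H \<xi>)"
      by (rule integrable_\<mu>F[OF x borel_measurable_times[OF A_meas W_meas], where C = 1])
         (use orbit_avg_le in \<open>simp add: indicator_def\<close>)
    have int_gA: "integrable (\<mu>F x) ?gA"
      by (rule integrable_\<mu>F[OF x gA_meas gA_le])
    have int_gA2: "integrable (\<mu>F x) (\<lambda>\<xi>. (?gA \<xi>)\<^sup>2)"
      by (rule integrable_\<mu>F[OF x borel_measurable_power[OF gA_meas] sq]) (use gA_le in simp)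
    have int_g2: "integrable (\<mu>F x) (\<lambda>\<xi>. (?g \<xi>)\<^sup>2)"
      by (rule integrable_\<mu>F[OF x borel_measurable_power[OF g_meas] sq[OF g_le]])
    have mA: "?m A = (\<integral>\<xi>. indicator A \<xi> \<partial>\<mu>F x)"
      using sets.sets_into_space[OF A(1)] by (simp add: space_\<mu>F[OF x] Int_absorb2)
    have "?m (A \<inter> rect P) - ?m A * ?m (rect P) = (\<integral>\<xi>. indicator A \<xi> * orbit_avg P H \<xi> - indicator A \<xi> * ?m (rect P) \<partial>\<mu>F x)"
      unfolding avg[OF H(1)] mA using int_A int_AW by simp
    also have "\<dots> = (\<integral>\<xi>. ?gA \<xi> \<partial>\<mu>F x)"
      by (simp add: right_diff_distrib)
    \<comment> \<open>Nonnegativity of the variance: the square of a mean is at most the mean of the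
      square.\<close>
    finally have "(?m (A \<inter> rect P) - ?m A * ?m (rect P))\<^sup>2 \<le> (\<integral>\<xi>. (?gA \<xi>)\<^sup>2 \<partial>\<mu>F x)"
      using X.variance_eq[OF int_gA int_gA2] X.variance_positive[of ?gA] by simp
    also have "\<dots> \<le> (\<integral>\<xi>. (?g \<xi>)\<^sup>2 \<partial>\<mu>F x)"
      by (rule integral_mono[OF int_gA2 int_g2]) (simp add: indicator_def)
    finally show ?thesis using H(2) by simp
  qed
  from field_le_epsilon[OF this] show ?thesis by simp
qed

text \<open>An invariant set is independent of all rectangles, hence of all measurable sets, hence
  of itself. The exceptional null set concerns rectangles only, so it is fixed before the invariant
  set is chosen.\<close>

theorem AE_ergodic: "AE x in M. measure_preserving (\<mu>F x) pmap \<and> ergodic_under (\<mu>F x) {pmap}"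
  using AE_invariant AE_orbit_averages AE_space
proof eventually_elim
  case (elim x)
  note x = elim(3)
  interpret X: prob_space "\<mu>F x" by (rule prob_space_\<mu>F[OF x])
  have "distr (\<mu>F x) (\<mu>F x) pmap = distr (\<mu>F x) PX pmap"
    by (rule distr_cong) (simp_all add: sets_\<mu>F[OF x])
  then have "measure_preserving (\<mu>F x) pmap"
    unfolding measure_preserving_def
    using elim(1) measurable_pmap by (simp cong: measurable_cong_sets add: sets_\<mu>F[OF x])
  moreover have "ergodic_under (\<mu>F x) {pmap}"
    unfolding ergodic_under_def
  proof (intro ballI impI)
    fix A assume "A \<in> sets (\<mu>F x)" "\<forall>S\<in>{pmap}. S -` A \<inter> space (\<mu>F x) = A"
    then have A: "A \<in> sets PX" "pmap -` A \<inter> space PX = A"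
      by (simp_all add: sets_\<mu>F[OF x] space_\<mu>F[OF x])
    have A': "A \<in> sets (\<mu>F x)" by fact
    have indep: "measure (\<mu>F x) (A \<inter> rect P) = measure (\<mu>F x) A * measure (\<mu>F x) (rect P)" if "finite P" for P
    proof (cases "fst ` P \<subseteq> D")
      case True
      then show ?thesis
        using elim(2) that by (intro invariant_set_independent[OF x elim(1) A that True]) blast
    qed (simp add: rect_empty)
    let ?c = "emeasure (\<mu>F x) A"
    \<comment> \<open>Independence is phrased as an equality of measures, so that it extends from
      rectangles to every set and can be evaluated at \<open>A\<close>.\<close>
    have "density (\<mu>F x) (indicator A) = scale_measure ?c (\<mu>F x)"
    proof (rule PX_measure_eqI)
      show "emeasure (density (\<mu>F x) (indicator A)) (space PX) \<noteq> \<infinity>"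
        using sets.top[of "\<mu>F x"] A' by (subst emeasure_restricted) (simp_all add: space_\<mu>F[OF x])
      fix P :: "(nat \<times> (nat \<times> nat)) set" assume P: "finite P"
      have R: "rect P \<in> sets (\<mu>F x)" using rect_sets[OF P] by (simp add: sets_\<mu>F[OF x])
      show "emeasure (density (\<mu>F x) (indicator A)) (rect P) = emeasure (scale_measure ?c (\<mu>F x)) (rect P)"
        using indep[OF P] A' R by (simp add: emeasure_restricted X.emeasure_eq_measure ennreal_mult)
    qed (simp_all add: sets_\<mu>F[OF x])
    then have "emeasure (density (\<mu>F x) (indicator A)) A = emeasure (scale_measure ?c (\<mu>F x)) A"
      by simp
    then have "measure (\<mu>F x) A = measure (\<mu>F x) A * measure (\<mu>F x) A"
      using A' by (simp add: emeasure_restricted X.emeasure_eq_measure ennreal_mult[symmetric])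
    then show "measure (\<mu>F x) A \<in> {0, 1}" by auto
  qed
  ultimately show ?case by blast
qed

section \<open>Null sets, and functions bounded almost everywhere\<close>

lemma AE_pow_T:
  assumes "A \<in> null_sets M"
  shows "AE x in M. \<forall>n. (T i ^^ n) x \<notin> A"
proof (subst AE_all_countable, intro allI)
  fix n
  have A: "A \<in> sets M" using assms by auto
  have "emeasure M ((T i ^^ n) -` A \<inter> space M) = emeasure (distr M M (T i ^^ n)) A"
    by (rule emeasure_distr[symmetric, OF measurable_pow_T A])
  also have "\<dots> = 0" using assms by (simp add: distr_pow_T null_setsD1)
  finally have "(T i ^^ n) -` A \<inter> space M \<in> null_sets M"
    using measurable_sets[OF measurable_pow_T A] by (rule null_setsI)
  then show "AE x in M. (T i ^^ n) x \<notin> A"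
    by (rule AE_I') auto
qed

text \<open>With the indicator of \<open>A\<close> in slot \<open>j\<close> and 1 elsewhere, the
  averages vanish almost everywhere, so the nonnegative limit has integral 0. Single measures
  \<open>\<mu>F x\<close> may well charge null sets of \<open>M\<close> in a coordinate, so this can
  hold only for almost every \<open>x\<close>.\<close>

lemma AE_marginal:
  assumes j: "j \<in> D" and A: "A \<in> null_sets M"
  shows "AE x in M. AE \<xi> in \<mu>F x. \<xi> j \<notin> A"
proof -
  define f where "f i = (if i = j then indicator A else (\<lambda>_. 1 :: real))" for i
  have [measurable]: "A \<in> sets M" using A by auto
  have tuple: "bounded_tuple f"
    unfolding bounded_tuple_def
  proof (intro ballI conjI exI allI)
    have "(indicator A :: 'a \<Rightarrow> real) \<in> borel_measurable M" "(\<lambda>_. 1 :: real) \<in> borel_measurable M"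
      by (rule borel_measurable_indicator[OF \<open>A \<in> sets M\<close>], rule borel_measurable_const)
    then show "f i \<in> borel_measurable M" for i
      by (cases "i = j") (simp_all only: f_def if_True if_False simp_thms)
    show "norm (f i x) \<le> 1" for i x by (simp add: f_def indicator_def)
  qed
  have prod: "(\<Prod>i\<in>D. f i (w i)) = indicator A (w j)" for w
    using j by (subst prod.remove[OF finite_D j]) (simp add: f_def)
  have zero: "(\<integral>x. mavg D f a N x \<partial>M) = 0" for a N
  proof -
    have "AE x in M. \<forall>n. (T j ^^ n) x \<notin> A"
      by (rule AE_pow_T[OF A])
    then have "AE x in M. mavg D f a N x = 0"
      by eventually_elim (simp add: mavg_def prod)
    then show ?thesis by (rule integral_eq_zero_AE)
  qed
  have "(\<lambda>N. \<integral>x. mavg D f 0 N x \<partial>M) \<longlonglongrightarrow> (\<integral>x. mean_limit f x \<partial>M)"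
    by (rule window_conv_integral[OF window_convergence_real[OF tuple] integrable_tuple[OF tuple]])
  then have "(\<integral>x. mean_limit f x \<partial>M) = 0"
    unfolding zero by (simp add: LIMSEQ_const_iff)
  moreover have "0 \<le> mean_limit f x" for x
    by (simp add: mean_limit_def prod)
  ultimately have "AE x in M. mean_limit f x = 0"
    using integrable_tuple(2)[OF tuple] by (subst integral_nonneg_eq_0_iff_AE[symmetric]) auto
  then show ?thesis
    using AE_space
  proof eventually_elim
    case (elim x)
    have "integrable (\<mu>F x) (\<lambda>\<xi>. indicator A (\<xi> j) :: real)"
      using integrable_prod_tuple[OF elim(2) tuple] by (simp add: prod)
    moreover have "(\<integral>\<xi>. indicator A (\<xi> j) \<partial>\<mu>F x) = (0 :: real)"
      using elim(1) by (simp add: mean_limit_def prod)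
    ultimately have "AE \<xi> in \<mu>F x. indicator A (\<xi> j) = (0 :: real)"
      by (subst integral_nonneg_eq_0_iff_AE[symmetric]) auto
    then show ?case by eventually_elim (simp add: indicator_eq_0_iff)
  qed
qed

end

section \<open>The theorem\<close>

lemma measure_preserving_cong:
  assumes "\<And>x. x \<in> space N \<Longrightarrow> f x = g x"
  shows "measure_preserving N f \<longleftrightarrow> measure_preserving N g"
  unfolding measure_preserving_def using assms
  by (simp cong: measurable_cong distr_cong)

lemma ergodic_under_cong:
  assumes "\<And>x. x \<in> space N \<Longrightarrow> f x = g x"
  shows "ergodic_under N {f} \<longleftrightarrow> ergodic_under N {g}"
proof -
  have "f -` A \<inter> space N = g -` A \<inter> space N" for A
    using assms by auto
  then show ?thesis by (simp add: ergodic_under_def)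
qed

context limit_kernel
begin

text \<open>Truncation changes each function on a null set only. Almost every orbit avoids these
  sets, and by \<open>AE_marginal\<close> so do almost all coordinates under
  \<open>\<mu>F x\<close>; averages and integrals are therefore those of the given
  representatives.\<close>

theorem Linfty_averages:
  fixes f :: "nat \<Rightarrow> 'a \<Rightarrow> complex"
  assumes f: "\<And>i. i \<in> D \<Longrightarrow> f i \<in> Linfty M"
  shows "\<exists>g. tendsto_L2 M (mavg D f 0) g \<and>
    (AE x in M. integrable (\<mu>F x) (\<lambda>\<xi>. \<Prod>i\<in>D. f i (\<xi> i)) \<and> g x = (\<integral>\<xi>. (\<Prod>i\<in>D. f i (\<xi> i)) \<partial>\<mu>F x))"
proof -
  have f_meas: "f i \<in> borel_measurable M" if "i \<in> D" for i
    using f[OF that] by (simp add: Linfty_def)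
  have "\<forall>i. \<exists>C. i \<in> D \<longrightarrow> (AE x in M. norm (f i x) \<le> C)"
    using f by (auto simp: Linfty_def)
  from choice[OF this] obtain C where C: "\<And>i. i \<in> D \<Longrightarrow> AE x in M. norm (f i x) \<le> C i"
    by blast
  define f' where "f' i x = (if norm (f i x) \<le> C i then f i x else 0)" for i x
  have tuple: "bounded_tuple f'"
    unfolding bounded_tuple_def
  proof (intro ballI conjI exI allI)
    fix i assume "i \<in> D"
    note [measurable] = f_meas[OF this]
    show "f' i \<in> borel_measurable M" unfolding f'_def by measurable
    show "norm (f' i x) \<le> \<bar>C i\<bar>" for x by (auto simp: f'_def)
  qed
  have f'_meas: "f' i \<in> borel_measurable M" if "i \<in> D" for i
    using tuple that by (simp add: bounded_tuple_def)
  obtain B where B: "B > 0" "\<And>w. norm (\<Prod>i\<in>D. f' i (w i)) \<le> B"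
    by (rule bounded_tuple_prod[OF tuple]) auto
  define Z where "Z i = {x \<in> space M. f i x \<noteq> f' i x}" for i
  have Z: "Z i \<in> null_sets M" if "i \<in> D" for i
  proof -
    note [measurable] = f_meas[OF that] f'_meas[OF that]
    have "Z i \<in> sets M" unfolding Z_def by measurable
    moreover have "AE x in M. x \<notin> Z i"
      using C[OF that] by eventually_elim (simp add: Z_def f'_def)
    ultimately show ?thesis by (simp add: AE_iff_null_sets)
  qed
  let ?u = "\<lambda>N. mavg D f 0 N" and ?u' = "\<lambda>N. mavg D f' 0 N" and ?g = "mean_limit f'"
  have u_meas: "?u N \<in> borel_measurable M" for N
    by (rule mavg_measurable) (rule f_meas)
  have u'_meas: "?u' N \<in> borel_measurable M" for N
    by (rule mavg_measurable) (rule f'_meas)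
  have u'_le: "norm (?u' N x) \<le> B" for N x
    by (rule norm_mavg_le) (rule B(2))
  have g_meas: "?g \<in> borel_measurable M"
    by (rule measurable_mean_limit[OF tuple])
  have g_le: "norm (?g x) \<le> B" if "x \<in> space M" for x
    by (rule norm_mean_limit_le[OF that tuple B(2)])
  have "AE x in M. \<forall>i\<in>D. \<forall>n. (T i ^^ n) x \<notin> Z i"
    by (rule AE_finite_allI[OF finite_D]) (rule AE_pow_T[OF Z])
  then have u_eq: "AE x in M. ?u N x = ?u' N x" for N
    using AE_space
  proof eventually_elim
    case (elim x)
    have "f i ((T i ^^ n) x) = f' i ((T i ^^ n) x)" if "i \<in> D" for i n
      using elim that measurable_space[OF measurable_pow_T elim(2)] by (auto simp: Z_def)
    then show ?case by (simp add: mavg_def)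
  qed
  have sq: "(norm z)\<^sup>2 \<le> B\<^sup>2" if "norm z \<le> B" for z :: complex
    using that by (intro power_mono) auto
  have "tendsto_L2 M ?u ?g"
    unfolding tendsto_L2_def L2_def mem_Collect_eq
  proof (intro conjI allI)
    fix N
    have "integrable M (\<lambda>x. (norm (?u' N x))\<^sup>2)"
      by (rule integrable_bounded[where C = "B\<^sup>2"])
         (use u'_meas sq[OF u'_le] in auto)
    moreover have "AE x in M. (norm (?u N x))\<^sup>2 = (norm (?u' N x))\<^sup>2"
      using u_eq[of N] by eventually_elim simp
    ultimately show "integrable M (\<lambda>x. (norm (?u N x))\<^sup>2)"
      using u_meas[of N] u'_meas[of N] by (subst integrable_cong_AE) auto
  next
    show "integrable M (\<lambda>x. (norm (?g x))\<^sup>2)"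
      by (rule integrable_const_bound[where B = "B\<^sup>2"]) (use g_meas sq[OF g_le] in auto)
    have int: "integrable M (\<lambda>x. norm (?u' N x - ?g x))" for N
      by (intro integrable_norm Bochner_Integration.integrable_diff integrable_tuple tuple)
    \<comment> \<open>Both functions are bounded by \<open>B\<close>, so one factor of the square is
      at most \<open>2 * B\<close> and \<open>L\<^sup>1\<close> convergence suffices. The tolerance
      \<open>r / (4 * B)\<close> below makes the product \<open>r / 2\<close>.\<close>
    have le: "(\<integral>x. (norm (?u N x - ?g x))\<^sup>2 \<partial>M) \<le> 2 * B * (\<integral>x. norm (?u' N x - ?g x) \<partial>M)" for N
    proof -
      have "(\<integral>x. (norm (?u N x - ?g x))\<^sup>2 \<partial>M) = (\<integral>x. (norm (?u' N x - ?g x))\<^sup>2 \<partial>M)"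
      proof (rule integral_cong_AE)
        note [measurable] = u_meas u'_meas g_meas
        show "(\<lambda>x. (norm (?u N x - ?g x))\<^sup>2) \<in> borel_measurable M"
          "(\<lambda>x. (norm (?u' N x - ?g x))\<^sup>2) \<in> borel_measurable M" by measurable
        show "AE x in M. (norm (?u N x - ?g x))\<^sup>2 = (norm (?u' N x - ?g x))\<^sup>2"
          using u_eq[of N] by eventually_elim simp
      qed
      also have "\<dots> \<le> (\<integral>x. 2 * B * norm (?u' N x - ?g x) \<partial>M)"
      proof (rule integral_mono')
        show "integrable M (\<lambda>x. 2 * B * norm (?u' N x - ?g x))"
          using int by (rule integrable_mult_right)
        fix x assume x: "x \<in> space M"
        have "norm (?u' N x - ?g x) \<le> 2 * B"
          using norm_triangle_ineq4[of "?u' N x" "?g x"] u'_le[of N x] g_le[OF x] by linarith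
        then show "(norm (?u' N x - ?g x))\<^sup>2 \<le> 2 * B * norm (?u' N x - ?g x)"
          unfolding power2_eq_square by (rule mult_right_mono) simp
        show "0 \<le> 2 * B * norm (?u' N x - ?g x)" using B(1) by simp
      qed
      finally show ?thesis by simp
    qed
    show "(\<lambda>N. \<integral>x. (norm (?u N x - ?g x))\<^sup>2 \<partial>M) \<longlonglongrightarrow> 0"
    proof (rule LIMSEQ_I)
      fix r :: real assume "r > 0"
      then have pos: "r / (4 * B) > 0" using B(1) by simp
      obtain N0 where
        N0: "\<And>N a. N \<ge> N0 \<Longrightarrow> (\<integral>x. norm (mavg D f' a N x - ?g x) \<partial>M) \<le> r / (4 * B)"
        by (rule window_convE[OF window_convergence[OF tuple] pos]) (rule that)
      have "norm ((\<integral>x. (norm (?u N x - ?g x))\<^sup>2 \<partial>M) - 0) < r" if "N \<ge> N0" for N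
      proof -
        have "(\<integral>x. (norm (?u N x - ?g x))\<^sup>2 \<partial>M) \<le> 2 * B * (r / (4 * B))"
          using le[of N] mult_left_mono[OF N0[OF that, of 0], of "2 * B"] B(1) by linarith
        also have "\<dots> < r" using B(1) \<open>r > 0\<close> by simp
        finally show ?thesis by simp
      qed
      then show "\<exists>N0. \<forall>N\<ge>N0. norm ((\<integral>x. (norm (?u N x - ?g x))\<^sup>2 \<partial>M) - 0) < r" by blast
    qed
  qed (fact u_meas g_meas)+
  moreover have "AE x in M. integrable (\<mu>F x) (\<lambda>\<xi>. \<Prod>i\<in>D. f i (\<xi> i)) \<and>
      ?g x = (\<integral>\<xi>. (\<Prod>i\<in>D. f i (\<xi> i)) \<partial>\<mu>F x)"
  proof -
    have "AE x in M. \<forall>i\<in>D. AE \<xi> in \<mu>F x. \<xi> i \<notin> Z i"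
      by (rule AE_finite_allI[OF finite_D]) (rule AE_marginal[OF _ Z])
    then show ?thesis
      using AE_space
    proof eventually_elim
      case (elim x)
      have meas: "(\<lambda>\<xi>. \<Prod>i\<in>D. f i (\<xi> i)) \<in> borel_measurable (\<mu>F x)"
      proof (rule borel_measurable_prod)
        fix i assume i: "i \<in> D"
        have "(\<lambda>\<xi>. f i (\<xi> i)) \<in> borel_measurable PX"
          by (rule measurable_compose[OF measurable_component_singleton[OF i] f_meas[OF i]])
        then show "(\<lambda>\<xi>. f i (\<xi> i)) \<in> borel_measurable (\<mu>F x)"
          by (simp cong: measurable_cong_sets add: sets_\<mu>F[OF elim(2)])
      qed
      have meas': "(\<lambda>\<xi>. \<Prod>i\<in>D. f' i (\<xi> i)) \<in> borel_measurable (\<mu>F x)"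
        using measurable_prod_tuple[OF tuple] by (simp cong: measurable_cong_sets add: sets_\<mu>F[OF elim(2)])
      have "AE \<xi> in \<mu>F x. \<forall>i\<in>D. \<xi> i \<notin> Z i"
        by (rule AE_finite_allI[OF finite_D]) (use elim(1) in blast)
      then have eq: "AE \<xi> in \<mu>F x. (\<Prod>i\<in>D. f i (\<xi> i)) = (\<Prod>i\<in>D. f' i (\<xi> i))"
        using AE_space
      proof eventually_elim
        case (elim \<xi>)
        have "\<xi> i \<in> space M" if "i \<in> D" for i
          using elim(2) that by (auto simp: space_\<mu>F[OF \<open>x \<in> space M\<close>] space_PiM)
        then show ?case using elim(1) by (intro prod.cong) (auto simp: Z_def)
      qed
      show ?case
        using integrable_cong_AE[OF meas meas' eq] integral_cong_AE[OF meas meas' eq]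
          integrable_prod_tuple[OF elim(2) tuple] by (simp add: mean_limit_def)
    qed
  qed
  ultimately show ?thesis by blast
qed

end

theorem theorem1p2:
  fixes M :: "'a measure" and d :: nat and T :: "nat \<Rightarrow> 'a \<Rightarrow> 'a"
  assumes "ergodic_commuting_system M d T"
  shows "\<exists>\<mu>F :: 'a \<Rightarrow> (nat \<Rightarrow> 'a) measure.
      (\<forall>x\<in>space M. prob_space (\<mu>F x) \<and> sets (\<mu>F x) = sets (power_space M d)) \<and>
      (AE x in M. measure_preserving (\<mu>F x) (product_map d T) \<and>
                  ergodic_under (\<mu>F x) {product_map d T}) \<and>
      (\<forall>f. (\<forall>i\<in>{1..d}. f i \<in> Linfty M) \<longrightarrow>
         (\<exists>g. tendsto_L2 M (multiple_average d T f) g \<and>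
              (AE x in M. integrable (\<mu>F x) (tensor d f) \<and>
                          g x = (\<integral>\<omega>. tensor d f \<omega> \<partial>\<mu>F x))))"
proof -
  interpret ergodic_commuting_system M d T by (rule assms)
  let ?D = "{1..d}"
  have T_meas: "T i \<in> measurable M M" and T_distr: "distr M M (T i) = M" if "i \<in> ?D" for i
    using preserving[OF that] by (auto simp: measure_preserving_def)
  \<comment> \<open>Outside \<open>space M\<close> the maps of the system are arbitrary; replacing them by the identity there
    makes them commuting bijections of the whole type.\<close>
  define T' where "T' i x = (if i \<in> ?D \<and> x \<in> space M then T i x else x)" for i x
  define S' where "S' i x = (if i \<in> ?D \<and> x \<in> space M then the_inv_into (space M) (T i) x else x)" for i x
  have T_space: "T i x \<in> space M" if "i \<in> ?D" "x \<in> space M" for i x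
    using measurable_space[OF T_meas[OF that(1)] that(2)] .
  have S_space: "the_inv_into (space M) (T i) x \<in> space M" if "i \<in> ?D" "x \<in> space M" for i x
    using measurable_space[OF inverse_measurable[OF that(1)] that(2)] .
  have T'_meas: "T' i \<in> measurable M M" for i
  proof (cases "i \<in> ?D")
    case True
    then show ?thesis
      using T_meas[OF True] by (subst measurable_cong[of M _ "T i"]) (auto simp: T'_def)
  next
    case False
    then have "T' i = (\<lambda>x. x)" by (auto simp: T'_def)
    then show ?thesis by simp
  qed
  have S'_meas: "S' i \<in> measurable M M" for i
  proof (cases "i \<in> ?D")
    case True
    then show ?thesis
      using inverse_measurable[OF True]
      by (subst measurable_cong[of M _ "the_inv_into (space M) (T i)"]) (auto simp: S'_def)
  next
    case False
    then have "S' i = (\<lambda>x. x)" by (auto simp: S'_def)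
    then show ?thesis by simp
  qed
  have ST: "S' i (T' i x) = x" for i x
    using invertible[of i] by (auto simp: S'_def T'_def T_space bij_betw_def the_inv_into_f_f)
  have TS: "T' i (S' i x) = x" for i x
    using invertible[of i] by (auto simp: S'_def T'_def S_space bij_betw_def f_the_inv_into_f)
  have TT: "T' i (T' j x) = T' j (T' i x)" for i j x
    using commute[of i j x] by (auto simp: T'_def T_space)
  have T'_distr: "distr M M (T' i) = M" for i
  proof (cases "i \<in> ?D")
    case True
    have "distr M M (T' i) = distr M M (T i)"
      by (rule distr_cong) (use True in \<open>auto simp: T'_def\<close>)
    then show ?thesis using T_distr[OF True] by simp
  next
    case False
    then have "T' i = (\<lambda>x. x)" by (auto simp: T'_def)
    then show ?thesis by (simp add: distr_id[unfolded id_def])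
  qed
  obtain \<phi> :: "'a \<Rightarrow> nat \<times> nat \<Rightarrow> bool" and \<rho>
    where \<phi>: "\<And>p. {x \<in> space M. \<phi> x p} \<in> sets M" and \<rho>: "\<rho> \<in> measurable cantor M"
      and \<rho>\<phi>: "\<And>x. x \<in> space M \<Longrightarrow> \<rho> (\<phi> x) = x"
    by (rule standard_borel_retract[OF standard not_empty]) (rule that)
  interpret coded_prob M T' S' ?D \<phi>
    by unfold_locales (fact T'_meas S'_meas ST TS TT T'_distr \<phi> finite_atLeastAtMost)+
  obtain \<kappa> where \<kappa>: "\<kappa> \<in> measurable M (prob_algebra cantor)"
    and \<kappa>_lim: "\<forall>P. finite P \<longrightarrow> window_conv (code_avg P) (\<lambda>x. measure (\<kappa> x) (cylinder P))"
    using ex_kernel by blast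
  interpret limit_kernel M T' S' ?D \<phi> \<kappa> \<rho>
    by unfold_locales (use \<kappa> \<kappa>_lim \<rho> \<rho>\<phi> in blast)+
  \<comment> \<open>The maps agree on the product space only, which is enough, since measure
    preservation and ergodicity refer to points of the space alone.\<close>
  have pmap_eq: "pmap \<xi> = product_map d T \<xi>" if "\<xi> \<in> space (power_space M d)" for \<xi>
    using that unfolding pmap_def product_map_def by (auto simp: T'_def space_PiM PiE_iff restrict_def)
  have pow_eq: "(T' i ^^ n) x = (T i ^^ n) x" if "i \<in> ?D" "x \<in> space M" for i n x
  proof (induction n)
    case (Suc n)
    have "(T' i ^^ n) x \<in> space M" using measurable_space[OF measurable_pow_T that(2)] .
    then show ?case using Suc that(1) by (simp add: T'_def)
  qed simp
  have avg_eq: "mavg ?D f 0 N x = multiple_average d T f N x" if "x \<in> space M" for f N x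
    using pow_eq[OF _ that] by (simp add: mavg_def multiple_average_def atLeast0LessThan del: One_nat_def)
  show ?thesis
  proof (intro exI[of _ \<mu>F] conjI ballI allI impI)
    show "prob_space (\<mu>F x)" "sets (\<mu>F x) = sets (power_space M d)" if "x \<in> space M" for x
      using prob_space_\<mu>F[OF that] sets_\<mu>F[OF that] .
    show "AE x in M. measure_preserving (\<mu>F x) (product_map d T) \<and> ergodic_under (\<mu>F x) {product_map d T}"
      using AE_ergodic AE_space
    proof eventually_elim
      case (elim x)
      have eq: "pmap \<xi> = product_map d T \<xi>" if "\<xi> \<in> space (\<mu>F x)" for \<xi>
        using that unfolding space_\<mu>F[OF elim(2)] by (rule pmap_eq)
      show ?case
        using elim(1)
          measure_preserving_cong[where N = "\<mu>F x" and f = pmap and g = "product_map d T", OF eq]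
          ergodic_under_cong[where N = "\<mu>F x" and f = pmap and g = "product_map d T", OF eq]
        by blast
    qed
    fix f :: "nat \<Rightarrow> 'a \<Rightarrow> complex" assume "\<forall>i\<in>?D. f i \<in> Linfty M"
    then obtain g where g: "tendsto_L2 M (mavg ?D f 0) g"
      "AE x in M. integrable (\<mu>F x) (\<lambda>\<xi>. \<Prod>i\<in>?D. f i (\<xi> i)) \<and> g x = (\<integral>\<xi>. (\<Prod>i\<in>?D. f i (\<xi> i)) \<partial>\<mu>F x)"
      using Linfty_averages[of f] by blast
    have "mavg ?D f 0 N \<in> borel_measurable M \<longleftrightarrow> multiple_average d T f N \<in> borel_measurable M" for N
      by (rule measurable_cong) (rule avg_eq)
    moreover have "integrable M (\<lambda>x. (norm (mavg ?D f 0 N x))\<^sup>2) \<longleftrightarrow>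
        integrable M (\<lambda>x. (norm (multiple_average d T f N x))\<^sup>2)" for N
      by (rule Bochner_Integration.integrable_cong) (simp_all add: avg_eq del: One_nat_def)
    ultimately have "mavg ?D f 0 N \<in> L2 M \<longleftrightarrow> multiple_average d T f N \<in> L2 M" for N
      unfolding L2_def mem_Collect_eq by blast
    moreover have "(\<integral>x. (norm (mavg ?D f 0 N x - g x))\<^sup>2 \<partial>M) = (\<integral>x. (norm (multiple_average d T f N x - g x))\<^sup>2 \<partial>M)" for N
      by (rule Bochner_Integration.integral_cong) (simp_all add: avg_eq del: One_nat_def)
    ultimately have "tendsto_L2 M (multiple_average d T f) g"
      using g(1) by (simp add: tendsto_L2_def del: One_nat_def)
    moreover have "tensor d f = (\<lambda>\<xi>. \<Prod>i\<in>?D. f i (\<xi> i))" by (simp add: tensor_def[abs_def] del: One_nat_def)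
    ultimately show "\<exists>g. tendsto_L2 M (multiple_average d T f) g \<and>
        (AE x in M. integrable (\<mu>F x) (tensor d f) \<and> g x = (\<integral>\<omega>. tensor d f \<omega> \<partial>\<mu>F x))"
      using g(2) by (intro exI[of _ g]) (simp del: One_nat_def)
  qed
qed

end
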